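(* If $A\vdash B$ is derivable in $\texttt{hol.mm}$, then $\vdash{\cal S}_\epsilon(A\vdash B)$, i.e. $\vdash(\mathrm{Ch}(\epsilon)\wedge\mathrm{toWff}({\cal S}_\epsilon(A)))\to\mathrm{toWff}({\cal S}_\epsilon(B))$, is derivable in $\texttt{set.mm}$ (with the hypotheses that the type variables occurring are types made explicit). In particular, if $A\vdash B$ does not contain the indefinite descriptor $\epsilon$, then $\vdash\mathrm{toWff}({\cal S}(A))\to\mathrm{toWff}({\cal S}(B))$ is derivable in $\texttt{set.mm}$, where ${\cal S}$ denotes ${\cal S}_\epsilon$ (which then does not depend on $\epsilon$).
   Context: $\texttt{set.mm}$ is the Metamath formalization of classical first-order logic with ZFC set theory (including the axiom of choice). $\texttt{hol.mm}$ is a Metamath axiomatization of HOL: metavariables for types (Greek), vars (lowercase, replaceable only by vars) and terms (capitals); terms are $\top$, context conjunctions $(R,S)$, applications $F\,T$, variable terms $x^\alpha$, abstractions $\lambda x^\alpha.\,T$, the equality constant ${=}_\alpha:\alpha\to(\alpha\to\mathsf{bool})$, the indefinite descriptor $\epsilon_\alpha:(\alpha\to\mathsf{bool})\to\alpha$, and defined constants; type constants $\mathsf{bool}$, $\mathsf{ind}$, and $\alpha\to\beta$; judgments $A:\alpha$ and $R\vdash S$. Its rules are: wtru $\top:\mathsf{bool}$; wct $R,S:\mathsf{bool}\Rightarrow(R,S):\mathsf{bool}$; wc $F:\alpha\to\beta,T:\alpha\Rightarrow F\,T:\beta$; wv $x^\alpha:\alpha$; wl $T:\beta\Rightarrow(\lambda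 x^\alpha.\,T):\alpha\to\beta$; weq ${=}:\alpha\to(\alpha\to\mathsf{bool})$; id $R:\mathsf{bool}\Rightarrow R\vdash R$; syl $R\vdash S,S\vdash T\Rightarrow R\vdash T$; jca $R\vdash S,R\vdash T\Rightarrow R\vdash(S,T)$; simpl/simpr $R,S:\mathsf{bool}\Rightarrow(R,S)\vdash R$ / $(R,S)\vdash S$; trud $R:\mathsf{bool}\Rightarrow R\vdash\top$; refl $A:\alpha\Rightarrow\top\vdash A=A$; eqmp $R\vdash A,R\vdash A=B\Rightarrow R\vdash B$; ded $(R,S)\vdash T,(R,T)\vdash S\Rightarrow R\vdash S=T$; ceq $F:\alpha\to\beta,A:\alpha,R\vdash F=G,R\vdash A=B\Rightarrow R\vdash F\,A=G\,B$; leq $R\vdash A=B\Rightarrow R\vdash(\lambda x^\alpha.\,A)=(\lambda x^\alpha.\,B)$ ($x$ not in $R$); hbl1 $A:\gamma,B:\alpha\Rightarrow\top\vdash(\lambda x^\alpha.\,\lambda x^\beta.\,A)\,B=\lambda x^\beta.\,A$; distrc $B:\alpha,F:\beta\to\gamma\Rightarrow\top\vdash(\lambda x^\alpha.\,F\,A)\,B=((\lambda x^\alpha.\,F)\,B)((\lambda x^\alpha.\,A)\,B)$; ax-17 $A:\beta,B:\alpha\Rightarrow\top\vdash(\lambda x^\alpha.\,A)\,B=A$ ($x$ not in $A$); distrl $A:\gamma,B:\alpha\Rightarrow\top\vdash(\lambda x^\alpha.\,\lambda y^\beta.\,A)\,B=\lambda y^\beta.\,((\lambda x^\alpha.\,A)\,B)$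 ($y\ne x$, $y$ not in $B$); beta $A:\beta\Rightarrow\top\vdash(\lambda x^\alpha.\,A)\,x^\alpha=A$; inst: from $\top\vdash(\lambda x^\alpha.\,B)\,y^\alpha=B$, $\top\vdash(\lambda x^\alpha.\,S)\,y^\alpha=S$, $x^\alpha=C\vdash A=B$, $x^\alpha=C\vdash R=S$, $R\vdash A$ infer $S\vdash B$; and axioms eta $\top\vdash\forall f^{\alpha\to\beta}.\,(\lambda x^\alpha.\,f\,x^\alpha)=f$, ac $\top\vdash\forall p^{\alpha\to\mathsf{bool}}.\,\forall x^\alpha.\,(p\,x\Rightarrow p\,(\epsilon\,p))$, inf $\top\vdash\exists f^{\mathsf{ind}\to\mathsf{ind}}.\,(\mathsf{injective}\,f\wedge\neg\mathsf{surjective}\,f)$ (logical constants defined in the standard HOL way). Rules are applied by uniform direct substitution respecting the provisos. Every type variable carries an implicit hypothesis that it is a type. \textbf{The model ${\cal S}_\epsilon$.} A \emph{type} is a pair $\alpha=\langle\iota_\alpha,b_\alpha\rangle$ with $b_\alpha\in V_{\omega+\omega}$ and $\iota_\alpha\in b_\alpha$ (witness and base set); $\alpha\in\mathrm{Type}$ means this. $\mathrm{Ch}(\epsilon)$ means: either $\epsilon$ is a choice function on $V_{\omega+\omega}$, or no such function exists. $\mathrm{toWff}(A)\iff A=1$ and $\mathrm{toBool}(\varphi)=\mathrm{if}(\varphi,1,0)$. ${\cal S}_\epsilon$ maps: $\mathsf{bool}\mapsto\langle1,\{0,1\}\rangle$; $\mathsf{ind}\mapsto\langle0,\omega\rangle$;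 $\top\mapsto1$; the judgment "$\alpha$ is a type" $\mapsto\alpha\in\mathrm{Type}$; $x^\alpha\mapsto\mathrm{if}(x\in b_\alpha,x,\iota_\alpha)$; $\alpha\to\beta\mapsto\langle(x\in b_\alpha\mapsto\iota_\beta),b_\beta^{b_\alpha}\rangle$; $F\,A\mapsto F(A)$ (function application); $\lambda x^\alpha.\,A\mapsto(x\in b_\alpha\mapsto A)$; $(A,B)\mapsto\mathrm{toBool}(\mathrm{toWff}(A)\wedge\mathrm{toWff}(B))$; $A:\alpha\mapsto A\in b_\alpha$; $A\vdash B\mapsto\ \vdash(\mathrm{Ch}(\epsilon)\wedge\mathrm{toWff}(A))\to\mathrm{toWff}(B)$; ${=}_\alpha\mapsto(x\in b_\alpha\mapsto(y\in b_\alpha\mapsto\mathrm{toBool}(x=y)))$; $\epsilon_\alpha\mapsto(f\in\{0,1\}^{b_\alpha}\mapsto\mathrm{if}(\forall x\in b_\alpha.\,f(x)=0,\ \iota_\alpha,\ \epsilon(\{x\in b_\alpha:f(x)=1\})))$; the type-definition statement $\mathrm{TD}_{\beta,A,R}(F,B)$ (for a new type $\beta$ carved out of $\alpha$ by predicate $F$ with witness $B$) maps to the assertion $\beta=\langle B,\{x\in b_\alpha:\mathrm{toWff}(F(x))\}\rangle$, $A=(x\in b_\alpha\mapsto\mathrm{if}(x\in b_\beta,x,B))$, $R=(x\in b_\beta\mapsto x)$. Here all components are applied recursively to subterms.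
   Formalization: Some listed rules are unsound as they stand and are mended: beta requires that x is not free in A at a type other than α; inst requires y ≠ x and x not in C; distrc requires A:β; the bound variables in eta and in ac are distinct. *)

theory Defs
  imports Main
begin

section \<open>The language and the axioms of set.mm\<close>

text \<open>
  Formulas and class terms over the primitives of set.mm: implication, negation, universal
  quantification, equality and membership of classes, set variables and class abstractions.
  Every other connective and class constructor is an abbreviation, i.e. definitions of set.mm are
  expanded.  Metavariables of set.mm are read as ranging over this object language.

  There are infinitely many set variables.  They come in three disjoint supplies so that the
  vars and the type variables of hol.mm can be used as set variables and infinitely many remain
  for other purposes (bound variables of defined notions, the choice function).
\<close>

datatype svar = HolVar nat | HolTyp nat | Aux nat

datatype wff =
    wi wff wff           (infixr \<open>\<^bold>\<rightarrow>\<close> 25)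
  | wn wff               (\<open>\<^bold>\<not> _\<close> [60] 60)
  | wal svar wff         (\<open>\<^bold>\<forall>_\<^bold>. _\<close> [1000, 60] 60)
  | wceq cls cls         (infix \<open>\<^bold>=\<close> 65)
  | wcel cls cls         (infix \<open>\<^bold>\<in>\<close> 65)
and cls =
    cv svar
  | cab svar wff

definition wa :: "wff \<Rightarrow> wff \<Rightarrow> wff" (infixr \<open>\<^bold>\<and>\<close> 35)
  where "(\<phi> \<^bold>\<and> \<psi>) = \<^bold>\<not> (\<phi> \<^bold>\<rightarrow> \<^bold>\<not> \<psi>)"

definition wo :: "wff \<Rightarrow> wff \<Rightarrow> wff" (infixr \<open>\<^bold>\<or>\<close> 30)
  where "(\<phi> \<^bold>\<or> \<psi>) = (\<^bold>\<not> \<phi> \<^bold>\<rightarrow> \<psi>)"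

definition wb :: "wff \<Rightarrow> wff \<Rightarrow> wff" (infix \<open>\<^bold>\<leftrightarrow>\<close> 25)
  where "(\<phi> \<^bold>\<leftrightarrow> \<psi>) = ((\<phi> \<^bold>\<rightarrow> \<psi>) \<^bold>\<and> (\<psi> \<^bold>\<rightarrow> \<phi>))"

definition wex :: "svar \<Rightarrow> wff \<Rightarrow> wff" (\<open>\<^bold>\<exists>_\<^bold>. _\<close> [1000, 60] 60)
  where "\<^bold>\<exists>x\<^bold>. \<phi> = \<^bold>\<not> (\<^bold>\<forall>x\<^bold>. \<^bold>\<not> \<phi>)"

text \<open>Proper substitution of \<open>x\<close> for \<open>y\<close>, as in the set.mm definition df-sb.\<close>

definition wsb :: "svar \<Rightarrow> svar \<Rightarrow> wff \<Rightarrow> wff"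
  where "wsb x y \<phi> = ((cv y \<^bold>= cv x \<^bold>\<rightarrow> \<phi>) \<^bold>\<and> \<^bold>\<exists>y\<^bold>. (cv y \<^bold>= cv x \<^bold>\<and> \<phi>))"

text \<open>All variables occurring in an expression, bound ones included: the distinct variable
  conditions of Metamath forbid any occurrence.\<close>

primrec wvars :: "wff \<Rightarrow> svar set" and cvars :: "cls \<Rightarrow> svar set"
  where
    "wvars (\<phi> \<^bold>\<rightarrow> \<psi>) = wvars \<phi> \<union> wvars \<psi>"
  | "wvars (\<^bold>\<not> \<phi>) = wvars \<phi>"
  | "wvars (\<^bold>\<forall>x\<^bold>. \<phi>) = insert x (wvars \<phi>)"
  | "wvars (A \<^bold>= B) = cvars A \<union> cvars B"
  | "wvars (A \<^bold>\<in> B) = cvars A \<union> cvars B"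
  | "cvars (cv x) = {x}"
  | "cvars (cab x \<phi>) = insert x (wvars \<phi>)"

text \<open>
  The axioms carry their set.mm names.  Some of them (ax-sep, ax-nul, ax-pr, ax-inf2) are
  redundant but are stated as axioms in set.mm as well; the Tarski-Grothendieck axiom, which goes
  beyond ZFC, is left out.
\<close>

inductive setmm :: "wff \<Rightarrow> bool"
  where
    ax_mp: "setmm \<phi> \<Longrightarrow> setmm (\<phi> \<^bold>\<rightarrow> \<psi>) \<Longrightarrow> setmm \<psi>"
  | ax_gen: "setmm \<phi> \<Longrightarrow> setmm (\<^bold>\<forall>x\<^bold>. \<phi>)"
  | ax_1: "setmm (\<phi> \<^bold>\<rightarrow> \<psi> \<^bold>\<rightarrow> \<phi>)"
  | ax_2: "setmm ((\<phi> \<^bold>\<rightarrow> \<psi> \<^bold>\<rightarrow> \<chi>) \<^bold>\<rightarrow> (\<phi> \<^bold>\<rightarrow> \<psi>) \<^bold>\<rightarrow> \<phi> \<^bold>\<rightarrow> \<chi>)"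
  | ax_3: "setmm ((\<^bold>\<not> \<phi> \<^bold>\<rightarrow> \<^bold>\<not> \<psi>) \<^bold>\<rightarrow> \<psi> \<^bold>\<rightarrow> \<phi>)"
  | ax_4: "setmm (\<^bold>\<forall>x\<^bold>. (\<phi> \<^bold>\<rightarrow> \<psi>) \<^bold>\<rightarrow> \<^bold>\<forall>x\<^bold>. \<phi> \<^bold>\<rightarrow> \<^bold>\<forall>x\<^bold>. \<psi>)"
  | ax_5: "x \<notin> wvars \<phi> \<Longrightarrow> setmm (\<phi> \<^bold>\<rightarrow> \<^bold>\<forall>x\<^bold>. \<phi>)"
  | ax_6: "setmm (\<^bold>\<not> (\<^bold>\<forall>x\<^bold>. \<^bold>\<not> (cv x \<^bold>= cv y)))"
  | ax_7: "setmm (cv x \<^bold>= cv y \<^bold>\<rightarrow> cv x \<^bold>= cv z \<^bold>\<rightarrow> cv y \<^bold>= cv z)"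
  | ax_8: "setmm (cv x \<^bold>= cv y \<^bold>\<rightarrow> cv x \<^bold>\<in> cv z \<^bold>\<rightarrow> cv y \<^bold>\<in> cv z)"
  | ax_9: "setmm (cv x \<^bold>= cv y \<^bold>\<rightarrow> cv z \<^bold>\<in> cv x \<^bold>\<rightarrow> cv z \<^bold>\<in> cv y)"
  | ax_10: "setmm (\<^bold>\<not> (\<^bold>\<forall>x\<^bold>. \<phi>) \<^bold>\<rightarrow> \<^bold>\<forall>x\<^bold>. \<^bold>\<not> (\<^bold>\<forall>x\<^bold>. \<phi>))"
  | ax_11: "setmm (\<^bold>\<forall>x\<^bold>. \<^bold>\<forall>y\<^bold>. \<phi> \<^bold>\<rightarrow> \<^bold>\<forall>y\<^bold>. \<^bold>\<forall>x\<^bold>. \<phi>)"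
  | ax_12: "setmm (cv x \<^bold>= cv y \<^bold>\<rightarrow> \<^bold>\<forall>y\<^bold>. \<phi> \<^bold>\<rightarrow> \<^bold>\<forall>x\<^bold>. (cv x \<^bold>= cv y \<^bold>\<rightarrow> \<phi>))"
  | ax_13: "setmm (\<^bold>\<not> (cv x \<^bold>= cv y) \<^bold>\<rightarrow> cv y \<^bold>= cv z \<^bold>\<rightarrow> \<^bold>\<forall>x\<^bold>. (cv y \<^bold>= cv z))"
  | df_clab: "setmm (cv x \<^bold>\<in> cab y \<phi> \<^bold>\<leftrightarrow> wsb x y \<phi>)"
  | df_cleq: "x \<notin> cvars A \<Longrightarrow> x \<notin> cvars B \<Longrightarrow>
      setmm (A \<^bold>= B \<^bold>\<leftrightarrow> \<^bold>\<forall>x\<^bold>. (cv x \<^bold>\<in> A \<^bold>\<leftrightarrow> cv x \<^bold>\<in> B))"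
  | df_clel: "x \<notin> cvars A \<Longrightarrow> x \<notin> cvars B \<Longrightarrow>
      setmm (A \<^bold>\<in> B \<^bold>\<leftrightarrow> \<^bold>\<exists>x\<^bold>. (cv x \<^bold>= A \<^bold>\<and> cv x \<^bold>\<in> B))"
  | ax_ext: "distinct [x, y, z] \<Longrightarrow>
      setmm (\<^bold>\<forall>z\<^bold>. (cv z \<^bold>\<in> cv x \<^bold>\<leftrightarrow> cv z \<^bold>\<in> cv y) \<^bold>\<rightarrow> cv x \<^bold>= cv y)"
  | ax_rep: "distinct [x, y, z, w] \<Longrightarrow>
      setmm (\<^bold>\<forall>w\<^bold>. \<^bold>\<exists>y\<^bold>. \<^bold>\<forall>z\<^bold>. (\<^bold>\<forall>y\<^bold>. \<phi> \<^bold>\<rightarrow> cv z \<^bold>= cv y) \<^bold>\<rightarrow>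
        \<^bold>\<exists>y\<^bold>. \<^bold>\<forall>z\<^bold>. (cv z \<^bold>\<in> cv y \<^bold>\<leftrightarrow> \<^bold>\<exists>w\<^bold>. (cv w \<^bold>\<in> cv x \<^bold>\<and> \<^bold>\<forall>y\<^bold>. \<phi>)))"
  | ax_sep: "distinct [x, y, z] \<Longrightarrow> y \<notin> wvars \<phi> \<Longrightarrow> z \<notin> wvars \<phi> \<Longrightarrow>
      setmm (\<^bold>\<exists>y\<^bold>. \<^bold>\<forall>x\<^bold>. (cv x \<^bold>\<in> cv y \<^bold>\<leftrightarrow> (cv x \<^bold>\<in> cv z \<^bold>\<and> \<phi>)))"
  | ax_nul: "x \<noteq> y \<Longrightarrow> setmm (\<^bold>\<exists>x\<^bold>. \<^bold>\<forall>y\<^bold>. \<^bold>\<not> (cv y \<^bold>\<in> cv x))"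
  | ax_pow: "distinct [x, y, z, w] \<Longrightarrow>
      setmm (\<^bold>\<exists>y\<^bold>. \<^bold>\<forall>z\<^bold>. (\<^bold>\<forall>w\<^bold>. (cv w \<^bold>\<in> cv z \<^bold>\<rightarrow> cv w \<^bold>\<in> cv x) \<^bold>\<rightarrow> cv z \<^bold>\<in> cv y))"
  | ax_pr: "distinct [x, z, w] \<Longrightarrow> distinct [y, z, w] \<Longrightarrow>
      setmm (\<^bold>\<exists>z\<^bold>. \<^bold>\<forall>w\<^bold>. ((cv w \<^bold>= cv x \<^bold>\<or> cv w \<^bold>= cv y) \<^bold>\<rightarrow> cv w \<^bold>\<in> cv z))"
  | ax_un: "distinct [x, y, z, w] \<Longrightarrow>
      setmm (\<^bold>\<exists>y\<^bold>. \<^bold>\<forall>z\<^bold>. (\<^bold>\<exists>w\<^bold>. (cv z \<^bold>\<in> cv w \<^bold>\<and> cv w \<^bold>\<in> cv x) \<^bold>\<rightarrow> cv z \<^bold>\<in> cv y))"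
  | ax_reg: "distinct [x, y, z] \<Longrightarrow>
      setmm (\<^bold>\<exists>y\<^bold>. (cv y \<^bold>\<in> cv x) \<^bold>\<rightarrow>
        \<^bold>\<exists>y\<^bold>. (cv y \<^bold>\<in> cv x \<^bold>\<and> \<^bold>\<forall>z\<^bold>. (cv z \<^bold>\<in> cv y \<^bold>\<rightarrow> \<^bold>\<not> (cv z \<^bold>\<in> cv x))))"
  | ax_inf: "distinct [x, y, z, w] \<Longrightarrow>
      setmm (\<^bold>\<exists>y\<^bold>. (cv x \<^bold>\<in> cv y \<^bold>\<and>
        \<^bold>\<forall>z\<^bold>. (cv z \<^bold>\<in> cv y \<^bold>\<rightarrow> \<^bold>\<exists>w\<^bold>. (cv z \<^bold>\<in> cv w \<^bold>\<and> cv w \<^bold>\<in> cv y))))"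
  | ax_inf2: "distinct [x, y, z, w] \<Longrightarrow>
      setmm (\<^bold>\<exists>x\<^bold>. (\<^bold>\<exists>y\<^bold>. (cv y \<^bold>\<in> cv x \<^bold>\<and> \<^bold>\<forall>z\<^bold>. \<^bold>\<not> (cv z \<^bold>\<in> cv y)) \<^bold>\<and>
        \<^bold>\<forall>y\<^bold>. (cv y \<^bold>\<in> cv x \<^bold>\<rightarrow> \<^bold>\<exists>z\<^bold>. (cv z \<^bold>\<in> cv x \<^bold>\<and>
          \<^bold>\<forall>w\<^bold>. (cv w \<^bold>\<in> cv z \<^bold>\<leftrightarrow> (cv w \<^bold>\<in> cv y \<^bold>\<or> cv w \<^bold>= cv y))))))"
  | ax_ac: "distinct [x, y, z, w, v, u, t] \<Longrightarrow>
      setmm (\<^bold>\<exists>y\<^bold>. \<^bold>\<forall>z\<^bold>. \<^bold>\<forall>w\<^bold>. ((cv z \<^bold>\<in> cv w \<^bold>\<and> cv w \<^bold>\<in> cv x) \<^bold>\<rightarrow>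
        \<^bold>\<exists>v\<^bold>. \<^bold>\<forall>u\<^bold>. (\<^bold>\<exists>t\<^bold>. ((cv u \<^bold>\<in> cv w \<^bold>\<and> cv w \<^bold>\<in> cv t) \<^bold>\<and> (cv u \<^bold>\<in> cv t \<^bold>\<and> cv t \<^bold>\<in> cv y))
          \<^bold>\<leftrightarrow> cv u \<^bold>= cv v)))"

section \<open>Defined notions of set.mm\<close>

text \<open>
  Names follow set.mm.  Bound variables that do not appear in the notation being defined are chosen outside the
  arguments.  For fixed finite \<open>X\<close>, the variables \<open>fr X 0\<close>, \<open>fr X 1\<close>, ... are distinct and not in \<open>X\<close>.
\<close>

definition fr :: "svar set \<Rightarrow> nat \<Rightarrow> svar"
  where "fr X n = Aux (n + (LEAST m. \<forall>k. Aux k \<in> X \<longrightarrow> k < m))"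

definition wss :: "cls \<Rightarrow> cls \<Rightarrow> wff" (infix \<open>\<^bold>\<subseteq>\<close> 65)
  where "A \<^bold>\<subseteq> B = (let x = fr (cvars A \<union> cvars B) 0 in \<^bold>\<forall>x\<^bold>. (cv x \<^bold>\<in> A \<^bold>\<rightarrow> cv x \<^bold>\<in> B))"

definition wral :: "svar \<Rightarrow> cls \<Rightarrow> wff \<Rightarrow> wff" (\<open>\<^bold>\<forall>_\<^bold>\<in>_\<^bold>. _\<close> [1000, 66, 60] 60)
  where "\<^bold>\<forall>x\<^bold>\<in>A\<^bold>. \<phi> = \<^bold>\<forall>x\<^bold>. (cv x \<^bold>\<in> A \<^bold>\<rightarrow> \<phi>)"

definition wrex :: "svar \<Rightarrow> cls \<Rightarrow> wff \<Rightarrow> wff" (\<open>\<^bold>\<exists>_\<^bold>\<in>_\<^bold>. _\<close> [1000, 66, 60] 60)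
  where "\<^bold>\<exists>x\<^bold>\<in>A\<^bold>. \<phi> = \<^bold>\<exists>x\<^bold>. (cv x \<^bold>\<in> A \<^bold>\<and> \<phi>)"

definition crab :: "svar \<Rightarrow> cls \<Rightarrow> wff \<Rightarrow> cls"
  where "crab x A \<phi> = cab x (cv x \<^bold>\<in> A \<^bold>\<and> \<phi>)"

definition cvv :: cls
  where "cvv = (let x = fr {} 0 in cab x (cv x \<^bold>= cv x))"

definition c0 :: cls
  where "c0 = (let x = fr {} 0 in cab x (\<^bold>\<not> (cv x \<^bold>= cv x)))"

definition cun :: "cls \<Rightarrow> cls \<Rightarrow> cls" (infixl \<open>\<^bold>\<union>\<close> 70)
  where "A \<^bold>\<union> B = (let x = fr (cvars A \<union> cvars B) 0 in cab x (cv x \<^bold>\<in> A \<^bold>\<or> cv x \<^bold>\<in> B))"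

definition cpw :: "cls \<Rightarrow> cls"
  where "cpw A = (let x = fr (cvars A) 0 in cab x (cv x \<^bold>\<subseteq> A))"

definition cuni :: "cls \<Rightarrow> cls"
  where "cuni A = (let x = fr (cvars A) 0; y = fr (cvars A) 1 in
    cab x (\<^bold>\<exists>y\<^bold>. (cv x \<^bold>\<in> cv y \<^bold>\<and> cv y \<^bold>\<in> A)))"

definition csn :: "cls \<Rightarrow> cls"
  where "csn A = (let x = fr (cvars A) 0 in cab x (cv x \<^bold>= A))"

definition cpr :: "cls \<Rightarrow> cls \<Rightarrow> cls"
  where "cpr A B = csn A \<^bold>\<union> csn B"

definition cop :: "cls \<Rightarrow> cls \<Rightarrow> cls"
  where "cop A B = (let x = fr (cvars A \<union> cvars B) 0 in
    cab x ((A \<^bold>\<in> cvv \<^bold>\<and> B \<^bold>\<in> cvv) \<^bold>\<and> cv x \<^bold>\<in> cpr (csn A) (cpr A B)))"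

definition cif :: "wff \<Rightarrow> cls \<Rightarrow> cls \<Rightarrow> cls"
  where "cif \<phi> A B = (let x = fr (wvars \<phi> \<union> cvars A \<union> cvars B) 0 in
    cab x ((cv x \<^bold>\<in> A \<^bold>\<and> \<phi>) \<^bold>\<or> (cv x \<^bold>\<in> B \<^bold>\<and> \<^bold>\<not> \<phi>)))"

definition csuc :: "cls \<Rightarrow> cls"
  where "csuc A = A \<^bold>\<union> csn A"

definition c1 :: cls
  where "c1 = csuc c0"

definition c2 :: cls
  where "c2 = cpr c0 c1"

definition copab :: "svar \<Rightarrow> svar \<Rightarrow> wff \<Rightarrow> cls"
  where "copab x y \<phi> = (let z = fr ({x, y} \<union> wvars \<phi>) 0 in
    cab z (\<^bold>\<exists>x\<^bold>. \<^bold>\<exists>y\<^bold>. (cv z \<^bold>= cop (cv x) (cv y) \<^bold>\<and> \<phi>)))"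

text \<open>The mapping that takes \<open>x\<close> in \<open>A\<close> to \<open>B\<close>; \<open>x\<close> may occur in \<open>B\<close>.\<close>

definition cmpt :: "svar \<Rightarrow> cls \<Rightarrow> cls \<Rightarrow> cls"
  where "cmpt x A B = (let y = fr ({x} \<union> cvars A \<union> cvars B) 0 in
    copab x y (cv x \<^bold>\<in> A \<^bold>\<and> cv y \<^bold>= B))"

definition cdm :: "cls \<Rightarrow> cls"
  where "cdm A = (let x = fr (cvars A) 0; y = fr (cvars A) 1 in
    cab x (\<^bold>\<exists>y\<^bold>. (cop (cv x) (cv y) \<^bold>\<in> A)))"

definition crn :: "cls \<Rightarrow> cls"
  where "crn A = (let x = fr (cvars A) 0; y = fr (cvars A) 1 in
    cab y (\<^bold>\<exists>x\<^bold>. (cop (cv x) (cv y) \<^bold>\<in> A)))"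

definition cres :: "cls \<Rightarrow> cls \<Rightarrow> cls"
  where "cres F A = (let X = cvars F \<union> cvars A; x = fr X 0; y = fr X 1; z = fr X 2 in
    crab z F (\<^bold>\<exists>x\<^bold>\<in>A\<^bold>. \<^bold>\<exists>y\<^bold>. (cv z \<^bold>= cop (cv x) (cv y))))"

definition wrel :: "cls \<Rightarrow> wff"
  where "wrel F = (let x = fr (cvars F) 0; y = fr (cvars F) 1; z = fr (cvars F) 2 in
    \<^bold>\<forall>z\<^bold>\<in>F\<^bold>. \<^bold>\<exists>x\<^bold>. \<^bold>\<exists>y\<^bold>. (cv z \<^bold>= cop (cv x) (cv y)))"

definition wfun :: "cls \<Rightarrow> wff"
  where "wfun F = (let x = fr (cvars F) 0; y = fr (cvars F) 1; z = fr (cvars F) 2 in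
    wrel F \<^bold>\<and> \<^bold>\<forall>x\<^bold>. \<^bold>\<forall>y\<^bold>. \<^bold>\<forall>z\<^bold>.
      ((cop (cv x) (cv y) \<^bold>\<in> F \<^bold>\<and> cop (cv x) (cv z) \<^bold>\<in> F) \<^bold>\<rightarrow> cv y \<^bold>= cv z))"

definition wfn :: "cls \<Rightarrow> cls \<Rightarrow> wff"
  where "wfn F A = (wfun F \<^bold>\<and> cdm F \<^bold>= A)"

text \<open>Function value; as in set.mm it is the empty set when \<open>F\<close> has no unique value at \<open>A\<close>.\<close>

definition cfv :: "cls \<Rightarrow> cls \<Rightarrow> cls"
  where "cfv F A = (let X = cvars F \<union> cvars A; x = fr X 0; y = fr X 1 in
    cuni (cab y (cab x (cop A (cv x) \<^bold>\<in> F) \<^bold>= csn (cv y))))"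

text \<open>The set of all functions from \<open>B\<close> to \<open>A\<close>, usually written as a power with exponent \<open>B\<close>.\<close>

definition cmap :: "cls \<Rightarrow> cls \<Rightarrow> cls"
  where "cmap A B = (let f = fr (cvars A \<union> cvars B) 0 in
    cab f (wfn (cv f) B \<^bold>\<and> crn (cv f) \<^bold>\<subseteq> A))"

definition c1st :: "cls \<Rightarrow> cls"
  where "c1st A = cuni (cdm (csn A))"

definition c2nd :: "cls \<Rightarrow> cls"
  where "c2nd A = cuni (crn (csn A))"

definition wtr :: "cls \<Rightarrow> wff"
  where "wtr A = (cuni A \<^bold>\<subseteq> A)"

text \<open>Well-ordering of \<open>A\<close> by membership: every nonempty subset has a minimal element, and any two
  elements are comparable.\<close>

definition wwe :: "cls \<Rightarrow> wff"
  where "wwe A = (let x = fr (cvars A) 0; y = fr (cvars A) 1; z = fr (cvars A) 2 in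
    \<^bold>\<forall>x\<^bold>. ((cv x \<^bold>\<subseteq> A \<^bold>\<and> \<^bold>\<not> (cv x \<^bold>= c0)) \<^bold>\<rightarrow> \<^bold>\<exists>y\<^bold>\<in>cv x\<^bold>. \<^bold>\<forall>z\<^bold>\<in>cv x\<^bold>. \<^bold>\<not> (cv z \<^bold>\<in> cv y)) \<^bold>\<and>
    \<^bold>\<forall>x\<^bold>\<in>A\<^bold>. \<^bold>\<forall>y\<^bold>\<in>A\<^bold>. (cv x \<^bold>\<in> cv y \<^bold>\<or> cv x \<^bold>= cv y \<^bold>\<or> cv y \<^bold>\<in> cv x))"

definition word :: "cls \<Rightarrow> wff"
  where "word A = (wtr A \<^bold>\<and> wwe A)"

definition wlim :: "cls \<Rightarrow> wff"
  where "wlim A = (word A \<^bold>\<and> \<^bold>\<not> (A \<^bold>= c0) \<^bold>\<and> A \<^bold>= cuni A)"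

definition con0 :: cls
  where "con0 = (let x = fr {} 0 in cab x (word (cv x)))"

definition com :: cls
  where "com = (let x = fr {} 0; y = fr {} 1 in
    crab x con0 (\<^bold>\<forall>y\<^bold>. (wlim (cv y) \<^bold>\<rightarrow> cv x \<^bold>\<in> cv y)))"

text \<open>Strong transfinite recursion (\<open>F\<close> is applied to the restriction to the preceding ordinals),
  and recursion by zero, successor and limit cases.\<close>

definition crecs :: "cls \<Rightarrow> cls"
  where "crecs F = (let x = fr (cvars F) 0; y = fr (cvars F) 1; f = fr (cvars F) 2 in
    cuni (cab f (\<^bold>\<exists>x\<^bold>\<in>con0\<^bold>. (wfn (cv f) (cv x) \<^bold>\<and>
      \<^bold>\<forall>y\<^bold>\<in>cv x\<^bold>. (cfv (cv f) (cv y) \<^bold>= cfv F (cres (cv f) (cv y)))))))"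

definition crdg :: "cls \<Rightarrow> cls \<Rightarrow> cls"
  where "crdg F A = (let g = fr (cvars F \<union> cvars A) 0 in
    crecs (cmpt g cvv
      (cif (cv g \<^bold>= c0) A
        (cif (wlim (cdm (cv g))) (cuni (crn (cv g)))
          (cfv F (cfv (cv g) (cuni (cdm (cv g)))))))))"

text \<open>Ordinal addition, and the cumulative hierarchy as a function on the ordinals.\<close>

definition coa :: "cls \<Rightarrow> cls \<Rightarrow> cls"
  where "coa A B = (let x = fr {} 0 in cfv (crdg (cmpt x cvv (csuc (cv x))) A) B)"

definition cr1 :: cls
  where "cr1 = (let x = fr {} 0 in crdg (cmpt x cvv (cpw (cv x))) c0)"

definition cVww :: cls
  where "cVww = cfv cr1 (coa com com)"

section \<open>hol.mm\<close>

datatype ty =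
    TVar nat
  | TBool
  | TInd
  | TFun ty ty  (infixr \<open>\<rightarrow>\<^sub>h\<close> 65)

type_synonym hvar = nat

text \<open>
  \<open>Ctx R S\<close> is the context conjunction.  A variable term carries a type annotation, but it is the
  bare var that is bound by an abstraction, and that the distinct variable conditions speak about.

  \<open>Const D\<close> is the defined constant with definiens \<open>D\<close>.  A constant contains no vars, whatever
  the bound vars of its definiens; \<open>D\<close> is required to be closed where the constant is introduced.
\<close>

datatype tm =
    Tru
  | Ctx tm tm
  | App tm tm  (infixl \<open>\<cdot>\<close> 70)
  | Var hvar ty
  | Lam hvar ty tm
  | Equal ty
  | Eps ty
  | Const tm

abbreviation heq :: "ty \<Rightarrow> tm \<Rightarrow> tm \<Rightarrow> tm"
  where "heq \<alpha> A B \<equiv> Equal \<alpha> \<cdot> A \<cdot> B"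

primrec hvars :: "tm \<Rightarrow> hvar set"
  where
    "hvars Tru = {}"
  | "hvars (Ctx R S) = hvars R \<union> hvars S"
  | "hvars (F \<cdot> A) = hvars F \<union> hvars A"
  | "hvars (Var x \<alpha>) = {x}"
  | "hvars (Lam x \<alpha> A) = insert x (hvars A)"
  | "hvars (Equal \<alpha>) = {}"
  | "hvars (Eps \<alpha>) = {}"
  | "hvars (Const D) = {}"

primrec hfree :: "tm \<Rightarrow> (hvar \<times> ty) set"
  where
    "hfree Tru = {}"
  | "hfree (Ctx R S) = hfree R \<union> hfree S"
  | "hfree (F \<cdot> A) = hfree F \<union> hfree A"
  | "hfree (Var x \<alpha>) = {(x, \<alpha>)}"
  | "hfree (Lam x \<alpha> A) = {(y, \<beta>) \<in> hfree A. y \<noteq> x}"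
  | "hfree (Equal \<alpha>) = {}"
  | "hfree (Eps \<alpha>) = {}"
  | "hfree (Const D) = {}"

primrec ty_tvars :: "ty \<Rightarrow> nat set"
  where
    "ty_tvars (TVar a) = {a}"
  | "ty_tvars TBool = {}"
  | "ty_tvars TInd = {}"
  | "ty_tvars (\<alpha> \<rightarrow>\<^sub>h \<beta>) = ty_tvars \<alpha> \<union> ty_tvars \<beta>"

primrec tvars :: "tm \<Rightarrow> nat set"
  where
    "tvars Tru = {}"
  | "tvars (Ctx R S) = tvars R \<union> tvars S"
  | "tvars (F \<cdot> A) = tvars F \<union> tvars A"
  | "tvars (Var x \<alpha>) = ty_tvars \<alpha>"
  | "tvars (Lam x \<alpha> A) = ty_tvars \<alpha> \<union> tvars A"
  | "tvars (Equal \<alpha>) = ty_tvars \<alpha>"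
  | "tvars (Eps \<alpha>) = ty_tvars \<alpha>"
  | "tvars (Const D) = tvars D"

text \<open>The indefinite descriptor does not occur, not even in the definition of a constant.\<close>

primrec eps_free :: "tm \<Rightarrow> bool"
  where
    "eps_free Tru = True"
  | "eps_free (Ctx R S) = (eps_free R \<and> eps_free S)"
  | "eps_free (F \<cdot> A) = (eps_free F \<and> eps_free A)"
  | "eps_free (Var x \<alpha>) = True"
  | "eps_free (Lam x \<alpha> A) = eps_free A"
  | "eps_free (Equal \<alpha>) = True"
  | "eps_free (Eps \<alpha>) = False"
  | "eps_free (Const D) = eps_free D"

text \<open>The standard definitions of the logical constants in terms of equality; the existential
  quantifier is the impredicative one, so that none of them involves the descriptor.\<close>

definition hal :: "ty \<Rightarrow> tm"
  where "hal \<alpha> = Const (Lam 0 (\<alpha> \<rightarrow>\<^sub>h TBool)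
    (heq (\<alpha> \<rightarrow>\<^sub>h TBool) (Var 0 (\<alpha> \<rightarrow>\<^sub>h TBool)) (Lam 1 \<alpha> Tru)))"

definition hfal :: tm
  where "hfal = Const (hal TBool \<cdot> Lam 0 TBool (Var 0 TBool))"

definition han :: tm
  where "han = Const (let \<beta> = TBool \<rightarrow>\<^sub>h TBool \<rightarrow>\<^sub>h TBool in
    Lam 0 TBool (Lam 1 TBool
      (heq (\<beta> \<rightarrow>\<^sub>h TBool)
        (Lam 2 \<beta> (Var 2 \<beta> \<cdot> Var 0 TBool \<cdot> Var 1 TBool))
        (Lam 2 \<beta> (Var 2 \<beta> \<cdot> Tru \<cdot> Tru)))))"

definition him :: tm
  where "him = Const (Lam 0 TBool (Lam 1 TBool
    (heq TBool (han \<cdot> Var 0 TBool \<cdot> Var 1 TBool) (Var 0 TBool))))"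

definition hnot :: tm
  where "hnot = Const (Lam 0 TBool (him \<cdot> Var 0 TBool \<cdot> hfal))"

definition hex :: "ty \<Rightarrow> tm"
  where "hex \<alpha> = Const (Lam 0 (\<alpha> \<rightarrow>\<^sub>h TBool)
    (hal TBool \<cdot> Lam 1 TBool
      (him \<cdot> (hal \<alpha> \<cdot> Lam 2 \<alpha> (him \<cdot> (Var 0 (\<alpha> \<rightarrow>\<^sub>h TBool) \<cdot> Var 2 \<alpha>) \<cdot> Var 1 TBool))
           \<cdot> Var 1 TBool)))"

definition hinj :: "ty \<Rightarrow> ty \<Rightarrow> tm"
  where "hinj \<alpha> \<beta> = Const (let f = Var 0 (\<alpha> \<rightarrow>\<^sub>h \<beta>); x = Var 1 \<alpha>; y = Var 2 \<alpha> in
    Lam 0 (\<alpha> \<rightarrow>\<^sub>h \<beta>)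
      (hal \<alpha> \<cdot> Lam 1 \<alpha> (hal \<alpha> \<cdot> Lam 2 \<alpha>
        (him \<cdot> heq \<beta> (f \<cdot> x) (f \<cdot> y) \<cdot> heq \<alpha> x y))))"

definition hsurj :: "ty \<Rightarrow> ty \<Rightarrow> tm"
  where "hsurj \<alpha> \<beta> = Const (let f = Var 0 (\<alpha> \<rightarrow>\<^sub>h \<beta>); x = Var 1 \<alpha>; y = Var 2 \<beta> in
    Lam 0 (\<alpha> \<rightarrow>\<^sub>h \<beta>)
      (hal \<beta> \<cdot> Lam 2 \<beta> (hex \<alpha> \<cdot> Lam 1 \<alpha> (heq \<beta> y (f \<cdot> x)))))"

text \<open>
  \<open>TypeDef \<alpha> \<beta> A R F B\<close> is the type-definition statement for the new type \<open>\<beta>\<close> carved out of \<open>\<alpha>\<close> by the predicate \<open>F\<close> with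
  witness \<open>B\<close>, abstraction function \<open>A\<close> and representation function \<open>R\<close>.  No rule below derives it.
\<close>

datatype judgement =
    IsType ty
  | HasType tm ty  (infix \<open>:\<^sub>h\<close> 50)
  | Entails tm tm  (infix \<open>\<turnstile>\<^sub>h\<close> 50)
  | TypeDef ty ty tm tm tm tm

text \<open>
  Derivability from the implicit hypotheses that the type variables are types (\<open>ty_var\<close>).
  Metavariables of the rules range over the object language above, so that the rule of direct
  substitution is subsumed.

  Rule \<open>beta\<close> has a proviso on the type annotations: \<open>x\<close> must not be free in \<open>A\<close> at a type other
  than \<open>\<alpha>\<close>.  It holds automatically when every var is used at one type only.  Without it,
  \<open>hbl1\<close>, \<open>beta\<close> and \<open>distrc\<close> for a var at two types make the calculus inconsistent: for
  \<open>K = (\<lambda>x:\<beta>. x:\<alpha>)\<close> they yield \<open>K ((\<lambda>x:\<alpha>. x:\<beta>) B) = B\<close> for every \<open>B : \<alpha>\<close>, so that every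
  type would be a surjective image of every other one, contradicting Cantor's theorem.
\<close>

inductive holmm :: "judgement \<Rightarrow> bool"
  where
    ty_var: "holmm (IsType (TVar a))"
  | ty_bool: "holmm (IsType TBool)"
  | ty_ind: "holmm (IsType TInd)"
  | ty_fun: "holmm (IsType \<alpha>) \<Longrightarrow> holmm (IsType \<beta>) \<Longrightarrow> holmm (IsType (\<alpha> \<rightarrow>\<^sub>h \<beta>))"
  | wtru: "holmm (Tru :\<^sub>h TBool)"
  | wct: "holmm (R :\<^sub>h TBool) \<Longrightarrow> holmm (S :\<^sub>h TBool) \<Longrightarrow> holmm (Ctx R S :\<^sub>h TBool)"
  | wc: "holmm (F :\<^sub>h \<alpha> \<rightarrow>\<^sub>h \<beta>) \<Longrightarrow> holmm (T :\<^sub>h \<alpha>) \<Longrightarrow> holmm (F \<cdot> T :\<^sub>h \<beta>)"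
  | wv: "holmm (Var x \<alpha> :\<^sub>h \<alpha>)"
  | wl: "holmm (T :\<^sub>h \<beta>) \<Longrightarrow> holmm (Lam x \<alpha> T :\<^sub>h \<alpha> \<rightarrow>\<^sub>h \<beta>)"
  | weq: "holmm (Equal \<alpha> :\<^sub>h \<alpha> \<rightarrow>\<^sub>h \<alpha> \<rightarrow>\<^sub>h TBool)"
  | weps: "holmm (Eps \<alpha> :\<^sub>h (\<alpha> \<rightarrow>\<^sub>h TBool) \<rightarrow>\<^sub>h \<alpha>)"
  | wconst: "holmm (D :\<^sub>h \<alpha>) \<Longrightarrow> hfree D = {} \<Longrightarrow> holmm (Const D :\<^sub>h \<alpha>)"
  | df_const: "holmm (D :\<^sub>h \<alpha>) \<Longrightarrow> hfree D = {} \<Longrightarrow> holmm (Tru \<turnstile>\<^sub>h heq \<alpha> (Const D) D)"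
  | id: "holmm (R :\<^sub>h TBool) \<Longrightarrow> holmm (R \<turnstile>\<^sub>h R)"
  | syl: "holmm (R \<turnstile>\<^sub>h S) \<Longrightarrow> holmm (S \<turnstile>\<^sub>h T) \<Longrightarrow> holmm (R \<turnstile>\<^sub>h T)"
  | jca: "holmm (R \<turnstile>\<^sub>h S) \<Longrightarrow> holmm (R \<turnstile>\<^sub>h T) \<Longrightarrow> holmm (R \<turnstile>\<^sub>h Ctx S T)"
  | simpl: "holmm (R :\<^sub>h TBool) \<Longrightarrow> holmm (S :\<^sub>h TBool) \<Longrightarrow> holmm (Ctx R S \<turnstile>\<^sub>h R)"
  | simpr: "holmm (R :\<^sub>h TBool) \<Longrightarrow> holmm (S :\<^sub>h TBool) \<Longrightarrow> holmm (Ctx R S \<turnstile>\<^sub>h S)"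
  | trud: "holmm (R :\<^sub>h TBool) \<Longrightarrow> holmm (R \<turnstile>\<^sub>h Tru)"
  | refl: "holmm (A :\<^sub>h \<alpha>) \<Longrightarrow> holmm (Tru \<turnstile>\<^sub>h heq \<alpha> A A)"
  | eqmp: "holmm (R \<turnstile>\<^sub>h A) \<Longrightarrow> holmm (R \<turnstile>\<^sub>h heq TBool A B) \<Longrightarrow> holmm (R \<turnstile>\<^sub>h B)"
  | ded: "holmm (Ctx R S \<turnstile>\<^sub>h T) \<Longrightarrow> holmm (Ctx R T \<turnstile>\<^sub>h S) \<Longrightarrow> holmm (R \<turnstile>\<^sub>h heq TBool S T)"
  | ceq: "holmm (F :\<^sub>h \<alpha> \<rightarrow>\<^sub>h \<beta>) \<Longrightarrow> holmm (A :\<^sub>h \<alpha>) \<Longrightarrow>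
      holmm (R \<turnstile>\<^sub>h heq (\<alpha> \<rightarrow>\<^sub>h \<beta>) F G) \<Longrightarrow> holmm (R \<turnstile>\<^sub>h heq \<alpha> A B) \<Longrightarrow>
      holmm (R \<turnstile>\<^sub>h heq \<beta> (F \<cdot> A) (G \<cdot> B))"
  | leq: "holmm (R \<turnstile>\<^sub>h heq \<beta> A B) \<Longrightarrow> x \<notin> hvars R \<Longrightarrow>
      holmm (R \<turnstile>\<^sub>h heq (\<alpha> \<rightarrow>\<^sub>h \<beta>) (Lam x \<alpha> A) (Lam x \<alpha> B))"
  | hbl1: "holmm (A :\<^sub>h \<gamma>) \<Longrightarrow> holmm (B :\<^sub>h \<alpha>) \<Longrightarrow>
      holmm (Tru \<turnstile>\<^sub>h heq (\<beta> \<rightarrow>\<^sub>h \<gamma>) (Lam x \<alpha> (Lam x \<beta> A) \<cdot> B) (Lam x \<beta> A))"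
  | distrc: "holmm (B :\<^sub>h \<alpha>) \<Longrightarrow> holmm (F :\<^sub>h \<beta> \<rightarrow>\<^sub>h \<gamma>) \<Longrightarrow> holmm (A :\<^sub>h \<beta>) \<Longrightarrow>
      holmm (Tru \<turnstile>\<^sub>h heq \<gamma> (Lam x \<alpha> (F \<cdot> A) \<cdot> B) ((Lam x \<alpha> F \<cdot> B) \<cdot> (Lam x \<alpha> A \<cdot> B)))"
  | ax_17: "holmm (A :\<^sub>h \<beta>) \<Longrightarrow> holmm (B :\<^sub>h \<alpha>) \<Longrightarrow> x \<notin> hvars A \<Longrightarrow>
      holmm (Tru \<turnstile>\<^sub>h heq \<beta> (Lam x \<alpha> A \<cdot> B) A)"
  | distrl: "holmm (A :\<^sub>h \<gamma>) \<Longrightarrow> holmm (B :\<^sub>h \<alpha>) \<Longrightarrow> y \<noteq> x \<Longrightarrow> y \<notin> hvars B \<Longrightarrow>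
      holmm (Tru \<turnstile>\<^sub>h heq (\<beta> \<rightarrow>\<^sub>h \<gamma>) (Lam x \<alpha> (Lam y \<beta> A) \<cdot> B) (Lam y \<beta> (Lam x \<alpha> A \<cdot> B)))"
  | beta: "holmm (A :\<^sub>h \<beta>) \<Longrightarrow> (\<forall>\<gamma>. (x, \<gamma>) \<in> hfree A \<longrightarrow> \<gamma> = \<alpha>) \<Longrightarrow>
      holmm (Tru \<turnstile>\<^sub>h heq \<beta> (Lam x \<alpha> A \<cdot> Var x \<alpha>) A)"
  | inst: "holmm (Tru \<turnstile>\<^sub>h heq TBool (Lam x \<alpha> B \<cdot> Var y \<alpha>) B) \<Longrightarrow>
      holmm (Tru \<turnstile>\<^sub>h heq TBool (Lam x \<alpha> S \<cdot> Var y \<alpha>) S) \<Longrightarrow>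
      holmm (heq \<alpha> (Var x \<alpha>) C \<turnstile>\<^sub>h heq TBool A B) \<Longrightarrow>
      holmm (heq \<alpha> (Var x \<alpha>) C \<turnstile>\<^sub>h heq TBool R S) \<Longrightarrow>
      holmm (R \<turnstile>\<^sub>h A) \<Longrightarrow> y \<noteq> x \<Longrightarrow> x \<notin> hvars C \<Longrightarrow>
      holmm (S \<turnstile>\<^sub>h B)"
  | eta: "f \<noteq> x \<Longrightarrow>
      holmm (Tru \<turnstile>\<^sub>h hal (\<alpha> \<rightarrow>\<^sub>h \<beta>) \<cdot> Lam f (\<alpha> \<rightarrow>\<^sub>h \<beta>)
        (heq (\<alpha> \<rightarrow>\<^sub>h \<beta>) (Lam x \<alpha> (Var f (\<alpha> \<rightarrow>\<^sub>h \<beta>) \<cdot> Var x \<alpha>)) (Var f (\<alpha> \<rightarrow>\<^sub>h \<beta>))))"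
  | ac: "p \<noteq> x \<Longrightarrow>
      holmm (Tru \<turnstile>\<^sub>h hal (\<alpha> \<rightarrow>\<^sub>h TBool) \<cdot> Lam p (\<alpha> \<rightarrow>\<^sub>h TBool) (hal \<alpha> \<cdot> Lam x \<alpha>
        (him \<cdot> (Var p (\<alpha> \<rightarrow>\<^sub>h TBool) \<cdot> Var x \<alpha>)
             \<cdot> (Var p (\<alpha> \<rightarrow>\<^sub>h TBool) \<cdot> (Eps \<alpha> \<cdot> Var p (\<alpha> \<rightarrow>\<^sub>h TBool))))))"
  | infinity: "holmm (Tru \<turnstile>\<^sub>h hex (TInd \<rightarrow>\<^sub>h TInd) \<cdot> Lam f (TInd \<rightarrow>\<^sub>h TInd)
      (han \<cdot> (hinj TInd TInd \<cdot> Var f (TInd \<rightarrow>\<^sub>h TInd))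
           \<cdot> (hnot \<cdot> (hsurj TInd TInd \<cdot> Var f (TInd \<rightarrow>\<^sub>h TInd)))))"

section \<open>The model\<close>

definition toWff :: "cls \<Rightarrow> wff"
  where "toWff A = (A \<^bold>= c1)"

definition toBool :: "wff \<Rightarrow> cls"
  where "toBool \<phi> = cif \<phi> c1 c0"

text \<open>The class of all pairs of a witness and a base set in \<open>V\<^bsub>\<omega>+\<omega>\<^esub>\<close> that contains it.\<close>

definition cType :: cls
  where "cType = (let i = fr {} 0; b = fr {} 1 in
    copab i b (cv b \<^bold>\<in> cVww \<^bold>\<and> cv i \<^bold>\<in> cv b))"

definition choice_fun :: "svar \<Rightarrow> wff"
  where "choice_fun e = (let x = fr {e} 0 in
    wfn (cv e) cVww \<^bold>\<and> \<^bold>\<forall>x\<^bold>\<in>cVww\<^bold>. (\<^bold>\<not> (cv x \<^bold>= c0) \<^bold>\<rightarrow> cfv (cv e) (cv x) \<^bold>\<in> cv x))"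

definition Ch :: "svar \<Rightarrow> wff"
  where "Ch e = (let f = fr {e} 0 in choice_fun e \<^bold>\<or> \<^bold>\<not> (\<^bold>\<exists>f\<^bold>. choice_fun f))"

primrec S_ty :: "ty \<Rightarrow> cls"
  where
    "S_ty (TVar a) = cv (HolTyp a)"
  | "S_ty TBool = cop c1 c2"
  | "S_ty TInd = cop c0 com"
  | "S_ty (\<alpha> \<rightarrow>\<^sub>h \<beta>) = (let x = fr (cvars (S_ty \<alpha>) \<union> cvars (S_ty \<beta>)) 0 in
      cop (cmpt x (c2nd (S_ty \<alpha>)) (c1st (S_ty \<beta>))) (cmap (c2nd (S_ty \<beta>)) (c2nd (S_ty \<alpha>))))"

definition wit :: "ty \<Rightarrow> cls"
  where "wit \<alpha> = c1st (S_ty \<alpha>)"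

definition base :: "ty \<Rightarrow> cls"
  where "base \<alpha> = c2nd (S_ty \<alpha>)"

text \<open>The set variable \<open>e\<close> stands for the choice function that interprets the descriptor.\<close>

primrec S_tm :: "svar \<Rightarrow> tm \<Rightarrow> cls"
  where
    "S_tm e Tru = c1"
  | "S_tm e (Ctx A B) = toBool (toWff (S_tm e A) \<^bold>\<and> toWff (S_tm e B))"
  | "S_tm e (F \<cdot> A) = cfv (S_tm e F) (S_tm e A)"
  | "S_tm e (Var x \<alpha>) = cif (cv (HolVar x) \<^bold>\<in> base \<alpha>) (cv (HolVar x)) (wit \<alpha>)"
  | "S_tm e (Lam x \<alpha> A) = cmpt (HolVar x) (base \<alpha>) (S_tm e A)"
  | "S_tm e (Equal \<alpha>) = (let x = fr (cvars (base \<alpha>)) 0; y = fr (cvars (base \<alpha>)) 1 in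
      cmpt x (base \<alpha>) (cmpt y (base \<alpha>) (toBool (cv x \<^bold>= cv y))))"
  | "S_tm e (Eps \<alpha>) = (let X = {e} \<union> cvars (base \<alpha>) \<union> cvars (wit \<alpha>); f = fr X 0; x = fr X 1 in
      cmpt f (cmap c2 (base \<alpha>))
        (cif (\<^bold>\<forall>x\<^bold>\<in>base \<alpha>\<^bold>. (cfv (cv f) (cv x) \<^bold>= c0)) (wit \<alpha>)
          (cfv (cv e) (crab x (base \<alpha>) (cfv (cv f) (cv x) \<^bold>= c1)))))"
  | "S_tm e (Const D) = S_tm e D"

primrec S_judgement :: "svar \<Rightarrow> judgement \<Rightarrow> wff"
  where
    "S_judgement e (IsType \<alpha>) = S_ty \<alpha> \<^bold>\<in> cType"
  | "S_judgement e (A :\<^sub>h \<alpha>) = S_tm e A \<^bold>\<in> base \<alpha>"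
  | "S_judgement e (A \<turnstile>\<^sub>h B) = (Ch e \<^bold>\<and> toWff (S_tm e A) \<^bold>\<rightarrow> toWff (S_tm e B))"
  | "S_judgement e (TypeDef \<alpha> \<beta> A R F B) =
      (let x = fr (cvars (base \<alpha>) \<union> cvars (base \<beta>) \<union> cvars (S_tm e F) \<union> cvars (S_tm e B)) 0 in
        S_ty \<beta> \<^bold>= cop (S_tm e B) (crab x (base \<alpha>) (toWff (cfv (S_tm e F) (cv x)))) \<^bold>\<and>
        S_tm e A \<^bold>= cmpt x (base \<alpha>) (cif (cv x \<^bold>\<in> base \<beta>) (cv x) (S_tm e B)) \<^bold>\<and>
        S_tm e R \<^bold>= cmpt x (base \<beta>) (cv x))"

text \<open>The hypotheses are antecedents, since generalization is applicable to whatever \<open>setmm\<close> derives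
  and would turn a free-standing hypothesis on a set variable into a universal statement.\<close>

definition under_types :: "nat set \<Rightarrow> wff \<Rightarrow> wff"
  where "under_types I \<phi> = foldr (\<lambda>a \<psi>. S_ty (TVar a) \<^bold>\<in> cType \<^bold>\<rightarrow> \<psi>) (sorted_list_of_set I) \<phi>"

end

theory Submission
  imports Defs "HOL-Library.Countable_Set"
begin

text \<open>
  Nothing is derived inside set.mm: by a Henkin argument a formula that holds in every extensional
  countable model of the axioms is derivable, and the translated judgement is checked in an
  arbitrary such model.  There a class term denotes a set of elements of the model, and a class is
  a set of the model when separation or replacement applies to a formula defining it; this gives
  ordinals, transfinite recursion, \<open>V\<^bsub>\<omega>+\<omega>\<^esub>\<close> and a choice function on it.  The types of hol.mm then
  form a standard full function hierarchy, in which the rules are sound.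

  For a descriptor-free judgement the choice function does not occur in the translation, so it may
  be taken to be any of those that exist in the model.
\<close>

text \<open>Higher-order logic is too weak to supply a model of ZFC. Countermodels exist here only
  under the assumption that a formula is underivable, and nothing excludes that they are ill-founded
  when seen from outside. Induction and recursion on their ordinals are therefore available only for
  properties and functions that a class term defines, and each such step exhibits the term.
  Likewise, function types are full only in the sense of the model: they contain the functions that
  are elements of it, so every abstraction has to be shown to be a set by replacement. Metamath has
  no primitive substitution, and its distinct variable conditions exclude bound occurrences too. A
  variable x is given the value of d by passing from a maximal consistent set T to the set of all
  \<phi> such that T contains \<forall>x (x = d \<longrightarrow> \<phi>); for distinct x and d this
  is again maximal consistent. It takes the place of the substitution lemma in the usual Henkin
  proof.\<close>

instance svar :: countable by countable_datatype
instance wff :: countable by countable_datatype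

lemma finite_wvars [simp]: "finite (wvars \<phi>)"
  and finite_cvars [simp]: "finite (cvars A)"
  by (induction \<phi> and A) auto

section \<open>Propositional valuations\<close>

lemma setmm_syl: "setmm (a \<^bold>\<rightarrow> b) \<Longrightarrow> setmm (b \<^bold>\<rightarrow> c) \<Longrightarrow> setmm (a \<^bold>\<rightarrow> c)"
  by (meson ax_1 ax_2 ax_mp)

lemma setmm_id: "setmm (a \<^bold>\<rightarrow> a)"
  by (meson ax_1 ax_2 ax_mp)

lemma setmm_not_imp: "setmm (\<^bold>\<not> a \<^bold>\<rightarrow> a \<^bold>\<rightarrow> b)"
  by (meson ax_1 ax_3 setmm_syl)

text \<open>The law of Clavius, on which proof by cases rests.\<close>

lemma setmm_clavius: "setmm ((\<^bold>\<not> a \<^bold>\<rightarrow> a) \<^bold>\<rightarrow> a)"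
proof -
  have "setmm ((\<^bold>\<not> a \<^bold>\<rightarrow> a) \<^bold>\<rightarrow> \<^bold>\<not> a \<^bold>\<rightarrow> \<^bold>\<not> (\<^bold>\<not> a \<^bold>\<rightarrow> a))"
    using ax_mp[OF setmm_not_imp ax_2] .
  then have "setmm ((\<^bold>\<not> a \<^bold>\<rightarrow> a) \<^bold>\<rightarrow> (\<^bold>\<not> a \<^bold>\<rightarrow> a) \<^bold>\<rightarrow> a)"
    using ax_3 setmm_syl by blast
  then show ?thesis
    by (meson ax_2 ax_mp setmm_id)
qed

lemma setmm_notnot: "setmm (\<^bold>\<not> (\<^bold>\<not> a) \<^bold>\<rightarrow> a)"
  using setmm_clavius setmm_not_imp setmm_syl by blast

lemma setmm_contrapos: "setmm (a \<^bold>\<rightarrow> b) \<Longrightarrow> setmm (\<^bold>\<not> b \<^bold>\<rightarrow> \<^bold>\<not> a)"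
  by (meson ax_3 ax_mp setmm_notnot setmm_syl)

lemma setmm_notnotI: "setmm (a \<^bold>\<rightarrow> \<^bold>\<not> (\<^bold>\<not> a))"
  using ax_mp[OF setmm_notnot ax_3] .

lemma setmm_cases: "setmm (a \<^bold>\<rightarrow> c) \<Longrightarrow> setmm (\<^bold>\<not> a \<^bold>\<rightarrow> c) \<Longrightarrow> setmm c"
  by (meson ax_mp setmm_clavius setmm_contrapos setmm_syl)

abbreviation holds :: "wff set \<Rightarrow> wff \<Rightarrow> bool" (infix \<open>\<Turnstile>\<close> 50)
  where "T \<Turnstile> \<phi> \<equiv> \<phi> \<in> T"

text \<open>A maximal consistent set: atoms and quantified formulas count as propositional letters,
  and membership of all theorems brings in the axioms about them.\<close>

definition valuation :: "wff set \<Rightarrow> bool"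
  where "valuation T \<longleftrightarrow> (\<forall>\<phi> \<psi>. T \<Turnstile> (\<phi> \<^bold>\<rightarrow> \<psi>) \<longleftrightarrow> (T \<Turnstile> \<phi> \<longrightarrow> T \<Turnstile> \<psi>)) \<and>
    (\<forall>\<phi>. T \<Turnstile> (\<^bold>\<not> \<phi>) \<longleftrightarrow> \<not> T \<Turnstile> \<phi>) \<and> (\<forall>\<phi>. setmm \<phi> \<longrightarrow> T \<Turnstile> \<phi>)"

lemma valuation_simps:
  assumes "valuation T"
  shows "T \<Turnstile> (\<phi> \<^bold>\<rightarrow> \<psi>) \<longleftrightarrow> (T \<Turnstile> \<phi> \<longrightarrow> T \<Turnstile> \<psi>)" "T \<Turnstile> (\<^bold>\<not> \<phi>) \<longleftrightarrow> \<not> T \<Turnstile> \<phi>"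
    "T \<Turnstile> (\<phi> \<^bold>\<and> \<psi>) \<longleftrightarrow> T \<Turnstile> \<phi> \<and> T \<Turnstile> \<psi>" "T \<Turnstile> (\<phi> \<^bold>\<or> \<psi>) \<longleftrightarrow> T \<Turnstile> \<phi> \<or> T \<Turnstile> \<psi>"
    "T \<Turnstile> (\<phi> \<^bold>\<leftrightarrow> \<psi>) \<longleftrightarrow> (T \<Turnstile> \<phi> \<longleftrightarrow> T \<Turnstile> \<psi>)" "T \<Turnstile> (\<^bold>\<exists>x\<^bold>. \<phi>) \<longleftrightarrow> \<not> T \<Turnstile> (\<^bold>\<forall>x\<^bold>. \<^bold>\<not> \<phi>)"
  using assms by (auto simp: valuation_def wa_def wo_def wb_def wex_def)

lemma valuation_setmm: "valuation T \<Longrightarrow> setmm \<phi> \<Longrightarrow> T \<Turnstile> \<phi>"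
  by (auto simp: valuation_def)

text \<open>The Lindenbaum construction; suitable sets \<open>D \<psi>\<close> make it produce Henkin witnesses as well.\<close>

lemma valuation_generic:
  fixes D :: "wff \<Rightarrow> wff set"
  assumes \<chi>: "\<not> setmm \<chi>"
    and dense: "\<And>\<psi> \<chi>. \<not> setmm \<chi> \<Longrightarrow> \<exists>\<theta>\<in>D \<psi>. \<not> setmm (\<theta> \<^bold>\<rightarrow> \<chi>)"
  obtains T where "valuation T" "\<not> T \<Turnstile> \<chi>" "\<And>\<psi>. \<exists>\<theta>\<in>D \<psi>. T \<Turnstile> \<theta>"
proof -
  \<comment> \<open>A pair \<open>(\<psi>, True)\<close> asks for a decision on \<psi>, a pair
    \<open>(\<psi>, False)\<close> for a member of \<open>D \<psi>\<close>; enumerating the pairs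
    serves both purposes.\<close>
  define D' where "D' p = (if snd p then {fst p, \<^bold>\<not> (fst p)} else D (fst p))" for p :: "wff \<times> bool"
  define th where "th n \<chi> = (SOME \<theta>. \<theta> \<in> D' (from_nat n) \<and> \<not> setmm (\<theta> \<^bold>\<rightarrow> \<chi>))" for n \<chi>
  have th: "th n \<chi> \<in> D' (from_nat n)" "\<not> setmm (th n \<chi> \<^bold>\<rightarrow> \<chi>)" if "\<not> setmm \<chi>" for n \<chi>
  proof -
    have "\<exists>\<theta>. \<theta> \<in> D' (from_nat n) \<and> \<not> setmm (\<theta> \<^bold>\<rightarrow> \<chi>)"
      unfolding D'_def using dense[OF that, of "fst (from_nat n)"] setmm_cases[of "fst (from_nat n)", OF _ _] that
      by (cases "snd (from_nat n :: wff \<times> bool)") auto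
    from someI_ex[OF this] show "th n \<chi> \<in> D' (from_nat n)" "\<not> setmm (th n \<chi> \<^bold>\<rightarrow> \<chi>)"
      by (auto simp: th_def)
  qed
  \<comment> \<open>One formula records the whole history: \<open>c n\<close> says that the first n
    choices imply \<chi>, so its underivability is their consistency with the negation of
    \<chi>.\<close>
  define c where "c = rec_nat \<chi> (\<lambda>n \<chi>. th n \<chi> \<^bold>\<rightarrow> \<chi>)"
  have c0: "c 0 = \<chi>" and cSuc: "c (Suc n) = (th n (c n) \<^bold>\<rightarrow> c n)" for n
    by (auto simp: c_def)
  have c: "\<not> setmm (c n)" for n
    by (induction n) (auto simp: c0 cSuc \<chi> th)
  define t where "t n = th n (c n)" for n
  have mono: "setmm (c n \<^bold>\<rightarrow> c (n + k))" for n k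
    by (induction k) (use setmm_id ax_1 setmm_syl in \<open>auto simp: cSuc\<close>)
  \<comment> \<open>A false premise makes an implication true, so the negation of a single choice
    already proves \<open>c n\<close>.\<close>
  have tc: "setmm (\<^bold>\<not> (t i) \<^bold>\<rightarrow> c n)" if "i < n" for i n
  proof -
    have "setmm (\<^bold>\<not> (t i) \<^bold>\<rightarrow> c (Suc i))"
      by (simp add: cSuc t_def setmm_not_imp)
    moreover obtain k where "n = Suc i + k" using \<open>i < n\<close> less_iff_Suc_add by auto
    ultimately show ?thesis using mono setmm_syl by blast
  qed
  define T where "T = range t"
  have dec: "T \<Turnstile> \<phi> \<or> T \<Turnstile> (\<^bold>\<not> \<phi>)" for \<phi>
  proof -
    have "t (to_nat (\<phi>, True)) \<in> D' (\<phi>, True)"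
      using th(1)[OF c, of "to_nat (\<phi>, True)"] by (simp add: t_def)
    then show ?thesis unfolding T_def D'_def by (metis (no_types, lifting) fst_conv insert_iff rangeI singletonD snd_conv)
  qed
  have cons: "T \<Turnstile> \<psi>" if asm: "T \<Turnstile> \<phi>1" "T \<Turnstile> \<phi>2" "setmm (\<phi>1 \<^bold>\<rightarrow> \<phi>2 \<^bold>\<rightarrow> \<psi>)" for \<phi>1 \<phi>2 \<psi>
  proof (rule ccontr)
    assume "\<not> T \<Turnstile> \<psi>"
    then have "T \<Turnstile> (\<^bold>\<not> \<psi>)" using dec by blast
    then obtain i j k where ijk: "\<phi>1 = t i" "\<phi>2 = t j" "\<^bold>\<not> \<psi> = t k"
      using asm unfolding T_def by blast
    define n where "n = Suc (i + j + k)"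
    have 1: "setmm (\<^bold>\<not> \<phi>1 \<^bold>\<rightarrow> c n)" "setmm (\<^bold>\<not> \<phi>2 \<^bold>\<rightarrow> c n)" "setmm (\<^bold>\<not> (\<^bold>\<not> \<psi>) \<^bold>\<rightarrow> c n)"
      using tc ijk by (auto simp: n_def)
    have "setmm (\<psi> \<^bold>\<rightarrow> c n)"
      using setmm_syl[OF setmm_notnotI 1(3)] .
    then have "setmm ((\<phi>2 \<^bold>\<rightarrow> \<psi>) \<^bold>\<rightarrow> \<phi>2 \<^bold>\<rightarrow> c n)"
      using ax_mp[OF ax_mp[OF _ ax_1] ax_2] by blast
    then have "setmm (\<phi>1 \<^bold>\<rightarrow> \<phi>2 \<^bold>\<rightarrow> c n)" using asm setmm_syl by blast
    moreover have "setmm (\<^bold>\<not> \<phi>1 \<^bold>\<rightarrow> \<phi>2 \<^bold>\<rightarrow> c n)" using 1 ax_1 setmm_syl by blast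
    ultimately have "setmm (\<phi>2 \<^bold>\<rightarrow> c n)" by (rule setmm_cases)
    then have "setmm (c n)" using 1 setmm_cases by blast
    then show False using c by blast
  qed
  have Tsetmm: "T \<Turnstile> \<psi>" if "setmm \<psi>" for \<psi>
    using cons[of "t 0" "t 0" \<psi>] ax_mp[OF ax_mp[OF that ax_1] ax_1] by (simp add: T_def)
  have neg: "T \<Turnstile> (\<^bold>\<not> \<phi>) \<longleftrightarrow> \<not> T \<Turnstile> \<phi>" for \<phi>
  proof
    assume a: "T \<Turnstile> (\<^bold>\<not> \<phi>)"
    show "\<not> T \<Turnstile> \<phi>"
    proof
      assume "T \<Turnstile> \<phi>"
      with a obtain i j where ij: "\<phi> = t i" "\<^bold>\<not> \<phi> = t j" unfolding T_def by blast
      have "setmm (\<^bold>\<not> \<phi> \<^bold>\<rightarrow> c (Suc (i+j)))" "setmm (\<^bold>\<not> (\<^bold>\<not> \<phi>) \<^bold>\<rightarrow> c (Suc (i+j)))"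
        using tc[of i "Suc (i+j)"] tc[of j "Suc (i+j)"] by (simp_all add: ij[symmetric])
      then show False using c setmm_cases by blast
    qed
  qed (use dec in blast)
  have imp: "T \<Turnstile> (\<phi> \<^bold>\<rightarrow> \<psi>) \<longleftrightarrow> (T \<Turnstile> \<phi> \<longrightarrow> T \<Turnstile> \<psi>)" for \<phi> \<psi>
    using cons[OF _ _ setmm_id, of \<phi> \<psi>] cons[OF _ _ ax_mp[OF ax_1[of \<psi> \<phi>] ax_1], of \<psi>]
      cons[OF _ _ ax_mp[OF setmm_not_imp[of \<phi> \<psi>] ax_1], of "\<^bold>\<not> \<phi>"] neg by blast
  have "valuation T" using imp neg Tsetmm by (auto simp: valuation_def)
  moreover have "\<not> T \<Turnstile> \<chi>"
  proof
    assume "T \<Turnstile> \<chi>"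
    then obtain i where "\<chi> = t i" by (auto simp: T_def)
    then have "setmm (\<^bold>\<not> \<chi> \<^bold>\<rightarrow> c (Suc i))" "setmm (\<chi> \<^bold>\<rightarrow> c (Suc i))"
      using tc mono[of 0 "Suc i"] by (auto simp: c0)
    then show False using c setmm_cases by blast
  qed
  moreover have "\<exists>\<theta>\<in>D \<psi>. T \<Turnstile> \<theta>" for \<psi>
    using th(1)[OF c, of "to_nat (\<psi>, False)" "to_nat (\<psi>, False)"] by (auto simp: T_def D'_def t_def)
  ultimately show ?thesis using that by blast
qed

text \<open>Propositional completeness. From here on, theorems are obtained by reasoning about truth
  in an arbitrary valuation instead of writing derivations.\<close>

lemma setmm_if_valuations:
  assumes "\<And>T. valuation T \<Longrightarrow> T \<Turnstile> \<phi>"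
  shows "setmm \<phi>"
proof (rule ccontr)
  assume a: "\<not> setmm \<phi>"
  have "\<exists>\<theta>\<in>{\<psi> \<^bold>\<rightarrow> \<psi>}. \<not> setmm (\<theta> \<^bold>\<rightarrow> \<chi>)" if "\<not> setmm \<chi>" for \<psi> \<chi>
    using that ax_mp setmm_id by blast
  from valuation_generic[OF a this] assms show False by metis
qed

section \<open>Quantifiers and equality under a valuation\<close>

lemma all_valid:
  assumes "valuation T" "\<And>T. valuation T \<Longrightarrow> T \<Turnstile> \<phi>"
  shows "T \<Turnstile> (\<^bold>\<forall>x\<^bold>. \<phi>)"
  using assms by (intro valuation_setmm[OF assms(1)] ax_gen setmm_if_valuations)

text \<open>Reasoning beneath a quantifier: what holds in all valuations is a theorem, so the
  implication can be generalized and then distributed by ax-4.\<close>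

lemma all_mono:
  assumes "valuation T" "T \<Turnstile> (\<^bold>\<forall>x\<^bold>. \<phi>)" "\<And>T. valuation T \<Longrightarrow> T \<Turnstile> \<phi> \<Longrightarrow> T \<Turnstile> \<psi>"
  shows "T \<Turnstile> (\<^bold>\<forall>x\<^bold>. \<psi>)"
proof -
  have "T \<Turnstile> (\<^bold>\<forall>x\<^bold>. (\<phi> \<^bold>\<rightarrow> \<psi>))"
    using assms by (intro all_valid) (auto simp: valuation_simps)
  then show ?thesis
    using assms valuation_setmm[OF assms(1) ax_4] by (auto simp: valuation_simps)
qed

lemma all_mono2:
  assumes "valuation T" "T \<Turnstile> (\<^bold>\<forall>x\<^bold>. \<phi>)" "T \<Turnstile> (\<^bold>\<forall>x\<^bold>. \<phi>')"
    "\<And>T. valuation T \<Longrightarrow> T \<Turnstile> \<phi> \<Longrightarrow> T \<Turnstile> \<phi>' \<Longrightarrow> T \<Turnstile> \<psi>"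
  shows "T \<Turnstile> (\<^bold>\<forall>x\<^bold>. \<psi>)"
proof -
  have "T \<Turnstile> (\<^bold>\<forall>x\<^bold>. (\<phi>' \<^bold>\<rightarrow> \<psi>))"
    using assms by (intro all_mono[OF assms(1,2)]) (auto simp: valuation_simps)
  then show ?thesis
    using assms valuation_setmm[OF assms(1) ax_4] by (auto simp: valuation_simps)
qed

lemma all_vacuous: "valuation T \<Longrightarrow> x \<notin> wvars \<phi> \<Longrightarrow> T \<Turnstile> \<phi> \<Longrightarrow> T \<Turnstile> (\<^bold>\<forall>x\<^bold>. \<phi>)"
  using valuation_setmm[OF _ ax_5[of x \<phi>]] by (auto simp: valuation_simps)

lemma exists_eq: "valuation T \<Longrightarrow> \<not> T \<Turnstile> (\<^bold>\<forall>x\<^bold>. \<^bold>\<not> (cv x \<^bold>= cv y))"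
  using valuation_setmm[OF _ ax_6[of x y]] by (auto simp: valuation_simps)

lemma exists_fresh:
  assumes "finite X"
  obtains z :: svar where "z \<notin> X"
proof -
  have "infinite (range Aux)" by (rule range_inj_infinite) (auto simp: inj_def)
  then have "infinite (UNIV :: svar set)" by (meson finite_subset subset_UNIV)
  then show ?thesis using assms that ex_new_if_finite by blast
qed

lemma holds_ax_7:
  assumes "valuation T" "T \<Turnstile> (cv x \<^bold>= cv y)" "T \<Turnstile> (cv x \<^bold>= cv z)"
  shows "T \<Turnstile> (cv y \<^bold>= cv z)"
  using assms valuation_setmm[OF assms(1) ax_7[of x y z]] by (simp add: valuation_simps)

lemma holds_ax_10: "valuation T \<Longrightarrow> \<not> T \<Turnstile> (\<^bold>\<forall>x\<^bold>. \<phi>) \<Longrightarrow> T \<Turnstile> (\<^bold>\<forall>x\<^bold>. \<^bold>\<not> (\<^bold>\<forall>x\<^bold>. \<phi>))"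
  using valuation_setmm[OF _ ax_10[of x \<phi>]] by (simp add: valuation_simps)

text \<open>By ax-7, anything equal to y shows that y equals itself, and ax-6 provides such a thing
  under a fresh name x.\<close>

lemma eq_refl:
  assumes "valuation T"
  shows "T \<Turnstile> (cv y \<^bold>= cv y)"
proof (rule ccontr)
  assume "\<not> T \<Turnstile> (cv y \<^bold>= cv y)"
  then have 1: "T \<Turnstile> (\<^bold>\<not> (cv y \<^bold>= cv y))" using assms by (simp add: valuation_simps)
  obtain x where x: "x \<notin> {y}" using exists_fresh[of "{y}"] by auto
  have "T \<Turnstile> (\<^bold>\<forall>x\<^bold>. \<^bold>\<not> (cv y \<^bold>= cv y))" using all_vacuous[OF assms _ 1] x by simp
  then have "T \<Turnstile> (\<^bold>\<forall>x\<^bold>. \<^bold>\<not> (cv x \<^bold>= cv y))"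
    by (rule all_mono[OF assms]) (auto simp: valuation_simps intro: holds_ax_7)
  then show False using exists_eq assms by blast
qed

lemma eq_sym:
  assumes "valuation T" "T \<Turnstile> (cv x \<^bold>= cv y)"
  shows "T \<Turnstile> (cv y \<^bold>= cv x)"
  using assms valuation_setmm[OF assms(1) ax_7[of x y x]] eq_refl[OF assms(1), of x]
  by (simp add: valuation_simps)

lemma eq_trans:
  assumes "valuation T" "T \<Turnstile> (cv x \<^bold>= cv y)" "T \<Turnstile> (cv y \<^bold>= cv z)"
  shows "T \<Turnstile> (cv x \<^bold>= cv z)"
  using assms valuation_setmm[OF assms(1) ax_7[of y x z]] eq_sym[OF assms(1,2)]
  by (simp add: valuation_simps)

text \<open>By ax-6 something equals y, and a variable z foreign to \<phi> may be taken to be it.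
  This introduces copies of variables without substitution.\<close>

lemma fresh_eq:
  assumes "valuation T" "z \<notin> wvars \<phi>" "\<And>T. valuation T \<Longrightarrow> T \<Turnstile> (cv z \<^bold>= cv y) \<Longrightarrow> T \<Turnstile> \<phi>"
  shows "T \<Turnstile> \<phi>"
proof (rule ccontr)
  assume "\<not> T \<Turnstile> \<phi>"
  then have "T \<Turnstile> (\<^bold>\<not> \<phi>)" using assms by (simp add: valuation_simps)
  then have "T \<Turnstile> (\<^bold>\<forall>z\<^bold>. \<^bold>\<not> \<phi>)" using all_vacuous assms by simp
  then have "T \<Turnstile> (\<^bold>\<forall>z\<^bold>. \<^bold>\<not> (cv z \<^bold>= cv y))"
    by (rule all_mono[OF assms(1)]) (use assms in \<open>auto simp: valuation_simps\<close>)
  then show False using exists_eq assms by blast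
qed

text \<open>Specialization has to be derived. With a fresh y equal to x, a failure of \<phi> would
  spread by ax-12 to every x equal to y, so that no x could equal y, against ax-6.\<close>

lemma all_sp:
  assumes "valuation T" "T \<Turnstile> (\<^bold>\<forall>x\<^bold>. \<phi>)"
  shows "T \<Turnstile> \<phi>"
proof -
  obtain y where y: "y \<notin> insert x (wvars \<phi>)" using exists_fresh[of "insert x (wvars \<phi>)"] by auto
  have "T \<Turnstile> (\<^bold>\<forall>x\<^bold>. \<phi> \<^bold>\<rightarrow> \<phi>)"
  proof (rule fresh_eq[OF assms(1)])
    show "y \<notin> wvars (\<^bold>\<forall>x\<^bold>. \<phi> \<^bold>\<rightarrow> \<phi>)" using y by simp
    fix T assume T: "valuation T" "T \<Turnstile> (cv y \<^bold>= cv x)"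
    show "T \<Turnstile> (\<^bold>\<forall>x\<^bold>. \<phi> \<^bold>\<rightarrow> \<phi>)"
    proof (rule ccontr)
      assume "\<not> T \<Turnstile> (\<^bold>\<forall>x\<^bold>. \<phi> \<^bold>\<rightarrow> \<phi>)"
      then have a: "T \<Turnstile> (\<^bold>\<forall>x\<^bold>. \<phi>)" "T \<Turnstile> (\<^bold>\<not> \<phi>)" using T by (auto simp: valuation_simps)
      then have "T \<Turnstile> (\<^bold>\<forall>y\<^bold>. \<^bold>\<not> \<phi>)" using all_vacuous[OF T(1) _ a(2)] y by simp
      then have "T \<Turnstile> (\<^bold>\<forall>x\<^bold>. (cv x \<^bold>= cv y \<^bold>\<rightarrow> \<^bold>\<not> \<phi>))"
        using valuation_setmm[OF T(1) ax_12[of x y "\<^bold>\<not> \<phi>"]] eq_sym[OF T] T by (auto simp: valuation_simps)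
      then have "T \<Turnstile> (\<^bold>\<forall>x\<^bold>. \<^bold>\<not> (cv x \<^bold>= cv y))"
        by (rule all_mono2[OF T(1) a(1)]) (auto simp: valuation_simps)
      then show False using exists_eq T by blast
    qed
  qed
  then show ?thesis using assms by (simp add: valuation_simps)
qed

text \<open>Unlike in ax-12, the variable \<open>d\<close> may occur in \<open>\<phi>\<close>.\<close>

lemma eq_imp_all_eq:
  assumes "valuation T" "x \<noteq> d" "T \<Turnstile> (cv x \<^bold>= cv d)" "T \<Turnstile> \<phi>"
  shows "T \<Turnstile> (\<^bold>\<forall>x\<^bold>. (cv x \<^bold>= cv d \<^bold>\<rightarrow> \<phi>))"
proof -
  let ?G = "cv x \<^bold>= cv d \<^bold>\<rightarrow> \<phi> \<^bold>\<rightarrow> \<^bold>\<forall>x\<^bold>. (cv x \<^bold>= cv d \<^bold>\<rightarrow> \<phi>)"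
  \<comment> \<open>A copy z of d that \<phi> does not mention meets the requirement of ax-12, since
    \<phi> then implies \<forall>z \<phi>.\<close>
  obtain z where z: "z \<notin> {x,d} \<union> wvars \<phi>" using exists_fresh[of "{x,d} \<union> wvars \<phi>"] by auto
  have "T \<Turnstile> ?G"
  proof (rule fresh_eq[OF assms(1)])
    show "z \<notin> wvars ?G" using z by simp
    fix T assume T: "valuation T" "T \<Turnstile> (cv z \<^bold>= cv d)"
    have "T \<Turnstile> (\<^bold>\<forall>x\<^bold>. (cv x \<^bold>= cv d \<^bold>\<rightarrow> \<phi>))" if a: "T \<Turnstile> (cv x \<^bold>= cv d)" "T \<Turnstile> \<phi>"
    proof -
      have "T \<Turnstile> (\<^bold>\<forall>z\<^bold>. \<phi>)" using all_vacuous[OF T(1) _ a(2)] z by simp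
      then have 1: "T \<Turnstile> (\<^bold>\<forall>x\<^bold>. (cv x \<^bold>= cv z \<^bold>\<rightarrow> \<phi>))"
        using valuation_setmm[OF T(1) ax_12[of x z \<phi>]] eq_trans[OF T(1) a(1) eq_sym[OF T]] T
        by (simp add: valuation_simps)
      have "T \<Turnstile> (\<^bold>\<forall>x\<^bold>. (cv z \<^bold>= cv d))" using all_vacuous[OF T(1) _ T(2), of x] z assms(2) by auto
      show ?thesis
        by (rule all_mono2[OF T(1) 1 \<open>T \<Turnstile> (\<^bold>\<forall>x\<^bold>. (cv z \<^bold>= cv d))\<close>])
          (simp add: valuation_simps, metis eq_trans eq_sym)
    qed
    then show "T \<Turnstile> ?G" using T by (simp add: valuation_simps)
  qed
  then show ?thesis using assms by (simp add: valuation_simps)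
qed

text \<open>The valuation obtained from \<open>T\<close> by giving \<open>x\<close> the value of \<open>d\<close>.\<close>

definition vsub :: "wff set \<Rightarrow> svar \<Rightarrow> svar \<Rightarrow> wff set"
  where "vsub T x d = {\<phi>. T \<Turnstile> (\<^bold>\<forall>x\<^bold>. (cv x \<^bold>= cv d \<^bold>\<rightarrow> \<phi>))}"

lemma holds_vsub: "vsub T x d \<Turnstile> \<phi> \<longleftrightarrow> T \<Turnstile> (\<^bold>\<forall>x\<^bold>. (cv x \<^bold>= cv d \<^bold>\<rightarrow> \<phi>))"
  by (simp add: vsub_def)

text \<open>Consistency is ax-6. For completeness, ax-10 carries the failure beneath the quantifier,
  where \<open>eq_imp_all_eq\<close> shows that \<phi> true at one x equal to d is true at all of
  them.\<close>

lemma vsub_not: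
  assumes "valuation T" "x \<noteq> d"
  shows "vsub T x d \<Turnstile> (\<^bold>\<not> \<phi>) \<longleftrightarrow> \<not> vsub T x d \<Turnstile> \<phi>"
proof
  assume a: "vsub T x d \<Turnstile> (\<^bold>\<not> \<phi>)"
  show "\<not> vsub T x d \<Turnstile> \<phi>"
  proof
    assume "vsub T x d \<Turnstile> \<phi>"
    from this[unfolded holds_vsub] have "T \<Turnstile> (\<^bold>\<forall>x\<^bold>. \<^bold>\<not> (cv x \<^bold>= cv d))"
      by (rule all_mono2[OF assms(1) a[unfolded holds_vsub]]) (auto simp: valuation_simps)
    then show False using assms exists_eq by blast
  qed
next
  assume "\<not> vsub T x d \<Turnstile> \<phi>"
  then have "T \<Turnstile> (\<^bold>\<forall>x\<^bold>. \<^bold>\<not> (\<^bold>\<forall>x\<^bold>. (cv x \<^bold>= cv d \<^bold>\<rightarrow> \<phi>)))"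
    using valuation_setmm[OF assms(1) ax_10] assms by (simp add: valuation_simps holds_vsub)
  then show "vsub T x d \<Turnstile> (\<^bold>\<not> \<phi>)"
    unfolding holds_vsub
    by (rule all_mono[OF assms(1)]) (simp add: valuation_simps, use eq_imp_all_eq[OF _ assms(2)] in blast)
qed

lemma valuation_vsub:
  assumes "valuation T" "x \<noteq> d"
  shows "valuation (vsub T x d)"
proof -
  have "vsub T x d \<Turnstile> (\<phi> \<^bold>\<rightarrow> \<psi>) \<longleftrightarrow> (vsub T x d \<Turnstile> \<phi> \<longrightarrow> vsub T x d \<Turnstile> \<psi>)" for \<phi> \<psi>
  proof (intro iffI impI)
    assume "vsub T x d \<Turnstile> (\<phi> \<^bold>\<rightarrow> \<psi>)" "vsub T x d \<Turnstile> \<phi>"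
    from this[unfolded holds_vsub] show "vsub T x d \<Turnstile> \<psi>" unfolding holds_vsub
      by (rule all_mono2[OF assms(1)]) (auto simp: valuation_simps)
  next
    assume "vsub T x d \<Turnstile> \<phi> \<longrightarrow> vsub T x d \<Turnstile> \<psi>"
    then have "vsub T x d \<Turnstile> (\<^bold>\<not> \<phi>) \<or> vsub T x d \<Turnstile> \<psi>" using vsub_not assms by blast
    then show "vsub T x d \<Turnstile> (\<phi> \<^bold>\<rightarrow> \<psi>)" unfolding holds_vsub
    proof
      assume "T \<Turnstile> (\<^bold>\<forall>x\<^bold>. (cv x \<^bold>= cv d \<^bold>\<rightarrow> \<^bold>\<not> \<phi>))"
      then show "T \<Turnstile> (\<^bold>\<forall>x\<^bold>. (cv x \<^bold>= cv d \<^bold>\<rightarrow> \<phi> \<^bold>\<rightarrow> \<psi>))" by (rule all_mono[OF assms(1)]) (simp add: valuation_simps)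
    next
      assume "T \<Turnstile> (\<^bold>\<forall>x\<^bold>. (cv x \<^bold>= cv d \<^bold>\<rightarrow> \<psi>))"
      then show "T \<Turnstile> (\<^bold>\<forall>x\<^bold>. (cv x \<^bold>= cv d \<^bold>\<rightarrow> \<phi> \<^bold>\<rightarrow> \<psi>))" by (rule all_mono[OF assms(1)]) (simp add: valuation_simps)
    qed
  qed
  moreover have "vsub T x d \<Turnstile> \<phi>" if "setmm \<phi>" for \<phi>
    unfolding holds_vsub using that
    by (intro all_valid[OF assms(1)]) (auto simp: valuation_simps valuation_setmm)
  ultimately show ?thesis using vsub_not[OF assms] by (simp add: valuation_def)
qed

lemma vsub_eq: "valuation T \<Longrightarrow> vsub T x d \<Turnstile> (cv x \<^bold>= cv d)"
  unfolding holds_vsub by (rule all_valid) (auto simp: valuation_simps)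

lemma vsub_vacuous:
  assumes "valuation T" "x \<noteq> d" "x \<notin> wvars \<phi>"
  shows "vsub T x d \<Turnstile> \<phi> \<longleftrightarrow> T \<Turnstile> \<phi>"
proof -
  have *: "vsub T x d \<Turnstile> \<phi>" if "T \<Turnstile> \<phi>" "x \<notin> wvars \<phi>" for \<phi>
    unfolding holds_vsub using all_vacuous[OF assms(1) that(2,1)]
    by (rule all_mono[OF assms(1)]) (auto simp: valuation_simps)
  show ?thesis using *[of \<phi>] *[of "\<^bold>\<not> \<phi>"] assms
    by (auto simp: vsub_not valuation_simps)
qed

lemma all_commute: "valuation T \<Longrightarrow> T \<Turnstile> (\<^bold>\<forall>x\<^bold>. \<^bold>\<forall>y\<^bold>. \<phi>) \<longleftrightarrow> T \<Turnstile> (\<^bold>\<forall>y\<^bold>. \<^bold>\<forall>x\<^bold>. \<phi>)"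
  using valuation_setmm[OF _ ax_11[of x y \<phi>]] valuation_setmm[OF _ ax_11[of y x \<phi>]]
  by (auto simp: valuation_simps)

section \<open>Witnesses\<close>

text \<open>A witness is an assignment of \<open>D j\<close> to x, not an instance of \<phi>. The
  variables in \<open>range D\<close> are excepted so that \<open>vsub T x (D j)\<close> always
  concerns two distinct variables.\<close>

definition henkin :: "(nat \<Rightarrow> svar) \<Rightarrow> wff set \<Rightarrow> bool"
  where "henkin D T \<longleftrightarrow>
    (\<forall>x \<phi>. x \<notin> range D \<longrightarrow> \<not> T \<Turnstile> (\<^bold>\<forall>x\<^bold>. \<phi>) \<longrightarrow> (\<exists>j. \<not> vsub T x (D j) \<Turnstile> \<phi>))"

text \<open>The quantifier over d covers the d that equals x, so generalizing over a fresh witness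
  gives back the quantified formula.\<close>

lemma all_of_fresh_instance:
  assumes "valuation T" "d \<notin> insert x (wvars \<phi>)" "T \<Turnstile> (\<^bold>\<forall>d\<^bold>. \<^bold>\<forall>x\<^bold>. (cv x \<^bold>= cv d \<^bold>\<rightarrow> \<phi>))"
  shows "T \<Turnstile> (\<^bold>\<forall>x\<^bold>. \<phi>)"
proof -
  have "T \<Turnstile> (\<^bold>\<forall>x\<^bold>. \<^bold>\<forall>d\<^bold>. (cv x \<^bold>= cv d \<^bold>\<rightarrow> \<phi>))" using all_commute assms by blast
  then show ?thesis
  proof (rule all_mono[OF assms(1)])
    fix T assume T: "valuation T" and a: "T \<Turnstile> (\<^bold>\<forall>d\<^bold>. (cv x \<^bold>= cv d \<^bold>\<rightarrow> \<phi>))"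
    show "T \<Turnstile> \<phi>"
    proof (rule ccontr)
      assume "\<not> T \<Turnstile> \<phi>"
      then have "T \<Turnstile> (\<^bold>\<forall>d\<^bold>. \<^bold>\<not> \<phi>)" using all_vacuous[OF T] assms(2) T by (simp add: valuation_simps)
      then have "T \<Turnstile> (\<^bold>\<forall>d\<^bold>. \<^bold>\<not> (cv d \<^bold>= cv x))"
        by (rule all_mono2[OF T a]) (simp add: valuation_simps, use eq_sym in blast)
      then show False using exists_eq T by blast
    qed
  qed
qed

lemma henkin_valuation:
  assumes "\<not> setmm \<chi>" "inj D"
  obtains T where "valuation T" "\<not> T \<Turnstile> \<chi>" "henkin D T"
proof -
  define W where "W \<psi> = (case \<psi> of (\<^bold>\<forall>x\<^bold>. \<phi>) \<Rightarrow>
      insert \<psi> {\<^bold>\<not> (\<^bold>\<forall>x\<^bold>. (cv x \<^bold>= cv (D j) \<^bold>\<rightarrow> \<phi>)) | j. True} | _ \<Rightarrow> {\<psi> \<^bold>\<rightarrow> \<psi>})" for \<psi>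
  have "\<exists>\<theta>\<in>W \<psi>. \<not> setmm (\<theta> \<^bold>\<rightarrow> \<chi>)" if \<chi>: "\<not> setmm \<chi>" for \<psi> \<chi>
  proof (cases "\<exists>x \<phi>. \<psi> = (\<^bold>\<forall>x\<^bold>. \<phi>)")
    case True
    then obtain x \<phi> where \<psi>: "\<psi> = (\<^bold>\<forall>x\<^bold>. \<phi>)" by blast
    \<comment> \<open>In the construction \<chi> is the history of all choices so far, so a d
      foreign to \<chi> is foreign to all of them.\<close>
    have "infinite (range D)" using assms(2) by (rule range_inj_infinite)
    then obtain d where d: "d \<in> range D" "d \<notin> {x} \<union> wvars \<phi> \<union> wvars \<chi>"
      by (metis (no_types, lifting) finite.emptyI finite.insertI finite_Un finite_subset finite_wvars subsetI)
    then obtain j where j: "d = D j" by auto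
    show ?thesis
    proof (rule ccontr)
      assume "\<not> (\<exists>\<theta>\<in>W \<psi>. \<not> setmm (\<theta> \<^bold>\<rightarrow> \<chi>))"
      then have a: "setmm (\<psi> \<^bold>\<rightarrow> \<chi>)" "setmm (\<^bold>\<not> (\<^bold>\<forall>x\<^bold>. (cv x \<^bold>= cv d \<^bold>\<rightarrow> \<phi>)) \<^bold>\<rightarrow> \<chi>)"
        using \<psi> j by (auto simp: W_def)
      have "setmm \<chi>"
      proof (rule setmm_if_valuations, rule ccontr)
        fix T assume T: "valuation T" and n: "\<not> T \<Turnstile> \<chi>"
        then have "T \<Turnstile> (\<^bold>\<forall>d\<^bold>. \<^bold>\<not> \<chi>)" using all_vacuous[OF T] d(2) by (simp add: valuation_simps)
        then have "T \<Turnstile> (\<^bold>\<forall>d\<^bold>. \<^bold>\<forall>x\<^bold>. (cv x \<^bold>= cv d \<^bold>\<rightarrow> \<phi>))"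
          by (rule all_mono[OF T]) (use valuation_setmm[OF _ a(2)] in \<open>auto simp: valuation_simps\<close>)
        then have "T \<Turnstile> \<psi>" using all_of_fresh_instance[OF T] d(2) \<psi> by blast
        then show False using n valuation_setmm[OF T a(1)] T by (simp add: valuation_simps)
      qed
      then show False using \<chi> by blast
    qed
  next
    case False
    then have "W \<psi> = {\<psi> \<^bold>\<rightarrow> \<psi>}" by (auto simp: W_def split: wff.splits)
    then show ?thesis using that ax_mp setmm_id by blast
  qed
  then obtain T where T: "valuation T" "\<not> T \<Turnstile> \<chi>" "\<And>\<psi>. \<exists>\<theta>\<in>W \<psi>. T \<Turnstile> \<theta>"
    using valuation_generic[OF assms(1), of W] by metis
  have "henkin D T" unfolding henkin_def
  proof (intro allI impI)
    fix x \<phi> assume n: "\<not> T \<Turnstile> (\<^bold>\<forall>x\<^bold>. \<phi>)"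
    obtain \<theta> where "\<theta> \<in> W (\<^bold>\<forall>x\<^bold>. \<phi>)" "T \<Turnstile> \<theta>" using T(3)[of "\<^bold>\<forall>x\<^bold>. \<phi>"] ..
    with n obtain j where "T \<Turnstile> (\<^bold>\<not> (\<^bold>\<forall>x\<^bold>. (cv x \<^bold>= cv (D j) \<^bold>\<rightarrow> \<phi>)))" by (auto simp: W_def)
    then show "\<exists>j. \<not> vsub T x (D j) \<Turnstile> \<phi>" using T(1) by (auto simp: holds_vsub valuation_simps)
  qed
  then show ?thesis using that[OF T(1,2)] by simp
qed

text \<open>In modal terms ax-10 is axiom 5, and together with specialization it yields axiom
  4.\<close>

lemma all_all:
  assumes "valuation T" "T \<Turnstile> (\<^bold>\<forall>x\<^bold>. \<phi>)"
  shows "T \<Turnstile> (\<^bold>\<forall>x\<^bold>. \<^bold>\<forall>x\<^bold>. \<phi>)"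
proof -
  have "\<not> T \<Turnstile> (\<^bold>\<forall>x\<^bold>. \<^bold>\<not> (\<^bold>\<forall>x\<^bold>. \<phi>))" using all_sp[OF assms(1), of x "\<^bold>\<not> (\<^bold>\<forall>x\<^bold>. \<phi>)"] assms by (auto simp: valuation_simps)
  then have "T \<Turnstile> (\<^bold>\<forall>x\<^bold>. \<^bold>\<not> (\<^bold>\<forall>x\<^bold>. \<^bold>\<not> (\<^bold>\<forall>x\<^bold>. \<phi>)))"
    using holds_ax_10[OF assms(1)] by blast
  then show ?thesis
    by (rule all_mono[OF assms(1)]) (simp add: valuation_simps, use holds_ax_10 in blast)
qed

text \<open>ax-5 does not apply, because x occurs in \<forall>x \<phi>; it is ax-10 that makes the
  truth of this formula independent of x.\<close>

lemma vsub_all_same: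
  assumes "valuation T" "x \<noteq> d"
  shows "vsub T x d \<Turnstile> (\<^bold>\<forall>x\<^bold>. \<phi>) \<longleftrightarrow> T \<Turnstile> (\<^bold>\<forall>x\<^bold>. \<phi>)"
proof
  assume "T \<Turnstile> (\<^bold>\<forall>x\<^bold>. \<phi>)"
  from all_all[OF assms(1) this] show "vsub T x d \<Turnstile> (\<^bold>\<forall>x\<^bold>. \<phi>)" unfolding holds_vsub
    by (rule all_mono[OF assms(1)]) (auto simp: valuation_simps)
next
  assume a: "vsub T x d \<Turnstile> (\<^bold>\<forall>x\<^bold>. \<phi>)"
  show "T \<Turnstile> (\<^bold>\<forall>x\<^bold>. \<phi>)"
  proof (rule ccontr)
    assume "\<not> T \<Turnstile> (\<^bold>\<forall>x\<^bold>. \<phi>)"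
    then have "T \<Turnstile> (\<^bold>\<forall>x\<^bold>. \<^bold>\<not> (\<^bold>\<forall>x\<^bold>. \<phi>))"
      using holds_ax_10[OF assms(1)] by blast
    then have "vsub T x d \<Turnstile> (\<^bold>\<not> (\<^bold>\<forall>x\<^bold>. \<phi>))" unfolding holds_vsub
      by (rule all_mono[OF assms(1)]) (auto simp: valuation_simps)
    then show False using a vsub_not assms by blast
  qed
qed

lemma all_imp_distrib:
  assumes "valuation T" "y \<notin> wvars \<phi>"
  shows "T \<Turnstile> (\<^bold>\<forall>x\<^bold>. \<^bold>\<forall>y\<^bold>. (\<phi> \<^bold>\<rightarrow> \<psi>)) \<longleftrightarrow> T \<Turnstile> (\<^bold>\<forall>x\<^bold>. (\<phi> \<^bold>\<rightarrow> \<^bold>\<forall>y\<^bold>. \<psi>))"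
proof
  assume "T \<Turnstile> (\<^bold>\<forall>x\<^bold>. \<^bold>\<forall>y\<^bold>. (\<phi> \<^bold>\<rightarrow> \<psi>))"
  then show "T \<Turnstile> (\<^bold>\<forall>x\<^bold>. (\<phi> \<^bold>\<rightarrow> \<^bold>\<forall>y\<^bold>. \<psi>))"
    by (rule all_mono[OF assms(1)])
      (use all_vacuous[OF _ assms(2)] valuation_setmm[OF _ ax_4[of y \<phi> \<psi>]] in \<open>simp add: valuation_simps\<close>)
next
  assume "T \<Turnstile> (\<^bold>\<forall>x\<^bold>. (\<phi> \<^bold>\<rightarrow> \<^bold>\<forall>y\<^bold>. \<psi>))"
  then show "T \<Turnstile> (\<^bold>\<forall>x\<^bold>. \<^bold>\<forall>y\<^bold>. (\<phi> \<^bold>\<rightarrow> \<psi>))"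
  proof (rule all_mono[OF assms(1)])
    fix T assume T: "valuation T" "T \<Turnstile> (\<phi> \<^bold>\<rightarrow> \<^bold>\<forall>y\<^bold>. \<psi>)"
    show "T \<Turnstile> (\<^bold>\<forall>y\<^bold>. (\<phi> \<^bold>\<rightarrow> \<psi>))"
    proof (cases "T \<Turnstile> \<phi>")
      case True
      then have "T \<Turnstile> (\<^bold>\<forall>y\<^bold>. \<psi>)" using T by (simp add: valuation_simps)
      then show ?thesis by (rule all_mono[OF T(1)]) (auto simp: valuation_simps)
    next
      case False
      then have "T \<Turnstile> (\<^bold>\<forall>y\<^bold>. \<^bold>\<not> \<phi>)" using T assms all_vacuous by (simp add: valuation_simps)
      then show ?thesis by (rule all_mono[OF T(1)]) (auto simp: valuation_simps)
    qed
  qed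
qed

text \<open>Witnesses remain available after a variable has received a value. For y = x the new
  value overwrites the old one; otherwise ax-11 exchanges the two quantifiers.\<close>

lemma henkin_vsub:
  assumes T: "valuation T" "henkin D T" and x: "x \<notin> range D"
  shows "henkin D (vsub T x (D k))"
  unfolding henkin_def
proof (intro allI impI)
  fix y \<phi> assume y: "y \<notin> range D" and n: "\<not> vsub T x (D k) \<Turnstile> (\<^bold>\<forall>y\<^bold>. \<phi>)"
  let ?d = "cv (D k)"
  have xy: "x \<noteq> D j" "y \<noteq> D j" "D j \<noteq> x" "D j \<noteq> y" for j using x y by auto
  show "\<exists>j. \<not> vsub (vsub T x (D k)) y (D j) \<Turnstile> \<phi>"
  proof (cases "y = x")
    case True
    have "\<not> T \<Turnstile> (\<^bold>\<forall>y\<^bold>. \<phi>)" using n vsub_all_same T True xy by simp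
    then obtain j where "\<not> vsub T y (D j) \<Turnstile> \<phi>" using T(2) y unfolding henkin_def by blast
    then have "\<not> vsub (vsub T x (D k)) y (D j) \<Turnstile> \<phi>"
      using True vsub_all_same[OF T(1)] xy by (simp add: holds_vsub[where T = "vsub T x (D k)"] holds_vsub[where d = "D j" and T = T])
    then show ?thesis by blast
  next
    case False
    have "\<not> T \<Turnstile> (\<^bold>\<forall>y\<^bold>. \<^bold>\<forall>x\<^bold>. (cv x \<^bold>= ?d \<^bold>\<rightarrow> \<phi>))"
      using n False xy by (simp add: holds_vsub all_imp_distrib[symmetric] all_commute[of T x y] T)
    then obtain j where j: "\<not> vsub T y (D j) \<Turnstile> (\<^bold>\<forall>x\<^bold>. (cv x \<^bold>= ?d \<^bold>\<rightarrow> \<phi>))"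
      using T(2) y unfolding henkin_def by blast
    have "\<not> vsub (vsub T x (D k)) y (D j) \<Turnstile> \<phi>"
    proof
      assume "vsub (vsub T x (D k)) y (D j) \<Turnstile> \<phi>"
      then have "T \<Turnstile> (\<^bold>\<forall>x\<^bold>. \<^bold>\<forall>y\<^bold>. (cv x \<^bold>= ?d \<^bold>\<rightarrow> cv y \<^bold>= cv (D j) \<^bold>\<rightarrow> \<phi>))"
        using T False xy by (simp add: holds_vsub all_imp_distrib)
      then have "T \<Turnstile> (\<^bold>\<forall>y\<^bold>. \<^bold>\<forall>x\<^bold>. (cv x \<^bold>= ?d \<^bold>\<rightarrow> cv y \<^bold>= cv (D j) \<^bold>\<rightarrow> \<phi>))" using all_commute T by blast
      then have "T \<Turnstile> (\<^bold>\<forall>y\<^bold>. \<^bold>\<forall>x\<^bold>. (cv y \<^bold>= cv (D j) \<^bold>\<rightarrow> cv x \<^bold>= ?d \<^bold>\<rightarrow> \<phi>))"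
        by (rule all_mono[OF T(1) _ all_mono]) (auto simp: valuation_simps)
      then show False
        using j T False xy by (simp add: holds_vsub all_imp_distrib)
    qed
    then show ?thesis by blast
  qed
qed

section \<open>Tarski semantics and completeness\<close>

text \<open>
  The relation \<open>E\<close> of the Henkin model is not extensional at first, so that the clause for \<open>A \<^bold>\<in> B\<close>
  has to allow any element with the same members as \<open>A\<close>, even if \<open>A\<close> is a variable.
\<close>

primrec sat :: "('m \<Rightarrow> 'm \<Rightarrow> bool) \<Rightarrow> (svar \<Rightarrow> 'm) \<Rightarrow> wff \<Rightarrow> bool"
  and den :: "('m \<Rightarrow> 'm \<Rightarrow> bool) \<Rightarrow> (svar \<Rightarrow> 'm) \<Rightarrow> cls \<Rightarrow> 'm set"
  where
    "sat E v (\<phi> \<^bold>\<rightarrow> \<psi>) = (sat E v \<phi> \<longrightarrow> sat E v \<psi>)"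
  | "sat E v (\<^bold>\<not> \<phi>) = (\<not> sat E v \<phi>)"
  | "sat E v (\<^bold>\<forall>x\<^bold>. \<phi>) = (\<forall>a. sat E (v(x := a)) \<phi>)"
  | "sat E v (A \<^bold>= B) = (den E v A = den E v B)"
  | "sat E v (A \<^bold>\<in> B) = (\<exists>m. {a. E a m} = den E v A \<and> m \<in> den E v B)"
  | "den E v (cv x) = {a. E a (v x)}"
  | "den E v (cab x \<phi>) = {a. sat E (v(x := a)) \<phi>}"

lemma sat_cong: "(\<And>x. x \<in> wvars \<phi> \<Longrightarrow> v x = w x) \<Longrightarrow> sat E v \<phi> = sat E w \<phi>"
  and den_cong: "(\<And>x. x \<in> cvars A \<Longrightarrow> v x = w x) \<Longrightarrow> den E v A = den E w A"
proof (induction \<phi> and A arbitrary: v w and v w)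
  case (wal x \<phi>)
  have "sat E (v(x := a)) \<phi> = sat E (w(x := a)) \<phi>" for a by (rule wal.IH) (use wal.prems in auto)
  then show ?case by simp
next
  case (cab x \<phi>)
  have "sat E (v(x := a)) \<phi> = sat E (w(x := a)) \<phi>" for a by (rule cab.IH) (use cab.prems in auto)
  then show ?case by simp
next
  case (wi \<phi> \<psi>)
  show ?case using wi.IH[of v w] wi.prems by simp
next
  case (wceq A B)
  show ?case using wceq.IH[of v w] wceq.prems by simp
next
  case (wcel A B)
  show ?case using wcel.IH[of v w] wcel.prems by simp
next
  case (wn \<phi>)
  show ?case using wn.IH[of v w] wn.prems by simp
next
  case (cv x)
  then show ?case by simp
qed

lemma sat_upd [simp]: "x \<notin> wvars \<phi> \<Longrightarrow> sat E (v(x := a)) \<phi> = sat E v \<phi>"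
  by (rule sat_cong) auto

lemma den_upd [simp]: "x \<notin> cvars A \<Longrightarrow> den E (v(x := a)) A = den E v A"
  by (rule den_cong) auto

text \<open>ax-8 speaks of set variables only. For a class A the step goes through df-clel, with the
  equality applied beneath its quantifier.\<close>

lemma class_member_cong:
  assumes T: "valuation T" "T \<Turnstile> (cv x \<^bold>= cv y)"
  shows "T \<Turnstile> (cv x \<^bold>\<in> A) \<longleftrightarrow> T \<Turnstile> (cv y \<^bold>\<in> A)"
proof -
  have *: "T \<Turnstile> (cv y \<^bold>\<in> A)" if "T \<Turnstile> (cv x \<^bold>= cv y)" "T \<Turnstile> (cv x \<^bold>\<in> A)" for x y
  proof -
    obtain w where w: "w \<notin> {x,y} \<union> cvars A" using exists_fresh[of "{x,y} \<union> cvars A"] by auto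
    have 1: "\<not> T \<Turnstile> (\<^bold>\<forall>w\<^bold>. \<^bold>\<not> (cv w \<^bold>= cv x \<^bold>\<and> cv w \<^bold>\<in> A))"
      using valuation_setmm[OF T(1) df_clel[of w "cv x" A]] w that T by (simp add: valuation_simps)
    have "\<not> T \<Turnstile> (\<^bold>\<forall>w\<^bold>. \<^bold>\<not> (cv w \<^bold>= cv y \<^bold>\<and> cv w \<^bold>\<in> A))"
    proof
      assume a: "T \<Turnstile> (\<^bold>\<forall>w\<^bold>. \<^bold>\<not> (cv w \<^bold>= cv y \<^bold>\<and> cv w \<^bold>\<in> A))"
      have "T \<Turnstile> (\<^bold>\<forall>w\<^bold>. (cv x \<^bold>= cv y))" using all_vacuous that(1) T w by simp
      then have "T \<Turnstile> (\<^bold>\<forall>w\<^bold>. \<^bold>\<not> (cv w \<^bold>= cv x \<^bold>\<and> cv w \<^bold>\<in> A))"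
        by (rule all_mono2[OF T(1) a]) (simp add: valuation_simps, use eq_trans in blast)
      then show False using 1 by blast
    qed
    then show ?thesis
      using valuation_setmm[OF T(1) df_clel[of w "cv y" A]] w T by (simp add: valuation_simps)
  qed
  then show ?thesis using T eq_sym[OF T] by blast
qed

lemma member_cong:
  assumes "valuation T" "T \<Turnstile> (cv x \<^bold>= cv y)" "T \<Turnstile> (cv x' \<^bold>= cv y')"
  shows "T \<Turnstile> (cv x \<^bold>\<in> cv x') \<longleftrightarrow> T \<Turnstile> (cv y \<^bold>\<in> cv y')"
  using assms valuation_setmm[OF assms(1) ax_9[of x' y' y]] valuation_setmm[OF assms(1) ax_9[of y' x' y]]
    class_member_cong[OF assms(1,2)] eq_sym[OF assms(1,3)] by (auto simp: valuation_simps)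

text \<open>The existential half of df-sb amounts to truth in \<open>vsub T y x\<close>, because the
  latter decides every formula; the other half follows by specialization.\<close>

lemma valuation_wsb:
  assumes "valuation T" "x \<noteq> y"
  shows "T \<Turnstile> (wsb x y \<phi>) \<longleftrightarrow> vsub T y x \<Turnstile> \<phi>"
proof -
  have "T \<Turnstile> (\<^bold>\<exists>y\<^bold>. (cv y \<^bold>= cv x \<^bold>\<and> \<phi>)) \<longleftrightarrow> \<not> vsub T y x \<Turnstile> (\<^bold>\<not> \<phi>)"
    using all_mono[OF assms(1), of y "cv y \<^bold>= cv x \<^bold>\<rightarrow> \<^bold>\<not> \<phi>" "\<^bold>\<not> (cv y \<^bold>= cv x \<^bold>\<and> \<phi>)"]
      all_mono[OF assms(1), of y "\<^bold>\<not> (cv y \<^bold>= cv x \<^bold>\<and> \<phi>)" "cv y \<^bold>= cv x \<^bold>\<rightarrow> \<^bold>\<not> \<phi>"] assms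
    by (auto simp: valuation_simps holds_vsub)
  then have "T \<Turnstile> (\<^bold>\<exists>y\<^bold>. (cv y \<^bold>= cv x \<^bold>\<and> \<phi>)) \<longleftrightarrow> vsub T y x \<Turnstile> \<phi>" using vsub_not assms by metis
  moreover have "T \<Turnstile> (cv y \<^bold>= cv x \<^bold>\<rightarrow> \<phi>)" if "vsub T y x \<Turnstile> \<phi>"
    using that all_sp assms unfolding holds_vsub by blast
  ultimately show ?thesis using assms by (auto simp: wsb_def valuation_simps)
qed

lemma vsub_member:
  assumes "valuation T" "x \<noteq> d" "x \<notin> cvars A"
  shows "vsub T x d \<Turnstile> (cv x \<^bold>\<in> A) \<longleftrightarrow> T \<Turnstile> (cv d \<^bold>\<in> A)"
  using class_member_cong[OF valuation_vsub[OF assms(1,2)] vsub_eq[OF assms(1)]] assms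
  by (simp add: vsub_vacuous)

section \<open>The Henkin model and its truth lemma\<close>

context
  fixes D :: "nat \<Rightarrow> svar" and P :: "svar set"
  assumes P: "P \<inter> range D = {}" "infinite P"
begin

text \<open>
  The elements of the Henkin model are the indices of the witnesses \<open>D j\<close>.  At a point the variables
  in \<open>X\<close> have the values given by \<open>v\<close>, so the truth lemma needs no substitution into formulas.
\<close>

definition point :: "(nat \<Rightarrow> nat \<Rightarrow> bool) \<Rightarrow> (svar \<Rightarrow> nat) \<Rightarrow> svar set \<Rightarrow> wff set \<Rightarrow> bool"
  where "point E v X T \<longleftrightarrow> valuation T \<and> henkin D T \<and> (\<forall>x\<in>X. T \<Turnstile> (cv x \<^bold>= cv (D (v x)))) \<and>
    (\<forall>i j. E i j \<longleftrightarrow> T \<Turnstile> (cv (D i) \<^bold>\<in> cv (D j)))"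

lemma point_mono: "point E v X T \<Longrightarrow> Y \<subseteq> X \<Longrightarrow> point E v Y T"
  by (auto simp: point_def)

lemma point_vsub:
  assumes "point E v (X - {x}) T" "x \<in> P" "X \<subseteq> P"
  shows "point E (v(x := j)) X (vsub T x (D j))"
proof -
  have x: "x \<notin> range D" and xD: "x \<noteq> D i" "D i \<noteq> x" for i using assms P by auto
  show ?thesis unfolding point_def
    using assms x xD by (auto simp: point_def valuation_vsub henkin_vsub vsub_eq vsub_vacuous)
qed

lemma point_all:
  assumes "point E v X T" "x \<in> P"
  shows "T \<Turnstile> (\<^bold>\<forall>x\<^bold>. \<phi>) \<longleftrightarrow> (\<forall>j. vsub T x (D j) \<Turnstile> \<phi>)"
proof
  assume "T \<Turnstile> (\<^bold>\<forall>x\<^bold>. \<phi>)"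
  then show "\<forall>j. vsub T x (D j) \<Turnstile> \<phi>" unfolding holds_vsub
    using assms all_mono[of T x \<phi>] by (auto simp: point_def valuation_simps)
next
  assume "\<forall>j. vsub T x (D j) \<Turnstile> \<phi>"
  then show "T \<Turnstile> (\<^bold>\<forall>x\<^bold>. \<phi>)" using assms P unfolding point_def henkin_def by blast
qed

lemma point_class_eq:
  assumes p: "point E v X T" and AB: "cvars A \<subseteq> P" "cvars B \<subseteq> P"
    and A: "\<And>j. T \<Turnstile> (cv (D j) \<^bold>\<in> A) \<longleftrightarrow> j \<in> den E v A"
    and B: "\<And>j. T \<Turnstile> (cv (D j) \<^bold>\<in> B) \<longleftrightarrow> j \<in> den E v B"
  shows "T \<Turnstile> (A \<^bold>= B) \<longleftrightarrow> den E v A = den E v B"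
proof -
  obtain z where z: "z \<in> P" "z \<notin> cvars A \<union> cvars B"
    by (metis P(2) finite_UnI finite_cvars finite_subset subsetI)
  then have zD: "z \<noteq> D j" for j using P by auto
  have T: "valuation T" using p by (simp add: point_def)
  have "T \<Turnstile> (A \<^bold>= B) \<longleftrightarrow> (\<forall>j. vsub T z (D j) \<Turnstile> (cv z \<^bold>\<in> A \<^bold>\<leftrightarrow> cv z \<^bold>\<in> B))"
    using valuation_setmm[OF T df_cleq[of z A B]] z point_all[OF p] T by (simp add: valuation_simps)
  also have "\<dots> \<longleftrightarrow> (\<forall>j. T \<Turnstile> (cv (D j) \<^bold>\<in> A) \<longleftrightarrow> T \<Turnstile> (cv (D j) \<^bold>\<in> B))"
    using z zD by (simp add: valuation_simps valuation_vsub T vsub_member)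
  finally show ?thesis using A B by blast
qed

text \<open>T and v vary together: beneath a quantifier, \<open>vsub T x (D j)\<close> goes with
  \<open>v(x := j)\<close>. All variables of the formulas lie in P, so no witness is ever
  bound.\<close>

lemma truth_lemma:
  "\<lbrakk>wvars \<phi> \<subseteq> P; point E v (wvars \<phi>) T\<rbrakk> \<Longrightarrow> T \<Turnstile> \<phi> \<longleftrightarrow> sat E v \<phi>"
  "\<lbrakk>cvars A \<subseteq> P; point E v (cvars A) T\<rbrakk> \<Longrightarrow> T \<Turnstile> (cv (D j) \<^bold>\<in> A) \<longleftrightarrow> j \<in> den E v A"
proof (induction \<phi> and A arbitrary: v T and v T j)
  case (wi \<phi> \<psi>)
  have "point E v (wvars \<phi>) T" "point E v (wvars \<psi>) T" "valuation T"
    using wi.prems(2) by (auto elim: point_mono simp: point_def)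
  then show ?case using wi.IH[of v T] wi.prems(1) by (simp add: valuation_simps)
next
  case (wn \<phi>)
  have "valuation T" using wn.prems(2) by (simp add: point_def)
  then show ?case using wn.IH[of v T] wn.prems by (simp add: valuation_simps)
next
  case (wal x \<phi>)
  have "vsub T x (D j) \<Turnstile> \<phi> = sat E (v(x := j)) \<phi>" for j
    by (rule wal.IH, use wal.prems in simp, rule point_vsub, rule point_mono[OF wal.prems(2)])
      (use wal.prems in auto)
  then show ?case using point_all[OF wal.prems(2)] wal.prems(1) by simp
next
  case (wceq A B)
  have "point E v (cvars A) T" "point E v (cvars B) T"
    using wceq.prems(2) by (auto elim: point_mono)
  then show ?case using wceq.prems wceq.IH[of v T] point_class_eq[OF wceq.prems(2)] by simp
next
  case (wcel A B)
  have T: "valuation T" using wcel.prems by (simp add: point_def)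
  obtain z where z: "z \<in> P" "z \<notin> cvars A \<union> cvars B"
    by (metis P(2) finite_UnI finite_cvars finite_subset subsetI)
  then have zD: "z \<noteq> D j" "D j \<noteq> z" for j using P by auto
  have A: "T \<Turnstile> (cv (D j) \<^bold>\<in> A) \<longleftrightarrow> j \<in> den E v A" and B: "T \<Turnstile> (cv (D j) \<^bold>\<in> B) \<longleftrightarrow> j \<in> den E v B" for j
    using wcel.prems(1) wcel.IH[of v T] point_mono[OF wcel.prems(2)] by simp_all
  have "T \<Turnstile> (A \<^bold>\<in> B) \<longleftrightarrow> (\<exists>j. vsub T z (D j) \<Turnstile> (cv z \<^bold>= A) \<and> vsub T z (D j) \<Turnstile> (cv z \<^bold>\<in> B))"
    using valuation_setmm[OF T df_clel[of z A B]] z point_all[OF wcel.prems(2) z(1)] T zD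
    by (auto simp add: valuation_simps valuation_vsub)
  also have "\<dots> \<longleftrightarrow> (\<exists>j. {a. E a j} = den E v A \<and> j \<in> den E v B)"
  proof -
    \<comment> \<open>The variable z has the value j, but other elements may have the same members,
      so only the members of j are compared with A.\<close>
    have "vsub T z (D j) \<Turnstile> (cv z \<^bold>= A) \<longleftrightarrow> {a. E a j} = den E v A" for j
    proof -
      let ?T = "vsub T z (D j)"
      have p: "point E (v(z := j)) (insert z (cvars A)) ?T"
        using z wcel.prems by (intro point_vsub) (auto elim: point_mono)
      have "?T \<Turnstile> (cv (D i) \<^bold>\<in> cv z) \<longleftrightarrow> E i j" for i
      proof -
        have "?T \<Turnstile> (cv (D i) \<^bold>\<in> cv z) \<longleftrightarrow> ?T \<Turnstile> (cv (D i) \<^bold>\<in> cv (D j))"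
          using p by (intro member_cong) (auto simp: point_def eq_refl)
        then show ?thesis using p by (simp add: point_def)
      qed
      then have "?T \<Turnstile> (cv z \<^bold>= A) \<longleftrightarrow> den E (v(z := j)) (cv z) = den E (v(z := j)) A"
        by (intro point_class_eq[OF p]) (use z zD wcel.prems A in \<open>auto simp: vsub_vacuous T\<close>)
      then show ?thesis using z by simp
    qed
    moreover have "vsub T z (D j) \<Turnstile> (cv z \<^bold>\<in> B) \<longleftrightarrow> j \<in> den E v B" for j
      using z zD B by (simp add: vsub_member T)
    ultimately show ?thesis by simp
  qed
  finally show ?case by simp
next
  case (cv x)
  then have "T \<Turnstile> (cv (D j) \<^bold>\<in> cv x) \<longleftrightarrow> T \<Turnstile> (cv (D j) \<^bold>\<in> cv (D (v x)))"
    by (intro member_cong) (auto simp: point_def eq_refl)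
  then show ?case using cv by (simp add: point_def)
next
  case (cab x \<phi>)
  have T: "valuation T" and x: "D j \<noteq> x" using cab.prems P by (auto simp: point_def)
  have "T \<Turnstile> (cv (D j) \<^bold>\<in> cab x \<phi>) \<longleftrightarrow> vsub T x (D j) \<Turnstile> \<phi>"
    using valuation_setmm[OF T df_clab] T valuation_wsb[OF T x] by (simp add: valuation_simps)
  also have "\<dots> \<longleftrightarrow> sat E (v(x := j)) \<phi>"
    by (rule cab.IH, use cab.prems in simp, rule point_vsub, rule point_mono[OF cab.prems(2)])
      (use cab.prems in auto)
  finally show ?case by simp
qed

end

text \<open>Renaming makes room for infinitely many witnesses that no formula at hand mentions.\<close>

primrec ren :: "(svar \<Rightarrow> svar) \<Rightarrow> wff \<Rightarrow> wff" and renc :: "(svar \<Rightarrow> svar) \<Rightarrow> cls \<Rightarrow> cls"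
  where
    "ren p (\<phi> \<^bold>\<rightarrow> \<psi>) = (ren p \<phi> \<^bold>\<rightarrow> ren p \<psi>)"
  | "ren p (\<^bold>\<not> \<phi>) = \<^bold>\<not> (ren p \<phi>)"
  | "ren p (\<^bold>\<forall>x\<^bold>. \<phi>) = wal (p x) (ren p \<phi>)"
  | "ren p (A \<^bold>= B) = (renc p A \<^bold>= renc p B)"
  | "ren p (A \<^bold>\<in> B) = (renc p A \<^bold>\<in> renc p B)"
  | "renc p (cv x) = cv (p x)"
  | "renc p (cab x \<phi>) = cab (p x) (ren p \<phi>)"

lemma ren_defined [simp]:
  "ren p (\<phi> \<^bold>\<and> \<psi>) = (ren p \<phi> \<^bold>\<and> ren p \<psi>)" "ren p (\<phi> \<^bold>\<or> \<psi>) = (ren p \<phi> \<^bold>\<or> ren p \<psi>)"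
  "ren p (\<phi> \<^bold>\<leftrightarrow> \<psi>) = (ren p \<phi> \<^bold>\<leftrightarrow> ren p \<psi>)" "ren p (wex x \<phi>) = wex (p x) (ren p \<phi>)"
  "ren p (wsb x y \<phi>) = wsb (p x) (p y) (ren p \<phi>)"
  by (simp_all add: wa_def wo_def wb_def wex_def wsb_def)

lemma wvars_ren [simp]: "wvars (ren p \<phi>) = p ` wvars \<phi>"
  and cvars_renc [simp]: "cvars (renc p A) = p ` cvars A"
  by (induction \<phi> and A) auto

lemma ren_id: "(\<And>x. x \<in> wvars \<phi> \<Longrightarrow> p x = x) \<Longrightarrow> ren p \<phi> = \<phi>"
  and renc_id: "(\<And>x. x \<in> cvars A \<Longrightarrow> p x = x) \<Longrightarrow> renc p A = A"
  by (induction \<phi> and A) auto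

text \<open>All side conditions are about distinctness and freshness, which an injective renaming
  preserves, so each axiom becomes an instance of the same scheme.\<close>

lemma setmm_ren:
  assumes p: "inj p"
  shows "setmm \<phi> \<Longrightarrow> setmm (ren p \<phi>)"
proof (induction rule: setmm.induct)
  case (ax_mp \<phi> \<psi>)
  then show ?case using setmm.ax_mp[of "ren p \<phi>" "ren p \<psi>"] by simp
qed (use p in \<open>simp_all add: inj_image_mem_iff inj_eq
    setmm.ax_gen setmm.ax_1 setmm.ax_2 setmm.ax_3 setmm.ax_4 setmm.ax_5 setmm.ax_6 setmm.ax_7
    setmm.ax_8 setmm.ax_9 setmm.ax_10 setmm.ax_11 setmm.ax_12 setmm.ax_13 setmm.df_clab
    setmm.df_cleq setmm.df_clel setmm.ax_ext setmm.ax_rep setmm.ax_sep setmm.ax_nul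
    setmm.ax_pow setmm.ax_pr setmm.ax_un setmm.ax_reg setmm.ax_inf setmm.ax_inf2 setmm.ax_ac\<close>)

lemma sat_ren: "inj p \<Longrightarrow> sat E v (ren p \<phi>) = sat E (v \<circ> p) \<phi>"
  and den_renc: "inj p \<Longrightarrow> den E v (renc p A) = den E (v \<circ> p) A"
proof (induction \<phi> and A arbitrary: v and v)
  case (wal x \<phi>)
  have "v(p x := a) \<circ> p = (v \<circ> p)(x := a)" for a using wal.prems by (auto simp: inj_eq)
  then show ?case by (simp only: ren.simps sat.simps wal.IH[OF wal.prems])
next
  case (cab x \<phi>)
  have "v(p x := a) \<circ> p = (v \<circ> p)(x := a)" for a using cab.prems by (auto simp: inj_eq)
  then show ?case by (simp only: renc.simps den.simps cab.IH[OF cab.prems])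
qed simp_all

section \<open>Transfer of truth along surjections\<close>

lemma all_surj:
  assumes "surj h"
  shows "(\<forall>b. P b) \<longleftrightarrow> (\<forall>a. P (h a))" "(\<exists>b. P b) \<longleftrightarrow> (\<exists>a. P (h a))"
proof -
  have "\<exists>a. b = h a" for b using assms by (rule surjD)
  then show "(\<forall>b. P b) \<longleftrightarrow> (\<forall>a. P (h a))" "(\<exists>b. P b) \<longleftrightarrow> (\<exists>a. P (h a))" by metis+
qed

text \<open>h may identify elements, since \<open>sat\<close> compares classes by their members and
  never elements by identity.\<close>

lemma sat_surj:
  assumes "surj h" and E: "\<And>a b. E' (h a) (h b) = E a b"
  shows "sat E' (h \<circ> v) \<phi> = sat E v \<phi>"
    and "(h a \<in> den E' (h \<circ> v) A) = (a \<in> den E v A)"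
proof (induction \<phi> and A arbitrary: v and v a)
  case (wal x \<phi>)
  have "(h \<circ> v)(x := h a) = h \<circ> v(x := a)" for a by (simp add: fun_upd_comp)
  then show ?case by (simp only: sat.simps all_surj(1)[OF \<open>surj h\<close>] wal.IH)
next
  case (cab x \<phi>)
  have "(h \<circ> v)(x := h a) = h \<circ> v(x := a)" for a by (simp add: fun_upd_comp)
  then show ?case by (simp only: den.simps mem_Collect_eq cab.IH)
next
  case (wceq A B)
  show ?case
    by (simp only: sat.simps set_eq_iff all_surj(1)[OF \<open>surj h\<close>] wceq.IH)
next
  case (wcel A B)
  show ?case
    by (simp only: sat.simps set_eq_iff mem_Collect_eq all_surj[OF \<open>surj h\<close>] wcel.IH E)
qed (simp_all add: E)

lemma sat_defined [simp]:
  "sat E v (\<phi> \<^bold>\<and> \<psi>) = (sat E v \<phi> \<and> sat E v \<psi>)" "sat E v (\<phi> \<^bold>\<or> \<psi>) = (sat E v \<phi> \<or> sat E v \<psi>)"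
  "sat E v (\<phi> \<^bold>\<leftrightarrow> \<psi>) = (sat E v \<phi> = sat E v \<psi>)" "sat E v (wex x \<phi>) = (\<exists>a. sat E (v(x := a)) \<phi>)"
  by (auto simp: wa_def wo_def wb_def wex_def)

lemma countermodel:
  assumes "\<not> setmm \<phi>"
  obtains E :: "nat \<Rightarrow> nat \<Rightarrow> bool" and v where
    "\<And>\<psi> w. setmm \<psi> \<Longrightarrow> sat E w \<psi>" "\<not> sat E v \<phi>"
    "\<And>i j k. {a. E a i} = {a. E a j} \<Longrightarrow> E i k \<Longrightarrow> E j k"
proof -
  obtain N where N: "\<And>k. Aux k \<in> wvars \<phi> \<Longrightarrow> k < N"
  proof -
    have "finite (Aux -` wvars \<phi>)" by (rule finite_vimageI) (auto simp: inj_def)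
    then show ?thesis using that by (metis finite_nat_set_iff_bounded vimageI)
  qed
  \<comment> \<open>p fixes the variables of \<phi> and moves the auxiliary ones from N on to even
    indices; the odd indices above 2N are left for D.\<close>
  define p where "p x = (case x of Aux k \<Rightarrow> Aux (if k < N then k else 2 * k) | _ \<Rightarrow> x)" for x
  define D where "D j = Aux (2 * (N + j) + 1)" for j
  have p: "inj p" unfolding p_def inj_def by (auto split: svar.splits if_splits)
  have D: "inj D" by (auto simp: D_def inj_def)
  have disj: "range p \<inter> range D = {}"
  proof -
    have "p x \<noteq> D j" for x j unfolding p_def D_def by (cases x) (auto, presburger)
    then show ?thesis by auto
  qed
  have inf: "infinite (range p)"
  proof -
    have "infinite (UNIV :: svar set)" using exists_fresh by (metis UNIV_I)
    then show ?thesis using p finite_imageD by blast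
  qed
  obtain T where T: "valuation T" "\<not> T \<Turnstile> \<phi>" "henkin D T" using henkin_valuation[OF assms D] .
  define E where "E i j \<longleftrightarrow> T \<Turnstile> (cv (D i) \<^bold>\<in> cv (D j))" for i j
  have id: "ren p \<phi> = \<phi>" by (rule ren_id) (use N in \<open>auto simp: p_def split: svar.splits\<close>)
  have p0: "point D E v {} T" for v using T by (simp add: point_def[OF disj inf] E_def)
  \<comment> \<open>Variables receive their values one after another, starting from T, which fits
    every assignment while no variable is constrained.\<close>
  have pX: "\<exists>T'. point D E w X T'" if "finite X" "X \<subseteq> range p" for w X
    using that
  proof (induction X)
    case empty
    show ?case using p0 by blast
  next
    case (insert x X)
    then obtain T' where T': "point D E w X T'" by auto
    have "point D E (w(x := w x)) (insert x X) (vsub T' x (D (w x)))"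
      by (rule point_vsub[OF disj inf], rule point_mono[OF disj inf T']) (use insert in auto)
    then show ?case by auto
  qed
  \<comment> \<open>A theorem is renamed into the range of p, where the truth lemma applies, and
    then read back through p.\<close>
  have all: "sat E w \<psi>" if "setmm \<psi>" for w \<psi>
  proof -
    define w' where "w' = w \<circ> inv p"
    have w': "w' \<circ> p = w" using p by (auto simp: w'_def)
    have X: "wvars (ren p \<psi>) \<subseteq> range p" by auto
    then obtain T' where p': "point D E w' (wvars (ren p \<psi>)) T'"
      using pX[of "wvars (ren p \<psi>)" w'] by auto
    then have "valuation T'" by (simp add: point_def[OF disj inf])
    then have "T' \<Turnstile> ren p \<psi>" using setmm_ren[OF p that] valuation_setmm by blast
    then have "sat E w' (ren p \<psi>)" using truth_lemma(1)[OF disj inf X p'] by simp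
    then show ?thesis by (simp add: sat_ren p w')
  qed
  have cong: "E j k" if ij: "{a. E a i} = {a. E a j}" and "E i k" for i j k
  proof -
    \<comment> \<open>Three variables with the values i, j and k turn equality of members into the
      formula x = y, to which the congruence laws of T' apply.\<close>
    define x y z where "x = p (Aux 0)" and "y = p (Aux 1)" and "z = p (Aux 2)"
    have xyz: "x \<noteq> y" "x \<noteq> z" "y \<noteq> z" using p by (auto simp: inj_eq x_def y_def z_def)
    define w where "w = (\<lambda>_. k)(x := i, y := j)"
    obtain T' where p': "point D E w {x,y,z} T'"
      using pX[of "{x,y,z}" w] by (auto simp: x_def y_def z_def)
    then have T': "valuation T'" "T' \<Turnstile> (cv x \<^bold>= cv (D i))" "T' \<Turnstile> (cv y \<^bold>= cv (D j))"
      "T' \<Turnstile> (cv z \<^bold>= cv (D k))" "T' \<Turnstile> (cv (D i) \<^bold>\<in> cv (D k))"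
      using xyz \<open>E i k\<close> by (auto simp: point_def[OF disj inf] w_def)
    have "point D E w (wvars (cv x \<^bold>= cv y)) T'" by (rule point_mono[OF disj inf p']) auto
    from truth_lemma(1)[OF disj inf _ this] have "T' \<Turnstile> (cv x \<^bold>= cv y)"
      using ij xyz by (auto simp: w_def x_def y_def)
    then have "T' \<Turnstile> (cv (D i) \<^bold>= cv (D j))" using T' eq_sym eq_trans by metis
    then have "T' \<Turnstile> (cv (D j) \<^bold>\<in> cv (D k))" using T' class_member_cong by blast
    then show ?thesis using p' by (simp add: point_def[OF disj inf])
  qed
  have "\<exists>v. \<not> sat E v \<phi>"
  proof (rule ccontr)
    assume "\<nexists>v. \<not> sat E v \<phi>"
    then have s: "sat E v \<phi>" for v by blast
    \<comment> \<open>T refutes \<phi>, but its variables need not have witnesses as values. If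
      \<phi> fails then so does \<forall>x \<phi>, hence x can be given a witness as its value with
      \<phi> still false.\<close>
    have *: "\<exists>v T'. point D E v X T' \<and> \<not> T' \<Turnstile> \<phi>" if "finite X" "X \<subseteq> range p" for X
      using that
    proof (induction X)
      case empty
      then show ?case using T p0 by blast
    next
      case (insert x X)
      then obtain v T' where vT: "point D E v X T'" "\<not> T' \<Turnstile> \<phi>" by auto
      then have "valuation T'" by (simp add: point_def[OF disj inf])
      then have "\<not> T' \<Turnstile> (\<^bold>\<forall>x\<^bold>. \<phi>)" using all_sp[of T' x \<phi>] vT(2) by blast
      then obtain j where "\<not> vsub T' x (D j) \<Turnstile> \<phi>"
        using point_all[OF disj inf vT(1), of x \<phi>] insert.prems by blast
      moreover have "point D E (v(x := j)) (insert x X) (vsub T' x (D j))"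
        by (rule point_vsub[OF disj inf], rule point_mono[OF disj inf vT(1)]) (use insert in auto)
      ultimately show ?case by blast
    qed
    have "wvars \<phi> \<subseteq> range p" using id wvars_ren by (metis image_mono subset_UNIV)
    with *[of "wvars \<phi>"] s truth_lemma(1)[OF disj inf] show False by auto
  qed
  then show ?thesis using that[of E] all cong by blast
qed

text \<open>The countermodel is countable; identifying elements with the same members makes it
  extensional, and it is not finite.\<close>

theorem completeness:
  assumes "\<And>(E :: nat \<Rightarrow> nat \<Rightarrow> bool) v. inj (\<lambda>m. {a. E a m}) \<Longrightarrow>
    (\<And>\<psi> w. setmm \<psi> \<Longrightarrow> sat E w \<psi>) \<Longrightarrow> sat E v \<phi>"
  shows "setmm \<phi>"
proof (rule ccontr)
  assume "\<not> setmm \<phi>"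
  then obtain E :: "nat \<Rightarrow> nat \<Rightarrow> bool" and v where
    E: "\<And>\<psi> w. setmm \<psi> \<Longrightarrow> sat E w \<psi>" and v: "\<not> sat E v \<phi>"
    and cong': "\<And>i j k. {a. E a i} = {a. E a j} \<Longrightarrow> E i k \<Longrightarrow> E j k" by (rule countermodel) blast
  define ext where "ext m = {a. E a m}" for m
  let ?x = "Aux 0" and ?y = "Aux (Suc 0)" and ?z = "Aux 2" and ?w = "Aux 3"
  have cong: "E a c \<longleftrightarrow> E b c" if "ext a = ext b" for a b c
    using cong' that unfolding ext_def by metis
  have mem: "(\<exists>m. {a. E a m} = {a. E a x} \<and> E m z) \<longleftrightarrow> E x z" for x z
    using cong' by blast
  \<comment> \<open>With finitely many extensions, pairing and union would yield a set of all
    elements, and separation its Russell subset. Infinity lets the quotient be numbered by all of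
    \<open>nat\<close>.\<close>
  have "infinite (range ext)"
  proof
    assume "finite (range ext)"
    then obtain S where S: "finite S" "range ext = ext ` S" by (meson finite_subset_image order_refl)
    have "\<exists>c. S \<subseteq> ext c" using S(1)
    proof (induction S)
      case (insert s S)
      then obtain c where c: "S \<subseteq> ext c" by blast
      have pair: "\<exists>p. E a p \<and> E b p" for a b
        using E[OF ax_pr[of ?x ?z ?w ?y], of "(\<lambda>_. a)(?y := b)"]
          by (simp add: fun_upd_def mem) blast
      have union: "\<exists>u. \<forall>z w. E z w \<and> E w a \<longrightarrow> E z u" for a
        using E[OF ax_un[of ?x ?y ?z ?w], of "\<lambda>_. a"] by (simp add: fun_upd_def mem)
      obtain q where q: "E s q" using pair by blast
      obtain p where "E c p" "E q p" using pair by blast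
      moreover obtain u where "\<forall>z w. E z w \<and> E w p \<longrightarrow> E z u" using union by blast
      ultimately have "insert s S \<subseteq> ext u" using c q by (auto simp: ext_def)
      then show ?case by blast
    qed auto
    then obtain u where u: "S \<subseteq> ext u" by blast
    have "E a u" for a
    proof -
      have "ext a \<in> ext ` S" using S(2) by blast
      then obtain s where s: "s \<in> S" "ext a = ext s" by blast
      then have "E s u" using u by (auto simp: ext_def)
      then show ?thesis using cong[OF s(2)] by simp
    qed
    moreover have "\<exists>y. \<forall>x. E x y \<longleftrightarrow> E x u \<and> \<not> E x x"
      using E[OF ax_sep[of ?x ?y ?z "\<^bold>\<not> (cv ?x \<^bold>\<in> cv ?x)"], of "\<lambda>_. u"]
      by (simp add: fun_upd_def mem)
    ultimately show False by blast
  qed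
  moreover have "countable (range ext)" by simp
  ultimately have bij: "bij_betw (to_nat_on (range ext)) (range ext) UNIV"
    by (rule to_nat_on_infinite[rotated])
  \<comment> \<open>h numbers the extensions, so that elements with the same members become
    one.\<close>
  define h where "h = to_nat_on (range ext) \<circ> ext"
  have h: "surj h" "\<And>a b. h a = h b \<longleftrightarrow> ext a = ext b"
    using bij by (auto simp: h_def bij_betw_def inj_on_eq_iff image_comp)
  define E' where "E' i j = E (inv h i) (inv h j)" for i j
  have ext_inv: "ext (inv h (h a)) = ext a" for a using h by (metis surj_f_inv_f)
  have E': "E' (h a) (h b) = E a b" for a b
    using cong[OF ext_inv[of a]] ext_inv[of b] by (auto simp: E'_def ext_def)
  have sat_h: "sat E' (h \<circ> w) \<psi> = sat E w \<psi>" for w \<psi>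
    using h(1) E' by (rule sat_surj(1))
  have "sat E' (h \<circ> v) \<phi>"
  proof (rule assms)
    show "inj (\<lambda>m. {a. E' a m})"
    proof (rule injI)
      fix i j assume a: "{a. E' a i} = {a. E' a j}"
      obtain m n where mn: "i = h m" "j = h n" using h(1) by (metis surjD)
      have "E' (h a) i \<longleftrightarrow> E' (h a) j" for a using a by blast
      then have "ext m = ext n" using E' mn by (auto simp: ext_def)
      then show "i = j" using h mn by blast
    qed
    fix \<psi> and w :: "svar \<Rightarrow> nat" assume "setmm \<psi>"
    have "h \<circ> (inv h \<circ> w) = w" using h(1) by (auto simp: surj_f_inv_f)
    then show "sat E' w \<psi>" using sat_h[of "inv h \<circ> w"] E[OF \<open>setmm \<psi>\<close>] by simp
  qed
  then show False using v sat_h by blast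
qed

section \<open>Fresh variables and updated assignments\<close>

lemma fr_eq_iff [simp]: "fr X m = fr X n \<longleftrightarrow> m = n"
  by (auto simp: fr_def)

lemma fr_avoid:
  assumes "finite X"
  shows "fr X n \<notin> X"
proof
  assume a: "fr X n \<in> X"
  have "finite (Aux -` X)" using assms by (rule finite_vimageI) (auto simp: inj_def)
  then have "\<exists>m. \<forall>k. Aux k \<in> X \<longrightarrow> k < m" using finite_nat_set_iff_bounded by (metis vimageI)
  then have "\<forall>k. Aux k \<in> X \<longrightarrow> k < (LEAST m. \<forall>k. Aux k \<in> X \<longrightarrow> k < m)" by (rule LeastI_ex)
  then show False using a by (auto simp: fr_def)
qed

lemma fr_neq_Hol [simp]: "fr X n \<noteq> HolVar k" "fr X n \<noteq> HolTyp k" "HolVar k \<noteq> fr X n" "HolTyp k \<noteq> fr X n"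
  by (auto simp: fr_def)

lemma sat_upd2 [simp]: "x \<notin> wvars \<phi> \<Longrightarrow> sat E (v(x := a, y := b)) \<phi> = sat E (v(y := b)) \<phi>"
  by (rule sat_cong) auto

lemma den_upd2 [simp]: "x \<notin> cvars A \<Longrightarrow> den E (v(x := a, y := b)) A = den E (v(y := b)) A"
  by (rule den_cong) auto

lemma sat_upd3 [simp]: "x \<notin> wvars \<phi> \<Longrightarrow> sat E (v(x := a, y := b, z := c)) \<phi> = sat E (v(y := b, z := c)) \<phi>"
  by (rule sat_cong) auto

locale set_model =
  fixes E :: "'m \<Rightarrow> 'm \<Rightarrow> bool"
  assumes inj_ext: "inj (\<lambda>m. {a. E a m})"
    and sound: "setmm \<psi> \<Longrightarrow> sat E w \<psi>"
begin

section \<open>Sets of the model\<close>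

definition ext :: "'m \<Rightarrow> 'm set"
  where "ext m = {a. E a m}"

lemma ext_eq_iff [simp]: "ext a = ext b \<longleftrightarrow> a = b"
  using inj_ext by (auto simp: ext_def inj_def)

text \<open>Unspecified on collections that are not the extension of an element.\<close>

definition cod :: "'m set \<Rightarrow> 'm"
  where "cod = inv ext"

definition isset :: "'m set \<Rightarrow> bool"
  where "isset X \<longleftrightarrow> X \<in> range ext"

lemma cod_ext [simp]: "cod (ext a) = a"
  by (simp add: cod_def inv_f_f inj_def)

lemma isset_ext [simp]: "isset (ext a)"
  by (simp add: isset_def)

lemma ext_cod [simp]: "isset X \<Longrightarrow> ext (cod X) = X"
  by (auto simp: isset_def)

lemma issetE: assumes "isset X" obtains m where "X = ext m"
  using assms by (auto simp: isset_def)

lemma den_cv [simp]: "den E v (cv x) = ext (v x)"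
  by (simp add: ext_def)

lemma sat_wcel [simp]: "sat E v (A \<^bold>\<in> B) \<longleftrightarrow> isset (den E v A) \<and> cod (den E v A) \<in> den E v B"
  by (auto simp: isset_def ext_def[symmetric]) (metis cod_ext)+

lemmas [simp del] = sat.simps(5) den.simps(1)

lemma empty_isset [simp]: "isset {}"
proof -
  from sound[OF ax_nul[of "Aux 0" "Aux 1"]]
  obtain m where "\<And>a. a \<notin> ext m" by auto
  then have "{} = ext m" by auto
  then show ?thesis using isset_ext[of m] by argo
qed

lemma separation:
  assumes "den E v A \<subseteq> ext m"
  shows "isset (den E v A)"
proof -
  let ?x = "fr (cvars A) 0" and ?y = "fr (cvars A) 1" and ?z = "fr (cvars A) 2"
  have f: "?x \<notin> cvars A" "?y \<notin> cvars A" "?z \<notin> cvars A" by (simp_all add: fr_avoid)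
  have "sat E (v(?z := m)) (\<^bold>\<exists>?y\<^bold>. \<^bold>\<forall>?x\<^bold>. (cv ?x \<^bold>\<in> cv ?y \<^bold>\<leftrightarrow> (cv ?x \<^bold>\<in> cv ?z \<^bold>\<and> cv ?x \<^bold>\<in> A)))"
    by (rule sound[OF ax_sep]) (use f in auto)
  then obtain y where "\<forall>a. a \<in> ext y \<longleftrightarrow> a \<in> ext m \<and> a \<in> den E v A" using f by auto
  then have "den E v A = ext y" using assms by auto
  then show ?thesis by simp
qed

text \<open>The usual way to obtain a set: a class term denoting X, and a bound m.\<close>

lemma definable_subset:
  assumes "X = den E v A" "X \<subseteq> ext m"
  shows "isset X"
  using assms separation by simp

text \<open>ax-pr yields only a superset, as do ax-un and ax-pow below; separation cuts it
  down.\<close>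

lemma insert2_isset [simp]: "isset {a, b}"
proof -
  let ?x = "Aux 0" and ?y = "Aux 1" and ?z = "Aux 2" and ?w = "Aux 3"
  from sound[OF ax_pr[of ?x ?z ?w ?y], of "(\<lambda>_. a)(?y := b)"]
  obtain z where "{a, b} \<subseteq> ext z" by auto
  then show ?thesis
    by (intro definable_subset[of "{a, b}" "(\<lambda>_. a)(?y := b)" "cab ?w (cv ?w \<^bold>= cv ?x \<^bold>\<or> cv ?w \<^bold>= cv ?y)" z]) auto
qed

lemma singleton_isset [simp]: "isset {a}"
  using insert2_isset[of a a] by simp

lemma Union_isset [simp]: "isset (\<Union>a\<in>ext m. ext a)"
proof -
  let ?x = "Aux 0" and ?y = "Aux 1" and ?z = "Aux 2" and ?w = "Aux 3"
  from sound[OF ax_un[of ?x ?y ?z ?w], of "\<lambda>_. m"]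
  obtain z where "(\<Union>a\<in>ext m. ext a) \<subseteq> ext z" by auto
  then show ?thesis
    by (intro definable_subset[of _ "\<lambda>_. m" "cab ?z (\<^bold>\<exists>?w\<^bold>. (cv ?z \<^bold>\<in> cv ?w \<^bold>\<and> cv ?w \<^bold>\<in> cv ?x))" z]) auto
qed

lemma Pow_isset [simp]: "isset {a. ext a \<subseteq> ext m}"
proof -
  let ?x = "Aux 0" and ?y = "Aux 1" and ?z = "Aux 2" and ?w = "Aux 3"
  from sound[OF ax_pow[of ?x ?y ?z ?w], of "\<lambda>_. m"]
  obtain z where "\<And>a. \<forall>b. b \<in> ext a \<longrightarrow> b \<in> ext m \<Longrightarrow> a \<in> ext z" by auto
  then have "{a. ext a \<subseteq> ext m} \<subseteq> ext z" by blast
  then show ?thesis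
    by (intro definable_subset[of _ "\<lambda>_. m" "cab ?z (\<^bold>\<forall>?w\<^bold>. (cv ?w \<^bold>\<in> cv ?z \<^bold>\<rightarrow> cv ?w \<^bold>\<in> cv ?x))" z]) auto
qed

lemma Un_isset [simp]:
  assumes "isset X" "isset Y"
  shows "isset (X \<union> Y)"
proof -
  have "X \<union> Y = (\<Union>a\<in>ext (cod {cod X, cod Y}). ext a)" using assms by simp
  then show ?thesis by (metis Union_isset)
qed

text \<open>In ax-rep the formula stands beneath a quantifier over the variable of the new set; a
  fresh s makes that quantifier vacuous. Membership in t confines \<phi> to \<open>ext m\<close>,
  since the axiom demands functionality everywhere while it is given only there.\<close>

lemma replacement:
  assumes "x \<noteq> y" and fn: "\<And>a b c. \<lbrakk>a \<in> ext m; sat E (v(x := a, y := b)) \<phi>; sat E (v(x := a, y := c)) \<phi>\<rbrakk> \<Longrightarrow> b = c"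
  shows "isset {b. \<exists>a\<in>ext m. sat E (v(x := a, y := b)) \<phi>}"
proof -
  let ?X = "insert x (insert y (wvars \<phi>))"
  define s t where "s = fr ?X 0" and "t = fr ?X 1"
  have f: "s \<notin> ?X" "t \<notin> ?X" "s \<noteq> t" by (simp_all add: fr_avoid s_def t_def del: insert_iff)
  let ?\<phi> = "cv x \<^bold>\<in> cv t \<^bold>\<and> \<phi>"
  have "sat E (v(t := m)) (\<^bold>\<forall>x\<^bold>. \<^bold>\<exists>s\<^bold>. \<^bold>\<forall>y\<^bold>. (\<^bold>\<forall>s\<^bold>. ?\<phi> \<^bold>\<rightarrow> cv y \<^bold>= cv s) \<^bold>\<rightarrow>
        \<^bold>\<exists>s\<^bold>. \<^bold>\<forall>y\<^bold>. (cv y \<^bold>\<in> cv s \<^bold>\<leftrightarrow> \<^bold>\<exists>x\<^bold>. (cv x \<^bold>\<in> cv t \<^bold>\<and> \<^bold>\<forall>s\<^bold>. ?\<phi>)))"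
    by (rule sound[OF ax_rep]) (use f assms(1) in auto)
  moreover have "sat E (v(t := m, x := a, s := c, y := b, s := d)) ?\<phi> \<longleftrightarrow> a \<in> ext m \<and> sat E (v(x := a, y := b)) \<phi>"
    "sat E (v(t := m, s := c, y := b, x := a, s := d)) ?\<phi> \<longleftrightarrow> a \<in> ext m \<and> sat E (v(x := a, y := b)) \<phi>" for a b c d
  proof -
    have "sat E (v(t := m, x := a, s := c, y := b, s := d)) \<phi> = sat E (v(x := a, y := b)) \<phi>"
      "sat E (v(t := m, s := c, y := b, x := a, s := d)) \<phi> = sat E (v(x := a, y := b)) \<phi>"
      by (rule sat_cong; use f assms(1) in auto)+
    then show "sat E (v(t := m, x := a, s := c, y := b, s := d)) ?\<phi> \<longleftrightarrow> a \<in> ext m \<and> sat E (v(x := a, y := b)) \<phi>"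
      "sat E (v(t := m, s := c, y := b, x := a, s := d)) ?\<phi> \<longleftrightarrow> a \<in> ext m \<and> sat E (v(x := a, y := b)) \<phi>"
      using f assms(1) by auto
  qed
  ultimately have "(\<forall>a. \<exists>c. \<forall>b. a \<in> ext m \<and> sat E (v(x := a, y := b)) \<phi> \<longrightarrow> b = c) \<longrightarrow>
      (\<exists>s. \<forall>b. b \<in> ext s \<longleftrightarrow> (\<exists>a. a \<in> ext m \<and> sat E (v(x := a, y := b)) \<phi>))"
    using f assms(1) by (auto simp del: fun_upd_apply simp: fun_upd_same fun_upd_other) blast
  moreover have "\<exists>c. \<forall>b. a \<in> ext m \<and> sat E (v(x := a, y := b)) \<phi> \<longrightarrow> b = c" for a
    using fn by blast
  ultimately obtain s where "\<forall>b. b \<in> ext s \<longleftrightarrow> (\<exists>a. a \<in> ext m \<and> sat E (v(x := a, y := b)) \<phi>)" by blast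
  then have "{b. \<exists>a\<in>ext m. sat E (v(x := a, y := b)) \<phi>} = ext s" by auto
  then show ?thesis by simp
qed

lemma regularity:
  assumes "a \<in> ext m"
  obtains y where "y \<in> ext m" "\<And>z. z \<in> ext y \<Longrightarrow> z \<notin> ext m"
proof -
  let ?x = "Aux 0" and ?y = "Aux 1" and ?z = "Aux 2"
  show ?thesis using sound[OF ax_reg[of ?x ?y ?z], of "\<lambda>_. m"] assms that by auto
qed

lemma no_cycle2: "a \<in> ext b \<Longrightarrow> b \<notin> ext a"
proof
  assume a: "a \<in> ext b" "b \<in> ext a"
  have "a \<in> ext (cod {a, b})" by simp
  then obtain y where "y \<in> ext (cod {a, b})" "\<And>z. z \<in> ext y \<Longrightarrow> z \<notin> ext (cod {a, b})"
    by (rule regularity) blast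
  then show False using a by auto
qed

lemma no_cycle1 [simp]: "a \<notin> ext a"
  using no_cycle2 by blast

lemma no_cycle3: "a \<in> ext b \<Longrightarrow> b \<in> ext c \<Longrightarrow> c \<notin> ext a"
proof
  assume a: "a \<in> ext b" "b \<in> ext c" "c \<in> ext a"
  have s: "isset ({a, b} \<union> {c})" by (intro Un_isset) simp_all
  have "a \<in> ext (cod ({a, b} \<union> {c}))" by (simp only: ext_cod[OF s]) simp
  then obtain y where "y \<in> ext (cod ({a, b} \<union> {c}))" "\<And>z. z \<in> ext y \<Longrightarrow> z \<notin> ext (cod ({a, b} \<union> {c}))"
    by (rule regularity) blast
  then show False using a by (simp only: ext_cod[OF s]) auto
qed

section \<open>Denotations of the defined notions\<close>

lemma sat_wss [simp]: "sat E v (A \<^bold>\<subseteq> B) \<longleftrightarrow> den E v A \<subseteq> den E v B"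
  using fr_avoid[of "cvars A \<union> cvars B" 0] by (auto simp: wss_def Let_def)

lemma sat_wral [simp]: "sat E v (wral x A \<phi>) \<longleftrightarrow> (\<forall>a. a \<in> den E (v(x := a)) A \<longrightarrow> sat E (v(x := a)) \<phi>)"
  by (simp add: wral_def)

lemma sat_wrex [simp]: "sat E v (wrex x A \<phi>) \<longleftrightarrow> (\<exists>a. a \<in> den E (v(x := a)) A \<and> sat E (v(x := a)) \<phi>)"
  by (simp add: wrex_def)

lemma den_crab [simp]: "den E v (crab x A \<phi>) = {a. a \<in> den E (v(x := a)) A \<and> sat E (v(x := a)) \<phi>}"
  by (simp add: crab_def)

lemma den_cvv [simp]: "den E v cvv = UNIV"
  by (simp add: cvv_def Let_def)

lemma den_c0 [simp]: "den E v c0 = {}"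
  by (simp add: c0_def Let_def)

lemma den_cun [simp]: "den E v (A \<^bold>\<union> B) = den E v A \<union> den E v B"
  using fr_avoid[of "cvars A \<union> cvars B" 0] by (auto simp: cun_def Let_def)

lemma den_cpw [simp]: "den E v (cpw A) = {a. ext a \<subseteq> den E v A}"
  using fr_avoid[of "cvars A" 0] by (auto simp: cpw_def Let_def)

lemma den_cuni [simp]: "den E v (cuni A) = (\<Union>a\<in>den E v A. ext a)"
  using fr_avoid[of "cvars A" 0] fr_avoid[of "cvars A" 1] by (auto simp: cuni_def Let_def)

lemma den_csn: "den E v (csn A) = {a. ext a = den E v A}"
  using fr_avoid[of "cvars A" 0] by (auto simp: csn_def Let_def)

lemma den_csn' [simp]: "den E v (csn A) = (if isset (den E v A) then {cod (den E v A)} else {})"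
proof (cases "isset (den E v A)")
  case True
  then obtain m where "den E v A = ext m" by (rule issetE)
  then show ?thesis by (simp add: den_csn)
next
  case False
  then have "ext a \<noteq> den E v A" for a by (metis isset_ext)
  then show ?thesis using False by (simp add: den_csn)
qed

lemma den_cpr [simp]: "den E v (cpr A B) = den E v (csn A) \<union> den E v (csn B)"
  by (simp add: cpr_def)

section \<open>Pairs, functions and function values\<close>

definition opr :: "'m \<Rightarrow> 'm \<Rightarrow> 'm"
  where "opr a b = cod {cod {a}, cod {a, b}}"

lemma ext_opr: "ext (opr a b) = {cod {a}, cod {a, b}}"
  by (simp add: opr_def)

lemma opr_eq_iff [simp]: "opr a b = opr c d \<longleftrightarrow> a = c \<and> b = d"
proof
  assume "opr a b = opr c d"
  then have "{cod {a}, cod {a, b}} = {cod {c}, cod {c, d}}" using ext_opr[of a b] ext_opr[of c d] by simp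
  then have "ext ` {cod {a}, cod {a, b}} = ext ` {cod {c}, cod {c, d}}" by simp
  then have "{{a}, {a, b}} = {{c}, {c, d}}" by (simp del: insert_iff)
  then show "a = c \<and> b = d" by (auto simp: doubleton_eq_iff)
qed simp

lemma den_cop [simp]: "den E v (cop A B) = (if isset (den E v A) \<and> isset (den E v B)
    then ext (opr (cod (den E v A)) (cod (den E v B))) else {})"
  using fr_avoid[of "cvars A \<union> cvars B" 0] by (auto simp: cop_def Let_def ext_opr insert_commute)

lemma den_cif [simp]: "den E v (cif \<phi> A B) = (if sat E v \<phi> then den E v A else den E v B)"
  using fr_avoid[of "wvars \<phi> \<union> cvars A \<union> cvars B" 0] by (auto simp: cif_def Let_def)

lemma den_csuc [simp]: "den E v (csuc A) = den E v A \<union> den E v (csn A)"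
  by (simp add: csuc_def)

definition zero :: 'm where "zero = cod {}"
definition one :: 'm where "one = cod {zero}"

lemma ext_zero [simp]: "ext zero = {}" by (simp add: zero_def)
lemma cod_empty [simp]: "cod {} = zero" by (simp add: zero_def)
lemma ext_one [simp]: "ext one = {zero}" by (simp add: one_def)
lemma cod_zero [simp]: "cod {zero} = one" by (simp add: one_def)
lemma zero_neq_one [simp]: "zero \<noteq> one" "one \<noteq> zero"
  by (metis empty_not_insert ext_one ext_zero)+

lemma den_c1 [simp]: "den E v c1 = ext one"
  by (simp add: c1_def)

lemma den_c2 [simp]: "den E v c2 = {zero, one}"
  by (auto simp: c2_def)

lemma den_copab [simp]: "x \<noteq> y \<Longrightarrow>
  den E v (copab x y \<phi>) = {opr a b | a b. sat E (v(x := a, y := b)) \<phi>}"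
  using fr_avoid[of "{x, y} \<union> wvars \<phi>" 0] by (auto simp: copab_def Let_def)

lemma den_cmpt:
  "den E v (cmpt x A B) = {opr a b | a b. a \<in> den E (v(x := a)) A \<and> ext b = den E (v(x := a)) B}"
proof -
  let ?y = "fr ({x} \<union> cvars A \<union> cvars B) 0"
  have "?y \<notin> {x} \<union> cvars A \<union> cvars B" by (rule fr_avoid) simp
  moreover from this have "x \<noteq> ?y" by auto
  ultimately show ?thesis by (simp add: cmpt_def Let_def)
qed

lemma den_cdm [simp]: "den E v (cdm A) = {a. \<exists>b. opr a b \<in> den E v A}"
  using fr_avoid[of "cvars A" 0] fr_avoid[of "cvars A" 1] by (auto simp: cdm_def Let_def)

lemma den_crn [simp]: "den E v (crn A) = {b. \<exists>a. opr a b \<in> den E v A}"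
  using fr_avoid[of "cvars A" 0] fr_avoid[of "cvars A" 1] by (auto simp: crn_def Let_def)

lemma den_cres:
  "den E v (cres F A) = {opr a b | a b. opr a b \<in> den E v F \<and> a \<in> den E v A}"
proof -
  let ?X = "cvars F \<union> cvars A"
  have f: "fr ?X n \<notin> ?X" for n by (rule fr_avoid) simp
  show ?thesis using f[of 0] f[of 1] f[of 2] by (auto simp: cres_def Let_def)
qed

definition Rl :: "'m set \<Rightarrow> bool"
  where "Rl F \<longleftrightarrow> (\<forall>p\<in>F. \<exists>a b. p = opr a b)"

definition Fn :: "'m set \<Rightarrow> 'm set \<Rightarrow> bool"
  where "Fn F D \<longleftrightarrow> Rl F \<and> (\<forall>a b c. opr a b \<in> F \<and> opr a c \<in> F \<longrightarrow> b = c) \<and> {a. \<exists>b. opr a b \<in> F} = D"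

lemma sat_wrel [simp]: "sat E v (wrel F) \<longleftrightarrow> Rl (den E v F)"
  using fr_avoid[of "cvars F" 0] fr_avoid[of "cvars F" 1] fr_avoid[of "cvars F" 2]
  by (auto simp: wrel_def Let_def Rl_def)

lemma sat_wfn [simp]: "sat E v (wfn F A) \<longleftrightarrow> Fn (den E v F) (den E v A)"
  using fr_avoid[of "cvars F" 0] fr_avoid[of "cvars F" 1] fr_avoid[of "cvars F" 2]
  by (auto simp: wfn_def wfun_def Let_def Fn_def)

definition fval :: "'m set \<Rightarrow> 'm set \<Rightarrow> 'm set"
  where "fval F A = (if isset A \<and> (\<exists>!b. opr (cod A) b \<in> F) then ext (THE b. opr (cod A) b \<in> F) else {})"

lemma den_cfv [simp]: "den E v (cfv F A) = fval (den E v F) (den E v A)"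
proof -
  let ?X = "cvars F \<union> cvars A"
  have f: "fr ?X n \<notin> ?X" for n by (rule fr_avoid) simp
  have u: "den E v (cfv F A) = \<Union>(ext ` {y. {x. sat E (v(fr ?X 0 := x)) (cop A (cv (fr ?X 0)) \<^bold>\<in> F)} = {y}})"
  proof -
    have "sat E (v(fr ?X 1 := a, fr ?X 0 := b)) (cop A (cv (fr ?X 0)) \<^bold>\<in> F) =
        sat E (v(fr ?X 0 := b)) (cop A (cv (fr ?X 0)) \<^bold>\<in> F)" for a b
      using f[of 0] f[of 1] by simp
    then show ?thesis by (simp add: cfv_def Let_def del: den_cop sat_wcel)
  qed
  show ?thesis
  proof (cases "isset (den E v A)")
    case True
    then have 1: "den E v (cfv F A) = \<Union>(ext ` {y. {x. opr (cod (den E v A)) x \<in> den E v F} = {y}})"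
      using f[of 0] u by simp
    show ?thesis
    proof (cases "\<exists>!b. opr (cod (den E v A)) b \<in> den E v F")
      case ex: True
      define b where "b = (THE b. opr (cod (den E v A)) b \<in> den E v F)"
      have "opr (cod (den E v A)) b \<in> den E v F" unfolding b_def using ex by (rule theI')
      then have "{y. {x. opr (cod (den E v A)) x \<in> den E v F} = {y}} = {b}" using ex by auto
      then show ?thesis using True 1 ex by (simp add: fval_def b_def)
    next
      case False
      then have "{x. opr (cod (den E v A)) x \<in> den E v F} \<noteq> {y}" for y
        by (metis mem_Collect_eq singleton_iff)
      then have "{y. {x. opr (cod (den E v A)) x \<in> den E v F} = {y}} = {}" by simp
      then show ?thesis using 1 False by (simp add: fval_def)
    qed
  next
    case False
    \<comment> \<open>For a proper class A every pair is the empty set, so the abstraction contains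
      everything or nothing; as there are at least two elements, it is no singleton.\<close>
    have "UNIV \<noteq> {y}" for y :: 'm using zero_neq_one by (metis UNIV_I singletonD)
    then have "{y. {x. sat E (v(fr ?X 0 := x)) (cop A (cv (fr ?X 0)) \<^bold>\<in> F)} = {y}} = {}"
      using f[of 0] False by (cases "zero \<in> den E v F") auto
    then show ?thesis using False u by (simp add: fval_def)
  qed
qed

lemma fval_isset [simp]: "isset (fval F A)"
  by (simp add: fval_def)

lemma den_cmap [simp]:
  "den E v (cmap A B) = {f. Fn (ext f) (den E v B) \<and> (\<forall>a b. opr a b \<in> ext f \<longrightarrow> b \<in> den E v A)}"
  using fr_avoid[of "cvars A \<union> cvars B" 0] by (auto simp: cmap_def Let_def)

lemma den_c1st:
  assumes "den E v A = ext (opr a b)"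
  shows "den E v (c1st A) = ext a"
  using assms by (simp add: c1st_def)

lemma den_c2nd:
  assumes "den E v A = ext (opr a b)"
  shows "den E v (c2nd A) = ext b"
  using assms by (simp add: c2nd_def)

definition Ordc :: "'m set \<Rightarrow> bool"
  where "Ordc X \<longleftrightarrow> (\<forall>b\<in>X. ext b \<subseteq> X) \<and> (\<forall>x\<in>X. \<forall>y\<in>X. x \<in> ext y \<or> x = y \<or> y \<in> ext x)"

definition Limc :: "'m set \<Rightarrow> bool"
  where "Limc X \<longleftrightarrow> Ordc X \<and> X \<noteq> {} \<and> X = (\<Union>b\<in>X. ext b)"

lemma sat_word [simp]: "sat E v (word A) \<longleftrightarrow> Ordc (den E v A)"
proof -
  \<comment> \<open>Minimal elements of nonempty subsets come from regularity; transitivity and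
    comparability remain.\<close>
  have r: "\<exists>y. y \<in> ext m \<and> (\<forall>z. z \<in> ext m \<longrightarrow> z \<notin> ext y)" if "x \<in> ext m" for x m
    by (rule regularity[OF that]) blast
  show ?thesis
    using fr_avoid[of "cvars A" 0] fr_avoid[of "cvars A" 1] fr_avoid[of "cvars A" 2] r
    by (simp add: word_def wtr_def wwe_def Let_def Ordc_def) blast
qed

lemma sat_wtr [simp]: "sat E v (wtr A) \<longleftrightarrow> (\<forall>b\<in>den E v A. ext b \<subseteq> den E v A)"
  by (auto simp: wtr_def)

lemma sat_wlim [simp]: "sat E v (wlim A) \<longleftrightarrow> Limc (den E v A)"
  by (simp add: wlim_def Limc_def)

definition On :: "'m set" where "On = {a. Ordc (ext a)}"

lemma den_con0 [simp]: "den E v con0 = On"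
  by (simp add: con0_def Let_def On_def)

section \<open>Functions\<close>

definition ap :: "'m \<Rightarrow> 'm \<Rightarrow> 'm"
  where "ap f a = cod (fval (ext f) (ext a))"

lemma fval_ext [simp]: "fval (ext f) (ext a) = ext (ap f a)"
  by (simp add: ap_def)

lemma fval_eqI:
  assumes "\<And>b. opr a b \<in> F \<longleftrightarrow> b = c"
  shows "fval F (ext a) = ext c"
  using assms by (simp add: fval_def)

lemma Fn_iff_ap:
  assumes "Fn (ext f) D" "a \<in> D"
  shows "opr a b \<in> ext f \<longleftrightarrow> b = ap f a"
proof -
  obtain c where c: "opr a c \<in> ext f" using assms by (auto simp: Fn_def)
  then have "opr a b \<in> ext f \<longleftrightarrow> b = c" for b using assms by (auto simp: Fn_def)
  moreover from this have "ap f a = c" using fval_eqI[of a "ext f" c] by simp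
  ultimately show ?thesis by simp
qed

definition gr :: "'m set \<Rightarrow> ('m \<Rightarrow> 'm) \<Rightarrow> 'm set"
  where "gr D g = {opr a (g a) | a. a \<in> D}"

lemma opr_in_gr [simp]: "opr a b \<in> gr D g \<longleftrightarrow> a \<in> D \<and> b = g a"
  by (auto simp: gr_def)

lemma Fn_gr [simp]: "Fn (gr D g) D"
  by (auto simp: Fn_def Rl_def) (auto simp: gr_def)

lemma fval_gr [simp]: "a \<in> D \<Longrightarrow> fval (gr D g) (ext a) = ext (g a)"
  by (rule fval_eqI) simp

lemma Fn_imp_Rl: "Fn F D \<Longrightarrow> Rl F"
  by (simp add: Fn_def)

lemma Fn_eq_gr:
  assumes "Fn (ext f) D"
  shows "ext f = gr D (ap f)"
proof -
  have m: "opr a b \<in> ext f \<longleftrightarrow> opr a b \<in> gr D (ap f)" for a b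
    using Fn_iff_ap[OF assms] assms by (auto simp: Fn_def)
  have "Rl (ext f)" "Rl (gr D (ap f))" using assms Fn_gr Fn_imp_Rl by blast+
  then have "p \<in> ext f \<longleftrightarrow> p \<in> gr D (ap f)" for p
    using m unfolding Rl_def by (cases "\<exists>a b. p = opr a b") blast+
  then show ?thesis by blast
qed

lemma gr_cong: "(\<And>a. a \<in> D \<Longrightarrow> g a = h a) \<Longrightarrow> gr D g = gr D h"
  by (auto simp: gr_def)

lemma Fn_ext:
  assumes "Fn (ext f) D" "Fn (ext g) D" "\<And>a. a \<in> D \<Longrightarrow> ap f a = ap g a"
  shows "f = g"
proof -
  have "ext f = ext g" using assms gr_cong by (metis Fn_eq_gr)
  then show ?thesis by simp
qed

text \<open>How a function of the meta level becomes an element of the model: when a class term B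
  gives its values, replacement collects the pairs of x and B.\<close>

lemma gr_isset:
  assumes "\<And>a. a \<in> ext m \<Longrightarrow> den E (v(x := a)) B = ext (g a)"
  shows "isset (gr (ext m) g)"
proof -
  let ?y = "fr ({x} \<union> cvars B) 0"
  have y: "?y \<notin> {x} \<union> cvars B" by (rule fr_avoid) simp
  have s: "sat E (v(x := a, ?y := b)) (cv ?y \<^bold>= cop (cv x) B) \<longleftrightarrow> b = opr a (g a)" if "a \<in> ext m" for a b
    using y assms[OF that] by auto
  then have "isset {b. \<exists>a\<in>ext m. sat E (v(x := a, ?y := b)) (cv ?y \<^bold>= cop (cv x) B)}"
    by (intro replacement) (use y in auto)
  also have "{b. \<exists>a\<in>ext m. sat E (v(x := a, ?y := b)) (cv ?y \<^bold>= cop (cv x) B)} = gr (ext m) g"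
    using s by (auto simp: gr_def)
  finally show ?thesis .
qed

lemma den_cmpt_gr:
  assumes "\<And>a. den E (v(x := a)) A = den E v A" "\<And>a. a \<in> den E v A \<Longrightarrow> den E (v(x := a)) B = ext (g a)"
  shows "den E v (cmpt x A B) = gr (den E v A) g"
  using assms by (auto simp: den_cmpt gr_def)

definition pw :: "'m \<Rightarrow> 'm"
  where "pw m = cod {a. ext a \<subseteq> ext m}"

lemma ext_pw [simp]: "ext (pw m) = {a. ext a \<subseteq> ext m}"
  by (simp add: pw_def)

text \<open>A pair of members of u is a set of subsets of u, so the function is a subset of the
  double power set.\<close>

lemma map_in_pw:
  assumes "Fn (ext f) (ext b)" "\<forall>x y. opr x y \<in> ext f \<longrightarrow> y \<in> ext a" "ext a \<union> ext b \<subseteq> ext u"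
  shows "f \<in> ext (pw (pw (pw u)))"
proof -
  have "p \<in> ext (pw (pw u))" if p: "p \<in> ext f" for p
  proof -
    obtain x y where xy: "p = opr x y" using assms(1) p by (auto simp: Fn_def Rl_def)
    then have "x \<in> ext b" "y \<in> ext a" using assms p by (auto simp: Fn_def)
    then show ?thesis using assms(3) by (auto simp: xy ext_opr)
  qed
  then show ?thesis by auto
qed

lemma map_isset: "isset {f. Fn (ext f) (ext b) \<and> (\<forall>x y. opr x y \<in> ext f \<longrightarrow> y \<in> ext a)}"
proof (rule definable_subset)
  show "{f. Fn (ext f) (ext b) \<and> (\<forall>x y. opr x y \<in> ext f \<longrightarrow> y \<in> ext a)}
    = den E ((\<lambda>_. a)(Aux 1 := b)) (cmap (cv (Aux 0)) (cv (Aux 1)))" by simp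
  show "{f. Fn (ext f) (ext b) \<and> (\<forall>x y. opr x y \<in> ext f \<longrightarrow> y \<in> ext a)}
    \<subseteq> ext (pw (pw (pw (cod (ext a \<union> ext b)))))"
    using map_in_pw[of _ b a "cod (ext a \<union> ext b)"] by auto
qed

section \<open>Ordinals\<close>

lemma insert_isset [simp]: "isset X \<Longrightarrow> isset (insert a X)"
  using Un_isset[OF singleton_isset[of a]] by simp

lemma On_trans: "a \<in> On \<Longrightarrow> b \<in> ext a \<Longrightarrow> c \<in> ext b \<Longrightarrow> c \<in> ext a"
  unfolding On_def Ordc_def by blast

lemma On_trichotomy: "a \<in> On \<Longrightarrow> b \<in> ext a \<Longrightarrow> c \<in> ext a \<Longrightarrow> b \<in> ext c \<or> b = c \<or> c \<in> ext b"
  unfolding On_def Ordc_def by blast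

text \<open>Comparability within a leaves three positions of d relative to b, and two of them would
  close a cycle of memberships.\<close>

lemma On_mem:
  assumes "a \<in> On" "b \<in> ext a"
  shows "b \<in> On"
proof -
  have "d \<in> ext b" if "c \<in> ext b" "d \<in> ext c" for c d
  proof -
    have "d \<in> ext a" using that assms On_trans by blast
    then have "d \<in> ext b \<or> d = b \<or> b \<in> ext d" using assms On_trichotomy by blast
    then show ?thesis using that no_cycle2[of b c] no_cycle3[of b d c] by blast
  qed
  moreover have "c \<in> ext d \<or> c = d \<or> d \<in> ext c" if "c \<in> ext b" "d \<in> ext b" for c d
    using that assms On_trans[OF assms] On_trichotomy[OF assms(1)] by blast
  ultimately show ?thesis unfolding On_def Ordc_def by blast
qed

text \<open>A membership-minimal element of the difference of a and c has exactly the members of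
  c.\<close>

lemma transitive_part_of_ordinal:
  assumes "a \<in> On" "ext c \<subseteq> ext a" "\<And>b. b \<in> ext c \<Longrightarrow> ext b \<subseteq> ext c" "c \<noteq> a"
  shows "c \<in> ext a"
proof -
  have "isset (ext a - ext c)"
    by (rule definable_subset[of _ "(\<lambda>_. a)(Aux 1 := c)" "cab (Aux 2) (cv (Aux 2) \<^bold>\<in> cv (Aux 0) \<^bold>\<and> \<^bold>\<not> (cv (Aux 2) \<^bold>\<in> cv (Aux 1)))" a])
      auto
  then obtain d where d: "ext a - ext c = ext d" by (rule issetE)
  moreover have "ext a \<noteq> ext c" using assms by auto
  ultimately obtain e where "e \<in> ext d" using assms by (metis Diff_eq_empty_iff ex_in_conv subset_antisym)
  then obtain y where y: "y \<in> ext d" "\<And>z. z \<in> ext y \<Longrightarrow> z \<notin> ext d" by (rule regularity) blast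
  have "ext y \<subseteq> ext c" using y d assms(1) by (auto simp: On_def Ordc_def) blast
  moreover have "ext c \<subseteq> ext y"
  proof
    fix z assume z: "z \<in> ext c"
    then have "z \<in> ext y \<or> z = y \<or> y \<in> ext z" using assms y(1) d unfolding On_def Ordc_def by blast
    then show "z \<in> ext y" using z assms(3) y(1) d by blast
  qed
  ultimately have "c = y" by (metis ext_eq_iff subset_antisym)
  then show ?thesis using y d by auto
qed

text \<open>The intersection is a transitive part of both ordinals; if it were a proper part of
  each, it would be an element of itself.\<close>

lemma On_linear:
  assumes "a \<in> On" "b \<in> On"
  shows "a \<in> ext b \<or> a = b \<or> b \<in> ext a"
proof -
  have "isset (ext a \<inter> ext b)"
    by (rule definable_subset[of _ "(\<lambda>_. a)(Aux 1 := b)" "cab (Aux 2) (cv (Aux 2) \<^bold>\<in> cv (Aux 0) \<^bold>\<and> cv (Aux 2) \<^bold>\<in> cv (Aux 1))" a])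
      auto
  then obtain c where c: "ext a \<inter> ext b = ext c" by (rule issetE)
  have t: "ext x \<subseteq> ext c" if "x \<in> ext c" for x
    using that c assms On_trans by blast
  have "c = a \<or> c \<in> ext a" using transitive_part_of_ordinal[OF assms(1) _ t] c by blast
  moreover have "c = b \<or> c \<in> ext b" using transitive_part_of_ordinal[OF assms(2) _ t] c by blast
  moreover have "c \<notin> ext c" by simp
  ultimately show ?thesis using c by blast
qed

lemma OnI:
  assumes "\<And>b. b \<in> ext a \<Longrightarrow> b \<in> On" "\<And>b c. b \<in> ext a \<Longrightarrow> c \<in> ext b \<Longrightarrow> c \<in> ext a"
  shows "a \<in> On"
proof -
  have "x \<in> ext y \<or> x = y \<or> y \<in> ext x" if "x \<in> ext a" "y \<in> ext a" for x y
    using that assms(1) On_linear by blast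
  then show ?thesis using assms(2) unfolding On_def Ordc_def by blast
qed

lemma On_least:
  assumes "a \<in> On" "a \<in> den E v A"
  obtains b where "b \<in> On" "b \<in> den E v A" "\<And>c. c \<in> ext b \<Longrightarrow> c \<notin> den E v A"
proof (cases "ext a \<inter> den E v A = {}")
  case True
  then show ?thesis using that assms by blast
next
  case False
  let ?x = "fr (cvars A) 0" and ?y = "fr (cvars A) 1"
  have "?x \<notin> cvars A" "?y \<notin> cvars A" by (simp_all add: fr_avoid)
  then have "isset (ext a \<inter> den E v A)"
    by (intro definable_subset[of _ "v(?y := a)" "cab ?x (cv ?x \<^bold>\<in> cv ?y \<^bold>\<and> cv ?x \<^bold>\<in> A)" a]) auto
  then obtain d where d: "ext a \<inter> den E v A = ext d" by (rule issetE)
  then obtain e where "e \<in> ext d" using False by blast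
  then obtain y where "y \<in> ext d" "\<And>z. z \<in> ext y \<Longrightarrow> z \<notin> ext d" by (rule regularity) blast
  then show ?thesis using that[of y] d assms(1) On_mem On_trans by blast
qed

text \<open>P has to agree on the ordinals with a denoted class: regularity holds inside the model,
  so only sets and definable classes have least counterexamples.\<close>

lemma On_induct:
  assumes "a \<in> On" and P: "\<And>x. x \<in> On \<Longrightarrow> P x \<longleftrightarrow> x \<in> den E v A"
    and step: "\<And>a. a \<in> On \<Longrightarrow> (\<And>b. b \<in> ext a \<Longrightarrow> P b) \<Longrightarrow> P a"
  shows "P a"
proof (rule ccontr)
  assume "\<not> P a"
  let ?x = "fr (cvars A) 0"
  let ?N = "cab ?x (\<^bold>\<not> (cv ?x \<^bold>\<in> A))"
  have "?x \<notin> cvars A" by (simp add: fr_avoid)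
  then have N: "b \<in> den E v ?N \<longleftrightarrow> \<not> P b" if "b \<in> On" for b using P[OF that] by simp
  have "a \<in> den E v ?N" using N assms(1) \<open>\<not> P a\<close> by blast
  then obtain b where b: "b \<in> On" "b \<in> den E v ?N" "\<And>c. c \<in> ext b \<Longrightarrow> c \<notin> den E v ?N"
    using On_least[OF assms(1)] by blast
  then have "P c" if "c \<in> ext b" for c using N On_mem that by blast
  then show False using b N step by blast
qed

definition suc :: "'m \<Rightarrow> 'm"
  where "suc a = cod (ext a \<union> {a})"

lemma ext_suc [simp]: "ext (suc a) = insert a (ext a)"
  by (simp add: suc_def)

lemma suc_On: "a \<in> On \<Longrightarrow> suc a \<in> On"
  by (rule OnI) (auto intro: On_mem On_trans)

lemma zero_On: "zero \<in> On"
  by (rule OnI) auto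

lemma Limc_imp_On: "Limc (ext a) \<Longrightarrow> a \<in> On"
  by (simp add: Limc_def On_def)

lemma Limc_suc:
  assumes "Limc (ext l)" "b \<in> ext l"
  shows "suc b \<in> ext l"
proof -
  have l: "l \<in> On" using assms Limc_imp_On by blast
  then have "suc b \<in> On" using assms On_mem suc_On by blast
  then consider "suc b \<in> ext l" | "suc b = l" | "l \<in> ext (suc b)" using On_linear l by blast
  then show ?thesis
  proof cases
    case 2
    have "b \<in> (\<Union>c\<in>ext l. ext c)" using assms unfolding Limc_def by blast
    then obtain c where "b \<in> ext c" "c \<in> ext l" by blast
    moreover from this have "c = b \<or> c \<in> ext b" using 2 by auto
    ultimately show ?thesis using no_cycle2 by auto
  next
    case 3
    then show ?thesis using assms no_cycle2 by auto
  qed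
qed

lemma LimcI:
  assumes "l \<in> On" "a \<in> ext l" "\<And>b. b \<in> ext l \<Longrightarrow> suc b \<in> ext l"
  shows "Limc (ext l)"
proof -
  have "ext l = (\<Union>b\<in>ext l. ext b)"
  proof (intro subset_antisym subsetI)
    fix b assume "b \<in> ext l"
    then show "b \<in> (\<Union>b\<in>ext l. ext b)" using assms(3)[of b] by (intro UN_I[of "suc b"]) simp_all
  next
    fix b assume "b \<in> (\<Union>b\<in>ext l. ext b)"
    then show "b \<in> ext l" using On_trans[OF assms(1)] by blast
  qed
  then show ?thesis using assms unfolding Limc_def On_def by blast
qed

text \<open>An ordinal that is not the union of its elements has a largest element, namely any one
  outside that union.\<close>

lemma On_cases:
  assumes "a \<in> On"
  obtains "a = zero" | b where "b \<in> On" "a = suc b" | "Limc (ext a)"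
proof (cases "a = zero \<or> Limc (ext a)")
  case False
  then have "ext a \<noteq> {}" by (metis ext_eq_iff ext_zero)
  then have "ext a \<noteq> (\<Union>b\<in>ext a. ext b)" using False assms by (auto simp: Limc_def On_def)
  then obtain b where b: "b \<in> ext a" "\<And>c. c \<in> ext a \<Longrightarrow> b \<notin> ext c"
    using On_trans[OF assms] by blast
  have "ext a = ext (suc b)"
  proof (intro subset_antisym subsetI)
    fix c assume "c \<in> ext a"
    then have "c \<in> ext b \<or> c = b" using b On_linear On_mem assms by metis
    then show "c \<in> ext (suc b)" by auto
  next
    fix c assume "c \<in> ext (suc b)"
    then show "c \<in> ext a" using b assms On_trans by auto
  qed
  then have "a = suc b" by (simp only: ext_eq_iff)
  moreover have "b \<in> On" using b On_mem assms by blast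
  ultimately show ?thesis using that(2) by blast
qed (use that in blast)

lemma Union_On:
  assumes "ext a \<subseteq> On" "ext u = (\<Union>b\<in>ext a. ext b)"
  shows "u \<in> On"
proof (rule OnI)
  fix b assume "b \<in> ext u"
  then obtain x where x: "x \<in> ext a" "b \<in> ext x" using assms(2) by blast
  then show "b \<in> On" using assms(1) On_mem by blast
  fix c assume "c \<in> ext b"
  then have "c \<in> ext x" using x assms(1) On_trans by blast
  then show "c \<in> ext u" using x assms(2) by blast
qed

lemma Limc_exists: "\<exists>l. Limc (ext l)"
proof -
  let ?x = "Aux 0" and ?y = "Aux 1" and ?z = "Aux 2" and ?w = "Aux 3"
  from sound[OF ax_inf2[of ?x ?y ?z ?w]]
  obtain x where x: "\<exists>y. y \<in> ext x \<and> (\<forall>z. z \<notin> ext y)"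
    "\<And>y. y \<in> ext x \<Longrightarrow> \<exists>z. z \<in> ext x \<and> (\<forall>w. w \<in> ext z \<longleftrightarrow> w \<in> ext y \<or> w = y)" by auto
  have z: "zero \<in> ext x"
  proof -
    obtain y where "y \<in> ext x" "ext y = {}" using x(1) by blast
    then show ?thesis by (metis ext_eq_iff ext_zero)
  qed
  have s: "suc y \<in> ext x" if "y \<in> ext x" for y
  proof -
    obtain z where z: "z \<in> ext x" "\<forall>w. w \<in> ext z \<longleftrightarrow> w \<in> ext y \<or> w = y" using x(2) \<open>y \<in> ext x\<close> by blast
    then have "ext z = ext (suc y)" by auto
    then have "z = suc y" by (simp only: ext_eq_iff)
    then show ?thesis using z by simp
  qed
  \<comment> \<open>ax-inf2 allows x to contain sets that are no ordinals. The union of the ordinals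
    in x is an ordinal, and it is closed under successor because x is.\<close>
  have "isset (ext x \<inter> On)"
    by (rule definable_subset[of _ "\<lambda>_. x" "cab ?y (cv ?y \<^bold>\<in> cv ?x \<^bold>\<and> cv ?y \<^bold>\<in> con0)" x]) auto
  then obtain o' where o': "ext x \<inter> On = ext o'" by (rule issetE)
  obtain u where u: "(\<Union>b\<in>ext o'. ext b) = ext u" using Union_isset by (rule issetE)
  have "Limc (ext u)"
  proof (rule LimcI)
    show "u \<in> On" using Union_On[of o' u] o' u by auto
    have "suc zero \<in> ext o'" using s[OF z] suc_On[OF zero_On] o' by blast
    moreover have "zero \<in> ext (suc zero)" by simp
    ultimately show "zero \<in> ext u" using u by blast
    fix b assume "b \<in> ext u"
    then obtain c where c: "c \<in> ext x" "c \<in> On" "b \<in> ext c" using o' u[symmetric] by auto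
    have "suc b \<in> On" using c On_mem suc_On by blast
    then have "suc b \<in> ext c \<or> suc b = c \<or> c \<in> ext (suc b)" using c On_linear by blast
    then have "suc b \<in> ext (suc c)" using c no_cycle2 by auto
    moreover have "suc c \<in> ext o'" using c s suc_On o' by auto
    ultimately show "suc b \<in> ext u" using u by blast
  qed
  then show ?thesis by blast
qed

section \<open>The least limit ordinal\<close>

definition om :: 'm
  where "om = cod {a \<in> On. \<forall>y. Limc (ext y) \<longrightarrow> a \<in> ext y}"

text \<open>set.mm defines \<omega> as the class of ordinals below every limit ordinal; a least
  limit ordinal exists and has exactly these elements.\<close>

lemma om_props: "ext om = {a \<in> On. \<forall>y. Limc (ext y) \<longrightarrow> a \<in> ext y}" "Limc (ext om)"
proof -
  obtain l where "Limc (ext l)" using Limc_exists by blast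
  moreover have L: "den E v (cab (Aux 0) (wlim (cv (Aux 0)))) = {a. Limc (ext a)}" for v by auto
  ultimately obtain m where m: "m \<in> On" "Limc (ext m)" "\<And>c. c \<in> ext m \<Longrightarrow> \<not> Limc (ext c)"
    using On_least[of l _ "cab (Aux 0) (wlim (cv (Aux 0)))"] Limc_imp_On by (metis mem_Collect_eq)
  have "m = l \<or> m \<in> ext l" if "Limc (ext l)" for l using On_linear m that Limc_imp_On by blast
  then have "{a \<in> On. \<forall>y. Limc (ext y) \<longrightarrow> a \<in> ext y} = ext m"
    using m On_mem On_trans Limc_imp_On by blast
  then have "om = m" "ext om = {a \<in> On. \<forall>y. Limc (ext y) \<longrightarrow> a \<in> ext y}" by (simp_all add: om_def)
  then show "ext om = {a \<in> On. \<forall>y. Limc (ext y) \<longrightarrow> a \<in> ext y}" "Limc (ext om)" using m by (simp_all only:)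
qed

lemma den_com [simp]: "den E v com = ext om"
  by (simp add: com_def Let_def om_props(1) conj_commute)

lemma om_On: "om \<in> On"
  using om_props(2) Limc_imp_On by blast

lemma zero_om: "zero \<in> ext om"
proof -
  have "zero \<in> ext y" if "Limc (ext y)" for y
  proof -
    have "zero \<in> ext y \<or> zero = y \<or> y \<in> ext zero" using that Limc_imp_On zero_On On_linear by blast
    then show ?thesis using that by (auto simp: Limc_def)
  qed
  then show ?thesis using om_props(1) zero_On by blast
qed

lemma suc_om: "a \<in> ext om \<Longrightarrow> suc a \<in> ext om"
  using om_props(2) Limc_suc by blast

lemma om_cases:
  assumes "a \<in> ext om"
  obtains "a = zero" | b where "b \<in> ext om" "a = suc b"
proof -
  have "a \<in> On" using assms om_On On_mem by blast
  moreover have "\<not> Limc (ext a)" using assms om_props(1) no_cycle1 by blast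
  ultimately show ?thesis using that assms om_On On_trans by (metis On_cases ext_suc insertI1)
qed

section \<open>Transfinite recursion\<close>

definition rst :: "'m \<Rightarrow> 'm \<Rightarrow> 'm"
  where "rst f y = cod {opr a b | a b. opr a b \<in> ext f \<and> a \<in> ext y}"

lemma ext_rst: "ext (rst f y) = {opr a b | a b. opr a b \<in> ext f \<and> a \<in> ext y}"
proof -
  have "isset {opr a b | a b. opr a b \<in> ext f \<and> a \<in> ext y}"
    by (rule definable_subset[of _ "(\<lambda>_. f)(Aux 1 := y)" "cres (cv (Aux 0)) (cv (Aux 1))" f]) (auto simp: den_cres)
  then show ?thesis by (simp add: rst_def)
qed

lemma den_cres_cv [simp]: "den E v (cres (cv f) (cv y)) = ext (rst (v f) (v y))"
  by (simp add: ext_rst den_cres)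

lemma ext_rst_gr:
  assumes "Fn (ext f) (ext a)" "ext y \<subseteq> ext a"
  shows "ext (rst f y) = gr (ext y) (ap f)"
  using Fn_iff_ap[OF assms(1)] assms by (auto simp: ext_rst gr_def Fn_def)

text \<open>An attempt in the sense of the classical recursion theorem: the recursively defined
  function cut off at a.\<close>

definition att :: "('m \<Rightarrow> 'm) \<Rightarrow> 'm \<Rightarrow> 'm \<Rightarrow> bool"
  where "att G f a \<longleftrightarrow> Fn (ext f) (ext a) \<and> (\<forall>y\<in>ext a. ap f y = G (rst f y))"

text \<open>Total on the model, since a class has the empty value wherever it has no unique
  one.\<close>

definition value_fn :: "'m set \<Rightarrow> 'm \<Rightarrow> 'm"
  where "value_fn F h = cod (fval F (ext h))"

lemma ext_value_fn [simp]: "ext (value_fn F h) = fval F (ext h)"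
  by (simp add: value_fn_def)

lemma sat_att:
  assumes "distinct [x, y, f]" "x \<notin> cvars F" "y \<notin> cvars F" "f \<notin> cvars F"
  shows "sat E w (wfn (cv f) (cv x) \<^bold>\<and> \<^bold>\<forall>y\<^bold>\<in>cv x\<^bold>. (cfv (cv f) (cv y) \<^bold>= cfv F (cres (cv f) (cv y))))
    \<longleftrightarrow> att (value_fn (den E w F)) (w f) (w x)"
proof -
  have "ext (ap (w f) a) = fval (den E w F) (ext (rst (w f) a)) \<longleftrightarrow>
      ap (w f) a = value_fn (den E w F) (rst (w f) a)" for a
    by (metis ext_eq_iff ext_value_fn)
  then show ?thesis using assms by (auto simp: att_def)
qed

lemma att_agree:
  assumes f: "att G f a" and g: "att G g b" and ab: "a \<in> On" "b \<in> On" and y: "y \<in> ext a" "y \<in> ext b"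
  shows "ap f y = ap g y"
proof -
  \<comment> \<open>With the two functions and their domains as values of variables, agreement at an
    ordinal is expressed by a class term.\<close>
  let ?v = "(\<lambda>_. a)(Aux 1 := b, Aux 2 := f, Aux 3 := g)"
  let ?A = "cab (Aux 4) ((cv (Aux 4) \<^bold>\<in> cv (Aux 0) \<^bold>\<and> cv (Aux 4) \<^bold>\<in> cv (Aux 1)) \<^bold>\<rightarrow>
    cfv (cv (Aux 2)) (cv (Aux 4)) \<^bold>= cfv (cv (Aux 3)) (cv (Aux 4)))"
  have "y \<in> On" using ab y On_mem by blast
  then have "y \<in> ext a \<and> y \<in> ext b \<longrightarrow> ap f y = ap g y"
  proof (rule On_induct)
    show "(x \<in> ext a \<and> x \<in> ext b \<longrightarrow> ap f x = ap g x) \<longleftrightarrow> x \<in> den E ?v ?A" for x by simp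
    fix y assume IH: "\<And>c. c \<in> ext y \<Longrightarrow> c \<in> ext a \<and> c \<in> ext b \<longrightarrow> ap f c = ap g c"
    show "y \<in> ext a \<and> y \<in> ext b \<longrightarrow> ap f y = ap g y"
    proof
      assume y: "y \<in> ext a \<and> y \<in> ext b"
      then have s: "ext y \<subseteq> ext a" "ext y \<subseteq> ext b" using ab On_trans by blast+
      have "ext (rst f y) = gr (ext y) (ap f)" using f s by (intro ext_rst_gr) (auto simp: att_def)
      also have "\<dots> = gr (ext y) (ap g)" using IH s by (intro gr_cong) blast
      also have "\<dots> = ext (rst g y)" using g s by (intro ext_rst_gr[of g b, symmetric]) (auto simp: att_def)
      finally have "rst f y = rst g y" by simp
      then show "ap f y = ap g y" using f g y by (simp add: att_def)
    qed
  qed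
  then show ?thesis using y by blast
qed

lemma att_unique:
  assumes "att G f a" "att G g a" "a \<in> On"
  shows "f = g"
proof (rule Fn_ext)
  show "Fn (ext f) (ext a)" "Fn (ext g) (ext a)" using assms unfolding att_def by blast+
  show "ap f b = ap g b" if "b \<in> ext a" for b using att_agree[OF assms(1,2,3,3) that that] .
qed

lemma att_rst:
  assumes f: "att G f a" and a: "a \<in> On" "c \<in> ext a"
  shows "att G (rst f c) c"
proof -
  have fn: "Fn (ext f) (ext a)" using f by (simp add: att_def)
  have s: "ext c \<subseteq> ext a" using a On_trans by blast
  have e: "ext (rst f c) = gr (ext c) (ap f)" by (rule ext_rst_gr[OF fn s])
  have F: "Fn (ext (rst f c)) (ext c)" by (simp add: e)
  have "ap (rst f c) z = ap f z" if "z \<in> ext c" for z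
  proof -
    have "opr z (ap f z) \<in> ext (rst f c)" using e that by simp
    then show ?thesis using Fn_iff_ap[OF F that] by simp
  qed
  moreover have "rst (rst f c) z = rst f z" if "z \<in> ext c" for z
  proof -
    have zc: "ext z \<subseteq> ext c" using that a On_mem On_trans by blast
    have "ext (rst (rst f c) z) = ext (rst f z)"
      using zc by (auto simp: ext_rst)
    then show ?thesis by simp
  qed
  ultimately show ?thesis using F f s by (auto simp: att_def)
qed

text \<open>By uniqueness the attempt on each b in a is definable from b, so replacement applies.
  The attempt on a sends b to the value of G at the attempt on b.\<close>

lemma att_exists:
  assumes "a \<in> On"
  shows "\<exists>f. att (value_fn (den E v F)) f a"
proof -
  let ?G = "value_fn (den E v F)"
  let ?x = "fr (cvars F) 0" and ?y = "fr (cvars F) 1" and ?f = "fr (cvars F) 2" and ?p = "fr (cvars F) 3"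
  have fr: "fr (cvars F) n \<notin> cvars F" for n by (simp add: fr_avoid)
  let ?att = "wfn (cv ?f) (cv ?x) \<^bold>\<and> \<^bold>\<forall>?y\<^bold>\<in>cv ?x\<^bold>. (cfv (cv ?f) (cv ?y) \<^bold>= cfv F (cres (cv ?f) (cv ?y)))"
  have sat_att': "sat E w ?att \<longleftrightarrow> att (value_fn (den E w F)) (w ?f) (w ?x)" for w
    using fr by (intro sat_att) auto
  show ?thesis using assms
  proof (rule On_induct)
    show "(\<exists>f. att ?G f a) \<longleftrightarrow> a \<in> den E v (cab ?x (wex ?f ?att))" for a
      using fr by (simp only: den.simps sat_defined(4) sat_att' mem_Collect_eq) simp
    fix a assume a: "a \<in> On" and IH: "\<And>b. b \<in> ext a \<Longrightarrow> \<exists>f. att ?G f b"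
    \<comment> \<open>An arbitrary selection; uniqueness identifies it with the attempt described by
      the formula below.\<close>
    define fb where "fb b = (SOME f. att ?G f b)" for b
    have fb: "att ?G (fb b) b" if "b \<in> ext a" for b
      unfolding fb_def using IH[OF that] by (rule someI_ex)
    have fb_eq: "f = fb b" if "b \<in> ext a" "att ?G f b" for f b
      using att_unique[OF that(2) fb[OF that(1)]] a that On_mem by blast
    let ?\<phi> = "wex ?f (?att \<^bold>\<and> cv ?p \<^bold>= cop (cv ?x) (cfv F (cv ?f)))"
    have s: "sat E (v(?x := b, ?p := q)) ?\<phi> \<longleftrightarrow> q = opr b (?G (fb b))" if b: "b \<in> ext a" for b q
    proof -
      have "sat E (v(?x := b, ?p := q)) ?\<phi> \<longleftrightarrow> (\<exists>f. att ?G f b \<and> q = opr b (?G f))"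
      proof -
        have "sat E w (?att \<^bold>\<and> cv ?p \<^bold>= cop (cv ?x) (cfv F (cv ?f))) \<longleftrightarrow>
            att (value_fn (den E w F)) (w ?f) (w ?x) \<and> sat E w (cv ?p \<^bold>= cop (cv ?x) (cfv F (cv ?f)))" for w
          by (simp only: sat_defined(1)[of E w ?att] sat_att')
        note * = this
        show ?thesis by (simp only: sat_defined(4) *) (use fr in \<open>simp add: value_fn_def\<close>)
      qed
      then show ?thesis using fb fb_eq b by blast
    qed
    then have "isset {q. \<exists>b\<in>ext a. sat E (v(?x := b, ?p := q)) ?\<phi>}"
      by (intro replacement) auto
    also have "{q. \<exists>b\<in>ext a. sat E (v(?x := b, ?p := q)) ?\<phi>} = gr (ext a) (\<lambda>b. ?G (fb b))"
      using s by (auto simp: gr_def simp del: sat_defined)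
    finally obtain h where h: "gr (ext a) (\<lambda>b. ?G (fb b)) = ext h" by (rule issetE)
    have F: "Fn (ext h) (ext a)" by (simp flip: h)
    have ap_h: "ap h b = ?G (fb b)" if "b \<in> ext a" for b
      using Fn_iff_ap[OF F that] that by (simp flip: h)
    \<comment> \<open>Both are functions on y. They agree at c because the attempt on y, restricted
      to c, is the attempt on c.\<close>
    have "rst h y = fb y" if y: "y \<in> ext a" for y
    proof (rule fb_eq[OF y])
      have sub: "ext y \<subseteq> ext a" using y a On_trans by blast
      have e: "ext (rst h y) = gr (ext y) (ap h)" by (rule ext_rst_gr[OF F sub])
      have "ap (fb y) c = ap h c" if c: "c \<in> ext y" for c
      proof -
        have "att ?G (rst (fb y) c) c" using att_rst[OF fb[OF y]] y a c On_mem by blast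
        then have "rst (fb y) c = fb c" using fb_eq sub c by blast
        then show ?thesis using fb[OF y] c ap_h sub by (auto simp: att_def)
      qed
      then have "gr (ext y) (ap h) = gr (ext y) (ap (fb y))" by (intro gr_cong) simp
      also have "\<dots> = ext (fb y)" using fb[OF y] by (intro Fn_eq_gr[symmetric]) (simp add: att_def)
      finally have "rst h y = fb y" using e by simp
      then show "att ?G (rst h y) y" using fb[OF y] by simp
    qed
    then have "att ?G h a" using F ap_h by (simp add: att_def)
    then show "\<exists>f. att ?G f a" by blast
  qed
qed

lemma den_crecs:
  "den E v (crecs F) = {p. \<exists>f x. x \<in> On \<and> att (value_fn (den E v F)) f x \<and> p \<in> ext f}"
proof -
  let ?x = "fr (cvars F) 0" and ?y = "fr (cvars F) 1" and ?f = "fr (cvars F) 2"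
  have fr: "fr (cvars F) n \<notin> cvars F" for n by (simp add: fr_avoid)
  let ?att = "wfn (cv ?f) (cv ?x) \<^bold>\<and> \<^bold>\<forall>?y\<^bold>\<in>cv ?x\<^bold>. (cfv (cv ?f) (cv ?y) \<^bold>= cfv F (cres (cv ?f) (cv ?y)))"
  have sat_att': "sat E w ?att \<longleftrightarrow> att (value_fn (den E w F)) (w ?f) (w ?x)" for w
    using fr by (intro sat_att) auto
  have "den E v (crecs F) = (\<Union>f\<in>{f. \<exists>x. x \<in> On \<and> sat E (v(?f := f, ?x := x)) ?att}. ext f)"
    by (simp only: crecs_def Let_def den_cuni den.simps sat_wrex den_con0)
  also have "\<dots> = {p. \<exists>f x. x \<in> On \<and> att (value_fn (den E v F)) f x \<and> p \<in> ext f}"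
    unfolding sat_att' using fr by auto
  finally show ?thesis .
qed

text \<open>\<open>crecs F\<close> is treated as a class, which need not be an element of the model.
  Its values are gathered in a function r of the meta level, whose restrictions to ordinals are
  elements.\<close>

lemma recursion:
  obtains r where "\<And>a. a \<in> On \<Longrightarrow> fval (den E v (crecs F)) (ext a) = ext (r a)"
    "\<And>a. a \<in> On \<Longrightarrow> \<exists>h. ext h = gr (ext a) r \<and> r a = value_fn (den E v F) h"
proof -
  let ?G = "value_fn (den E v F)"
  define fb where "fb b = (SOME f. att ?G f b)" for b
  have fb: "att ?G (fb b) b" if "b \<in> On" for b
    unfolding fb_def using att_exists[OF that] by (rule someI_ex)
  have fb_eq: "rst f b = fb b" if "att ?G f a" "b \<in> ext a" "a \<in> On" for f a b
    using att_unique[OF att_rst[OF that(1,3,2)] fb] that On_mem by blast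
  define r where "r a = ?G (fb a)" for a
  have ap_r: "ap f b = r b" if "att ?G f a" "b \<in> ext a" "a \<in> On" for f a b
    using that fb_eq[OF that] by (simp add: att_def r_def)
  have gr: "ext (fb a) = gr (ext a) r" if "a \<in> On" for a
  proof -
    have "ext (fb a) = gr (ext a) (ap (fb a))" using fb[OF that] by (intro Fn_eq_gr) (simp add: att_def)
    also have "\<dots> = gr (ext a) r" using ap_r[OF fb[OF that] _ that] by (rule gr_cong)
    finally show ?thesis .
  qed
  have "opr a b \<in> den E v (crecs F) \<longleftrightarrow> b = r a" if a: "a \<in> On" for a b
  proof
    assume "opr a b \<in> den E v (crecs F)"
    then obtain f x where f: "x \<in> On" "att ?G f x" "opr a b \<in> ext f" by (auto simp: den_crecs)
    then have "a \<in> ext x" by (auto simp: att_def Fn_def)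
    then show "b = r a" using f ap_r Fn_iff_ap[of f "ext x" a b] by (auto simp: att_def)
  next
    assume "b = r a"
    moreover have "suc a \<in> On" using a suc_On by blast
    ultimately have "opr a b \<in> ext (fb (suc a))" using gr by simp
    then show "opr a b \<in> den E v (crecs F)" using fb \<open>suc a \<in> On\<close> by (auto simp: den_crecs)
  qed
  then have "fval (den E v (crecs F)) (ext a) = ext (r a)" if "a \<in> On" for a
    using that by (intro fval_eqI) blast
  moreover have "\<exists>h. ext h = gr (ext a) r \<and> r a = ?G h" if "a \<in> On" for a
    using gr[OF that] r_def by blast
  ultimately show ?thesis using that by blast
qed

section \<open>Recursion by zero, successor and limit cases\<close>

lemma fval_cmpt_cvv:
  assumes "isset (den E (v(x := h)) B)"
  shows "fval (den E v (cmpt x cvv B)) (ext h) = den E (v(x := h)) B"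
proof -
  obtain c where c: "den E (v(x := h)) B = ext c" using assms by (rule issetE)
  have "fval (den E v (cmpt x cvv B)) (ext h) = ext c"
    by (rule fval_eqI) (auto simp: den_cmpt c)
  then show ?thesis using c by simp
qed

definition rdg_body :: "'m set \<Rightarrow> 'm set \<Rightarrow> 'm \<Rightarrow> 'm set"
  where "rdg_body F A h = (let dom = {a. \<exists>b. opr a b \<in> ext h} in
    if ext h = {} then A
    else if Limc dom then (\<Union>b\<in>{b. \<exists>a. opr a b \<in> ext h}. ext b)
    else fval F (fval (ext h) (\<Union>a\<in>dom. ext a)))"

text \<open>Hides the bound variable and shows that the recursion depends on F and A through their
  denotations alone.\<close>

lemma crdg_body:
  obtains g B where "crdg F A = crecs (cmpt g cvv B)"
    "\<And>v h. den E (v(g := h)) B = rdg_body (den E v F) (den E v A) h"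
proof
  let ?g = "fr (cvars F \<union> cvars A) 0"
  have g: "?g \<notin> cvars F \<union> cvars A" by (rule fr_avoid) simp
  show "crdg F A = crecs (cmpt ?g cvv (cif (cv ?g \<^bold>= c0) A
        (cif (wlim (cdm (cv ?g))) (cuni (crn (cv ?g)))
          (cfv F (cfv (cv ?g) (cuni (cdm (cv ?g))))))))"
    by (simp add: crdg_def Let_def)
  show "den E (v(?g := h)) (cif (cv ?g \<^bold>= c0) A
        (cif (wlim (cdm (cv ?g))) (cuni (crn (cv ?g)))
          (cfv F (cfv (cv ?g) (cuni (cdm (cv ?g)))))))
      = rdg_body (den E v F) (den E v A) h" for v h
    using g by (simp add: rdg_body_def Let_def)
qed

lemma den_crdg_cong:
  assumes "den E v F = den E w F" "den E v A = den E w A"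
  shows "den E v (crdg F A) = den E w (crdg F A)"
proof -
  obtain g B where gB: "crdg F A = crecs (cmpt g cvv B)"
    "\<And>v h. den E (v(g := h)) B = rdg_body (den E v F) (den E v A) h" using crdg_body by blast
  have "den E v (cmpt g cvv B) = den E w (cmpt g cvv B)" using assms by (simp add: den_cmpt gB(2))
  then show ?thesis by (simp add: gB(1) den_crecs)
qed

lemma rdg:
  assumes A: "den E v A = ext a0"
  obtains r where "\<And>a. a \<in> On \<Longrightarrow> fval (den E v (crdg F A)) (ext a) = ext (r a)"
    "r zero = a0" "\<And>a. a \<in> On \<Longrightarrow> ext (r (suc a)) = fval (den E v F) (ext (r a))"
    "\<And>a. Limc (ext a) \<Longrightarrow> ext (r a) = (\<Union>b\<in>ext a. ext (r b))"
proof -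
  obtain g B where gB: "crdg F A = crecs (cmpt g cvv B)"
    "\<And>v h. den E (v(g := h)) B = rdg_body (den E v F) (den E v A) h" using crdg_body by blast
  obtain r where r: "\<And>a. a \<in> On \<Longrightarrow> fval (den E v (crdg F A)) (ext a) = ext (r a)"
    "\<And>a. a \<in> On \<Longrightarrow> \<exists>h. ext h = gr (ext a) r \<and> r a = value_fn (den E v (cmpt g cvv B)) h"
    using recursion[of v "cmpt g cvv B"] unfolding gB(1) by blast
  have step: "ext (r a) = rdg_body (den E v F) (den E v A) h"
    if "a \<in> On" "ext h = gr (ext a) r" "isset (rdg_body (den E v F) (den E v A) h)" for a h
  proof -
    obtain h' where h': "ext h' = gr (ext a) r" "r a = value_fn (den E v (cmpt g cvv B)) h'"
      using r(2) \<open>a \<in> On\<close> by blast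
    then have "h' = h" using that(2) by (metis ext_eq_iff)
    then show ?thesis using h'(2) that(3) by (simp add: fval_cmpt_cvv gB(2))
  qed
  have dom: "{x. \<exists>b. opr x b \<in> gr D r} = D" "{b. \<exists>x. opr x b \<in> gr D r} = r ` D" for D by auto
  have z: "r zero = a0"
  proof -
    obtain h where h: "ext h = gr (ext zero) r" using r(2) zero_On by blast
    then have "ext h = {}" by (simp add: gr_def)
    then have "rdg_body (den E v F) (den E v A) h = ext a0" by (simp add: rdg_body_def A)
    then have "ext (r zero) = ext a0" using step[OF zero_On h] by simp
    then show ?thesis by simp
  qed
  have s: "ext (r (suc a)) = fval (den E v F) (ext (r a))" if a: "a \<in> On" for a
  proof -
    have sa: "suc a \<in> On" using a suc_On by blast
    obtain h where h: "ext h = gr (ext (suc a)) r" using r(2) sa by blast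
    \<comment> \<open>A limit is closed under successor, so if \<open>suc a\<close> were one it
      would be an element of itself.\<close>
    have "\<not> Limc (ext (suc a))" using Limc_suc[of "suc a" a] no_cycle1[of "suc a"] by auto
    moreover have "opr a (r a) \<in> gr (ext (suc a)) r" by simp
    then have "gr (ext (suc a)) r \<noteq> {}" by blast
    moreover have "(\<Union>b\<in>ext (suc a). ext b) = ext a" using a On_trans by auto
    moreover have "fval (gr (ext (suc a)) r) (ext a) = ext (r a)" by (rule fval_gr) simp
    ultimately have "rdg_body (den E v F) (den E v A) h = fval (den E v F) (ext (r a))"
      unfolding rdg_body_def h dom Let_def by simp
    then show ?thesis using step[OF sa h] by simp
  qed
  have l: "ext (r a) = (\<Union>b\<in>ext a. ext (r b))" if lim: "Limc (ext a)" for a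
  proof -
    have a: "a \<in> On" using lim Limc_imp_On by blast
    obtain h where h: "ext h = gr (ext a) r" using r(2) a by blast
    obtain b where "b \<in> ext a" using lim by (auto simp: Limc_def)
    then have "opr b (r b) \<in> gr (ext a) r" by simp
    then have "gr (ext a) r \<noteq> {}" by blast
    then have b: "rdg_body (den E v F) (den E v A) h = (\<Union>b\<in>r ` ext a. ext b)"
      unfolding rdg_body_def h dom Let_def using lim by simp
    obtain u where u: "(\<Union>b\<in>ext h. ext b) = ext u" using Union_isset by (rule issetE)
    obtain u' where u': "(\<Union>b\<in>ext u. ext b) = ext u'" using Union_isset by (rule issetE)
    \<comment> \<open>These values form the range of h. As the pair of b and c is {{b}, {b, c}},
      they lie in the double union of h, which is a set.\<close>
    have "isset (r ` ext a)"
    proof (rule definable_subset[of _ "\<lambda>_. h" "crn (cv (Aux 0))" u'])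
      show "r ` ext a = den E (\<lambda>_. h) (crn (cv (Aux 0)))" by (auto simp: h)
      have "r b \<in> ext u'" if "b \<in> ext a" for b
      proof -
        have "opr b (r b) \<in> ext h" using h that by simp
        moreover have "cod {b, r b} \<in> ext (opr b (r b))" by (simp add: ext_opr)
        ultimately have "cod {b, r b} \<in> ext u" using u by blast
        moreover have "r b \<in> ext (cod {b, r b})" by simp
        ultimately show ?thesis using u' by blast
      qed
      then show "r ` ext a \<subseteq> ext u'" by blast
    qed
    then obtain m where "r ` ext a = ext m" by (rule issetE)
    then have "isset (\<Union>b\<in>r ` ext a. ext b)" by simp
    then show ?thesis using step[OF a h] b by simp
  qed
  show ?thesis using that r(1) z s l by blast
qed

section \<open>The cumulative hierarchy\<close>

text \<open>The hierarchy needs two facts about its index \<omega> + \<omega>: it is a limit ordinal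
  and exceeds \<omega>.\<close>

lemma coa_omega:
  obtains l where "\<And>v. den E v (coa com com) = ext l" "Limc (ext l)" "om \<in> ext l"
proof -
  let ?F = "cmpt (fr {} 0) cvv (csuc (cv (fr {} 0)))"
  \<comment> \<open>The terms have no free variables, so they are evaluated at an arbitrary
    assignment; \<open>den_crdg_cong\<close> transfers the result to every v.\<close>
  fix v0 :: "svar \<Rightarrow> 'm"
  obtain r where r: "\<And>a. a \<in> On \<Longrightarrow> fval (den E v0 (crdg ?F com)) (ext a) = ext (r a)"
    "r zero = om" "\<And>a. a \<in> On \<Longrightarrow> ext (r (suc a)) = fval (den E v0 ?F) (ext (r a))"
    "\<And>a. Limc (ext a) \<Longrightarrow> ext (r a) = (\<Union>b\<in>ext a. ext (r b))"
    by (rule rdg[OF den_com, of v0 ?F]) blast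
  have "fval (den E v0 ?F) (ext a) = ext (suc a)" for a
    by (subst fval_cmpt_cvv) auto
  then have r_suc: "r (suc a) = suc (r a)" if "a \<in> On" for a
    using r(3)[OF that] by (simp only: ext_eq_iff)
  have rOn: "r a \<in> On" if a: "a \<in> ext om" for a
  proof -
    have "a \<in> On" using a om_On On_mem by blast
    \<comment> \<open>The restriction to elements of \<open>om\<close> keeps limit ordinals out of
      the induction.\<close>
    then have "a \<in> ext om \<longrightarrow> r a \<in> On"
    proof (rule On_induct)
      let ?x = "fr (cvars (crdg ?F com)) 0"
      have x: "?x \<notin> cvars (crdg ?F com)" by (simp add: fr_avoid)
      show "(a \<in> ext om \<longrightarrow> r a \<in> On) \<longleftrightarrow>
          a \<in> den E v0 (cab ?x (cv ?x \<^bold>\<in> com \<^bold>\<rightarrow> cfv (crdg ?F com) (cv ?x) \<^bold>\<in> con0))" if "a \<in> On" for a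
        using x r(1)[OF that] by simp
      fix a assume IH: "\<And>b. b \<in> ext a \<Longrightarrow> b \<in> ext om \<longrightarrow> r b \<in> On"
      show "a \<in> ext om \<longrightarrow> r a \<in> On"
      proof
        assume "a \<in> ext om"
        then show "r a \<in> On"
        proof (cases rule: om_cases)
          case 1
          then show ?thesis using r(2) om_On by simp
        next
          case (2 b)
          moreover have "b \<in> On" using 2 om_On On_mem by blast
          ultimately show ?thesis using IH[of b] r_suc suc_On by simp
        qed
      qed
    qed
    then show ?thesis using a by blast
  qed
  have om_sub: "ext (r om) = (\<Union>b\<in>ext om. ext (r b))" using r(4) om_props(2) by blast
  have "Limc (ext (r om))"
  proof (rule LimcI)
    show "r om \<in> On"
    proof (rule OnI)
      fix b assume "b \<in> ext (r om)"
      then obtain n where n: "n \<in> ext om" "b \<in> ext (r n)" using om_sub by blast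
      then show "b \<in> On" using rOn On_mem by blast
      fix c assume "c \<in> ext b"
      then show "c \<in> ext (r om)" using n rOn On_trans om_sub by blast
    qed
    have "zero \<in> ext (r zero)" using zero_om r(2) by simp
    then show "zero \<in> ext (r om)" using om_sub zero_om by blast
    fix b assume "b \<in> ext (r om)"
    then obtain n where n: "n \<in> ext om" "b \<in> ext (r n)" using om_sub by blast
    then have nOn: "n \<in> On" using om_On On_mem by blast
    have "suc b \<in> On" using n rOn On_mem suc_On by blast
    then have "suc b \<in> ext (r n) \<or> suc b = r n \<or> r n \<in> ext (suc b)" using rOn n On_linear by blast
    then have "suc b \<in> ext (suc (r n))" using n no_cycle2 by auto
    then have "suc b \<in> ext (r (suc n))" using r_suc nOn by simp
    then show "suc b \<in> ext (r om)" using n suc_om om_sub by blast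
  qed
  moreover have "om \<in> ext (r om)"
  proof -
    have "om \<in> ext (r (suc zero))" using r_suc[OF zero_On] r(2) by simp
    then show ?thesis using om_sub suc_om[OF zero_om] by blast
  qed
  moreover have "den E v (coa com com) = ext (r om)" for v
  proof -
    have "den E v ?F = den E v0 ?F" by (simp add: den_cmpt)
    then have "den E v (crdg ?F com) = den E v0 (crdg ?F com)" by (rule den_crdg_cong) simp
    then show ?thesis using r(1)[OF om_On] by (simp add: coa_def Let_def)
  qed
  ultimately show ?thesis using that by blast
qed

text \<open>These closure properties are what the interpretation of types uses: infinity for
  \<open>ind\<close>, power sets and upper bounds for function types, transitivity for
  subsets.\<close>

lemma V_exists:
  obtains V where "\<And>v. den E v cVww = ext V" "om \<in> ext V"
    "\<And>a b. a \<in> ext V \<Longrightarrow> b \<in> ext a \<Longrightarrow> b \<in> ext V" "\<And>a. a \<in> ext V \<Longrightarrow> pw a \<in> ext V"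
    "\<And>a b. a \<in> ext V \<Longrightarrow> b \<in> ext V \<Longrightarrow> \<exists>u\<in>ext V. ext a \<union> ext b \<subseteq> ext u"
proof -
  obtain l where l: "\<And>v. den E v (coa com com) = ext l" "Limc (ext l)" "om \<in> ext l"
    by (rule coa_omega) blast
  have lOn: "l \<in> On" using l(2) Limc_imp_On by blast
  let ?F = "cmpt (fr {} 0) cvv (cpw (cv (fr {} 0)))"
  let ?R = "crdg ?F c0"
  fix v0 :: "svar \<Rightarrow> 'm"
  have "den E v0 c0 = ext zero" by simp
  then obtain r where r: "\<And>a. a \<in> On \<Longrightarrow> fval (den E v0 ?R) (ext a) = ext (r a)"
    "r zero = zero" "\<And>a. a \<in> On \<Longrightarrow> ext (r (suc a)) = fval (den E v0 ?F) (ext (r a))"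
    "\<And>a. Limc (ext a) \<Longrightarrow> ext (r a) = (\<Union>b\<in>ext a. ext (r b))"
    by (rule rdg[of v0 c0 zero ?F]) blast
  have "fval (den E v0 ?F) (ext a) = ext (pw a)" for a
    by (subst fval_cmpt_cvv) auto
  then have r_suc: "r (suc a) = pw (r a)" if "a \<in> On" for a
    using r(3)[OF that] by (simp only: ext_eq_iff)
  let ?x = "fr (cvars ?R) 0" and ?y = "fr (cvars ?R) 1"
  have xy: "?x \<notin> cvars ?R" "?y \<notin> cvars ?R" by (simp_all add: fr_avoid)
  have trans: "\<forall>b\<in>ext (r a). ext b \<subseteq> ext (r a)" if "a \<in> On" for a
    using that
  proof (rule On_induct)
    show "(\<forall>b\<in>ext (r a). ext b \<subseteq> ext (r a)) \<longleftrightarrow> a \<in> den E v0 (cab ?x (wtr (cfv ?R (cv ?x))))"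
      if "a \<in> On" for a using xy r(1)[OF that] by simp
    fix a assume a: "a \<in> On" and IH: "\<And>b. b \<in> ext a \<Longrightarrow> \<forall>c\<in>ext (r b). ext c \<subseteq> ext (r b)"
    show "\<forall>b\<in>ext (r a). ext b \<subseteq> ext (r a)" using a
    proof (cases rule: On_cases)
      case 1
      then show ?thesis using r(2) by simp
    next
      case (2 b)
      then have "\<forall>c\<in>ext (r b). ext c \<subseteq> ext (r b)" using IH[of b] by simp
      then show ?thesis using 2 r_suc by auto
    next
      case 3
      show ?thesis unfolding r(4)[OF 3] using IH by blast
    qed
  qed
  have mono: "\<forall>b\<in>ext a. ext (r b) \<subseteq> ext (r a)" if "a \<in> On" for a
    using that
  proof (rule On_induct)
    show "(\<forall>b\<in>ext a. ext (r b) \<subseteq> ext (r a)) \<longleftrightarrow>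
      a \<in> den E v0 (cab ?x (wral ?y (cv ?x) (cfv ?R (cv ?y) \<^bold>\<subseteq> cfv ?R (cv ?x))))" if "a \<in> On" for a
      using xy r(1)[OF that] r(1)[OF On_mem[OF that]] by auto
    fix a assume a: "a \<in> On" and IH: "\<And>b. b \<in> ext a \<Longrightarrow> \<forall>c\<in>ext b. ext (r c) \<subseteq> ext (r b)"
    have "ext (r b) \<subseteq> ext (r a)" if b: "b \<in> ext a" for b using a
    proof (cases rule: On_cases)
      case 1
      then show ?thesis using b by simp
    next
      case (2 c)
      have "ext (r b) \<subseteq> ext (r c)" using IH[of c] b 2 by auto
      also have "\<dots> \<subseteq> ext (pw (r c))" using trans 2 by auto
      finally show ?thesis using 2 r_suc by simp
    next
      case 3
      show ?thesis unfolding r(4)[OF 3] using b by blast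
    qed
    then show "\<forall>b\<in>ext a. ext (r b) \<subseteq> ext (r a)" by blast
  qed
  \<comment> \<open>Each ordinal is included in its level of the hierarchy; since \<omega> belongs
    to the index, it belongs to V.\<close>
  have sub: "ext a \<subseteq> ext (r a)" if "a \<in> On" for a
    using that
  proof (rule On_induct)
    show "ext a \<subseteq> ext (r a) \<longleftrightarrow> a \<in> den E v0 (cab ?x (cv ?x \<^bold>\<subseteq> cfv ?R (cv ?x)))" if "a \<in> On" for a
      using xy r(1)[OF that] by simp
    fix a assume a: "a \<in> On" and IH: "\<And>b. b \<in> ext a \<Longrightarrow> ext b \<subseteq> ext (r b)"
    show "ext a \<subseteq> ext (r a)" using a
    proof (cases rule: On_cases)
      case 1
      then show ?thesis by simp
    next
      case (2 b)
      then have b: "ext b \<subseteq> ext (r b)" using IH by simp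
      have "ext (r b) \<subseteq> ext (r a)" using mono[OF a] 2 by simp
      moreover have "b \<in> ext (r a)" using b 2 r_suc by simp
      ultimately show ?thesis using b 2 by auto
    next
      case 3
      show ?thesis
      proof
        fix b assume "b \<in> ext a"
        then have "suc b \<in> ext a" using Limc_suc 3 by blast
        moreover have "b \<in> ext (suc b)" by simp
        ultimately show "b \<in> ext (r a)" unfolding r(4)[OF 3] using IH by blast
      qed
    qed
  qed
  let ?V = "r l"
  have V: "ext ?V = (\<Union>b\<in>ext l. ext (r b))" by (rule r(4)[OF l(2)])
  have tr: "b \<in> ext ?V" if "a \<in> ext ?V" "b \<in> ext a" for a b using trans[OF lOn] that by blast
  have pow: "pw a \<in> ext ?V" if a: "a \<in> ext ?V" for a
  proof -
    obtain b where b: "b \<in> ext l" "a \<in> ext (r b)" using a[unfolded V] by blast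
    have bOn: "b \<in> On" using b lOn On_mem by blast
    have "ext a \<subseteq> ext (r b)" using trans[OF bOn] b by blast
    \<comment> \<open>Subsets of a are subsets of level b, hence members of level b + 1, which puts
      the power set into level b + 2.\<close>
    then have "pw a \<in> ext (r (suc (suc b)))" using r_suc bOn suc_On by auto
    moreover have "suc (suc b) \<in> ext l" using Limc_suc[OF l(2)] b(1) by blast
    ultimately show ?thesis unfolding V by blast
  qed
  have un: "\<exists>u\<in>ext ?V. ext a \<union> ext b \<subseteq> ext u" if ab: "a \<in> ext ?V" "b \<in> ext ?V" for a b
  proof -
    have "\<exists>c\<in>ext l. a \<in> ext (r c) \<and> b \<in> ext (r c)"
    proof -
      obtain c d where cd: "c \<in> ext l" "a \<in> ext (r c)" "d \<in> ext l" "b \<in> ext (r d)" using ab[unfolded V] by blast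
      then have "c \<in> ext d \<or> c = d \<or> d \<in> ext c" using lOn On_trichotomy by blast
      then show ?thesis using cd mono lOn On_mem by blast
    qed
    then obtain c where c: "c \<in> ext l" "a \<in> ext (r c)" "b \<in> ext (r c)" by blast
    have cOn: "c \<in> On" using c lOn On_mem by blast
    have "r c \<in> ext (r (suc c))" using r_suc cOn by simp
    moreover have "suc c \<in> ext l" using Limc_suc[OF l(2)] c(1) by blast
    ultimately have "r c \<in> ext ?V" unfolding V by blast
    then show ?thesis using trans[OF cOn] c by blast
  qed
  have "den E v cVww = ext ?V" for v
  proof -
    have "den E v ?F = den E v0 ?F" by (simp add: den_cmpt)
    then have "den E v ?R = den E v0 ?R" by (rule den_crdg_cong) simp
    then show ?thesis using r(1)[OF lOn] l(1) by (simp add: cVww_def cr1_def Let_def)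
  qed
  moreover have "om \<in> ext ?V" using sub[OF lOn] l(3) by blast
  ultimately show ?thesis using that tr pow un by blast
qed

text \<open>\<open>cVww\<close> denotes the same set under every assignment, so any assignment
  serves.\<close>

definition V :: 'm
  where "V = cod (den E undefined cVww)"

lemma V_props: "den E v cVww = ext V" "om \<in> ext V"
    "\<And>a b. a \<in> ext V \<Longrightarrow> b \<in> ext a \<Longrightarrow> b \<in> ext V" "\<And>a. a \<in> ext V \<Longrightarrow> pw a \<in> ext V"
    "\<And>a b. a \<in> ext V \<Longrightarrow> b \<in> ext V \<Longrightarrow> \<exists>u\<in>ext V. ext a \<union> ext b \<subseteq> ext u"
proof -
  obtain W where W: "\<And>v. den E v cVww = ext W" "om \<in> ext W"
    "\<And>a b. a \<in> ext W \<Longrightarrow> b \<in> ext a \<Longrightarrow> b \<in> ext W" "\<And>a. a \<in> ext W \<Longrightarrow> pw a \<in> ext W"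
    "\<And>a b. a \<in> ext W \<Longrightarrow> b \<in> ext W \<Longrightarrow> \<exists>u\<in>ext W. ext a \<union> ext b \<subseteq> ext u" by (rule V_exists) blast
  have "V = W" by (simp add: V_def W(1))
  then show "den E v cVww = ext V" "om \<in> ext V"
    "\<And>a b. a \<in> ext V \<Longrightarrow> b \<in> ext a \<Longrightarrow> b \<in> ext V" "\<And>a. a \<in> ext V \<Longrightarrow> pw a \<in> ext V"
    "\<And>a b. a \<in> ext V \<Longrightarrow> b \<in> ext V \<Longrightarrow> \<exists>u\<in>ext V. ext a \<union> ext b \<subseteq> ext u" using W by simp_all
qed

declare V_props(1) [simp]

lemma V_subset: "a \<in> ext V \<Longrightarrow> ext b \<subseteq> ext a \<Longrightarrow> b \<in> ext V"
  using V_props(3)[OF V_props(4)] by simp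

lemma map_in_V:
  assumes "a \<in> ext V" "b \<in> ext V"
    "ext m = {f. Fn (ext f) (ext b) \<and> (\<forall>x y. opr x y \<in> ext f \<longrightarrow> y \<in> ext a)}"
  shows "m \<in> ext V"
proof -
  obtain u where u: "u \<in> ext V" "ext a \<union> ext b \<subseteq> ext u" using V_props(5) assms by blast
  then have "pw (pw (pw u)) \<in> ext V" using V_props(4) by blast
  moreover have "ext m \<subseteq> ext (pw (pw (pw u)))" using map_in_pw u(2) assms(3) by blast
  ultimately show ?thesis by (rule V_subset)
qed

section \<open>Choice\<close>

definition is_choice :: "'m \<Rightarrow> bool"
  where "is_choice c \<longleftrightarrow> Fn (ext c) (ext V) \<and> (\<forall>x\<in>ext V. x \<noteq> zero \<longrightarrow> ap c x \<in> ext x)"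

lemma sat_choice_fun [simp]: "sat E v (choice_fun e) \<longleftrightarrow> is_choice (v e)"
proof -
  have x: "fr {e} 0 \<notin> {e}" by (rule fr_avoid) simp
  have z: "ext a = {} \<longleftrightarrow> a = zero" for a by (metis ext_eq_iff ext_zero)
  show ?thesis using x by (auto simp: choice_fun_def Let_def is_choice_def z)
qed

text \<open>ax-ac provides no function but a set y from which one member of each nonempty w in V can
  be read off. Replacement turns this selection into a function on all of V, with the default zero
  at the empty set.\<close>

lemma choice_exists: "\<exists>c. is_choice c"
proof -
  let ?x = "Aux 0" and ?y = "Aux 1" and ?z = "Aux 2" and ?w = "Aux 3" and ?v = "Aux 4" and ?u = "Aux 5" and ?t = "Aux 6"
  let ?R = "\<lambda>y w u. \<exists>t. u \<in> ext w \<and> w \<in> ext t \<and> u \<in> ext t \<and> t \<in> ext y"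
  from sound[OF ax_ac[of ?x ?y ?z ?w ?v ?u ?t], of "\<lambda>_. V"] obtain y where
    y: "\<And>z w. z \<in> ext w \<and> w \<in> ext V \<longrightarrow> (\<exists>v. \<forall>u. ?R y w u \<longleftrightarrow> u = v)" by auto
  \<comment> \<open>each nonempty \<open>w\<close> has exactly one member \<open>u\<close> such that \<open>w\<close> and \<open>u\<close> lie in a common member of \<open>y\<close>\<close>
  define g where "g w = (if w = zero then zero else (THE v. \<forall>u. ?R y w u \<longleftrightarrow> u = v))" for w
  have g: "?R y w u \<longleftrightarrow> u = g w" if w: "w \<in> ext V" "w \<noteq> zero" for w u
  proof -
    obtain z where "z \<in> ext w" using w(2) by (metis ext_eq_iff ext_zero ex_in_conv)
    then obtain v where v: "\<forall>u. ?R y w u \<longleftrightarrow> u = v" using y w by blast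
    then have "g w = v" using w by (auto simp: g_def)
    then show ?thesis using v by blast
  qed
  have z: "ext a = {} \<longleftrightarrow> a = zero" for a by (metis ext_eq_iff ext_zero)
  let ?\<phi> = "\<^bold>\<exists>?u\<^bold>. (cv ?v \<^bold>= cop (cv ?w) (cv ?u) \<^bold>\<and> ((cv ?w \<^bold>= c0 \<^bold>\<and> cv ?u \<^bold>= c0) \<^bold>\<or>
    (\<^bold>\<not> (cv ?w \<^bold>= c0) \<^bold>\<and> \<^bold>\<exists>?t\<^bold>. ((cv ?u \<^bold>\<in> cv ?w \<^bold>\<and> cv ?w \<^bold>\<in> cv ?t) \<^bold>\<and> (cv ?u \<^bold>\<in> cv ?t \<^bold>\<and> cv ?t \<^bold>\<in> cv ?y)))))"
  have s: "sat E ((\<lambda>_. y)(?w := w, ?v := p)) ?\<phi> \<longleftrightarrow> p = opr w (g w)" if w: "w \<in> ext V" for w p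
  proof -
    have "sat E ((\<lambda>_. y)(?w := w, ?v := p)) ?\<phi> \<longleftrightarrow>
      (\<exists>u. p = opr w u \<and> ((w = zero \<and> u = zero) \<or> (w \<noteq> zero \<and> ?R y w u)))"
      by (simp add: z conj_assoc)
    also have "\<dots> \<longleftrightarrow> p = opr w (g w)" 
    proof (cases "w = zero")
      case True
      then show ?thesis by (simp add: g_def)
    next
      case False
      show ?thesis by (simp only: g[OF w False]) (use False in simp)
    qed
    finally show ?thesis .
  qed
  then have "isset {p. \<exists>w\<in>ext V. sat E ((\<lambda>_. y)(?w := w, ?v := p)) ?\<phi>}"
    by (intro replacement) auto
  also have "{p. \<exists>w\<in>ext V. sat E ((\<lambda>_. y)(?w := w, ?v := p)) ?\<phi>} = gr (ext V) g"
    using s by (auto simp: gr_def simp del: sat_defined)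
  finally obtain c where c: "gr (ext V) g = ext c" by (rule issetE)
  have F: "Fn (ext c) (ext V)" by (simp flip: c)
  have "ap c w = g w" if "w \<in> ext V" for w using Fn_iff_ap[OF F that] that by (simp flip: c)
  moreover have "g w \<in> ext w" if "w \<in> ext V" "w \<noteq> zero" for w using g[OF that] by blast
  ultimately show ?thesis using F by (auto simp: is_choice_def)
qed

text \<open>The model satisfies the axiom of choice, which refutes the second alternative of
  \<open>Ch\<close>.\<close>

lemma sat_Ch [simp]: "sat E v (Ch e) \<longleftrightarrow> is_choice (v e)"
  using choice_exists by (auto simp: Ch_def Let_def)

end

section \<open>Types of terms\<close>

text \<open>Annotations on vars make types unique, so inference is a function. The test on
  \<open>hfree\<close> keeps the definiens of every constant closed.\<close>

primrec tyof :: "tm \<Rightarrow> ty option"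
  where
    "tyof Tru = Some TBool"
  | "tyof (Ctx R S) = (if tyof R = Some TBool \<and> tyof S = Some TBool then Some TBool else None)"
  | "tyof (F \<cdot> A) = (case tyof F of Some (\<alpha> \<rightarrow>\<^sub>h \<beta>) \<Rightarrow> if tyof A = Some \<alpha> then Some \<beta> else None | _ \<Rightarrow> None)"
  | "tyof (Var x \<alpha>) = Some \<alpha>"
  | "tyof (Lam x \<alpha> A) = map_option (TFun \<alpha>) (tyof A)"
  | "tyof (Equal \<alpha>) = Some (\<alpha> \<rightarrow>\<^sub>h \<alpha> \<rightarrow>\<^sub>h TBool)"
  | "tyof (Eps \<alpha>) = Some ((\<alpha> \<rightarrow>\<^sub>h TBool) \<rightarrow>\<^sub>h \<alpha>)"
  | "tyof (Const D) = (if hfree D = {} then tyof D else None)"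

lemma tyof_app: "tyof (F \<cdot> A) = Some \<beta> \<longleftrightarrow> (\<exists>\<alpha>. tyof F = Some (\<alpha> \<rightarrow>\<^sub>h \<beta>) \<and> tyof A = Some \<alpha>)"
  by (auto split: option.splits ty.splits)

lemma tyof_heq [simp]:
  "tyof (heq \<alpha> A B) = Some \<gamma> \<longleftrightarrow> \<gamma> = TBool \<and> tyof A = Some \<alpha> \<and> tyof B = Some \<alpha>"
  by (auto simp: tyof_app simp del: tyof.simps(3))

lemma tyof_logic [simp]:
  "tyof (hal \<alpha>) = Some ((\<alpha> \<rightarrow>\<^sub>h TBool) \<rightarrow>\<^sub>h TBool)"
  "tyof hfal = Some TBool"
  "tyof han = Some (TBool \<rightarrow>\<^sub>h TBool \<rightarrow>\<^sub>h TBool)"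
  "tyof him = Some (TBool \<rightarrow>\<^sub>h TBool \<rightarrow>\<^sub>h TBool)"
  "tyof hnot = Some (TBool \<rightarrow>\<^sub>h TBool)"
  "tyof (hex \<alpha>) = Some ((\<alpha> \<rightarrow>\<^sub>h TBool) \<rightarrow>\<^sub>h TBool)"
  "tyof (hinj \<alpha> \<beta>) = Some ((\<alpha> \<rightarrow>\<^sub>h \<beta>) \<rightarrow>\<^sub>h TBool)"
  "tyof (hsurj \<alpha> \<beta>) = Some ((\<alpha> \<rightarrow>\<^sub>h \<beta>) \<rightarrow>\<^sub>h TBool)"
proof -
  show al: "tyof (hal \<alpha>) = Some ((\<alpha> \<rightarrow>\<^sub>h TBool) \<rightarrow>\<^sub>h TBool)" for \<alpha> by (auto simp: hal_def)
  show fal: "tyof hfal = Some TBool" by (simp add: hfal_def al) (auto simp: hal_def)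
  show an: "tyof han = Some (TBool \<rightarrow>\<^sub>h TBool \<rightarrow>\<^sub>h TBool)" by (auto simp: han_def Let_def)
  show im: "tyof him = Some (TBool \<rightarrow>\<^sub>h TBool \<rightarrow>\<^sub>h TBool)"
    by (simp add: him_def an) (auto simp: han_def)
  show "tyof hnot = Some (TBool \<rightarrow>\<^sub>h TBool)"
    by (simp add: hnot_def im fal) (auto simp: him_def hfal_def)
  show ex: "tyof (hex \<alpha>) = Some ((\<alpha> \<rightarrow>\<^sub>h TBool) \<rightarrow>\<^sub>h TBool)"
    by (simp add: hex_def im al) (auto simp: him_def hal_def)
  show "tyof (hinj \<alpha> \<beta>) = Some ((\<alpha> \<rightarrow>\<^sub>h \<beta>) \<rightarrow>\<^sub>h TBool)"
    by (simp add: hinj_def Let_def im al) (auto simp: him_def hal_def)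
  show "tyof (hsurj \<alpha> \<beta>) = Some ((\<alpha> \<rightarrow>\<^sub>h \<beta>) \<rightarrow>\<^sub>h TBool)"
    by (simp add: hsurj_def Let_def ex al) (auto simp: hex_def hal_def)
qed

primrec typed :: "judgement \<Rightarrow> bool"
  where
    "typed (IsType \<alpha>) = True"
  | "typed (A :\<^sub>h \<alpha>) = (tyof A = Some \<alpha>)"
  | "typed (A \<turnstile>\<^sub>h B) = (tyof A = Some TBool \<and> tyof B = Some TBool)"
  | "typed (TypeDef \<alpha> \<beta> A R F B) = True"

text \<open>Rules need not state the types of all their terms, for example of G and B in
  \<open>ceq\<close>; these are recovered from the typing of the premises. Soundness relies on them,
  as typed terms are the ones known to denote elements.\<close>

lemma holmm_typed: "holmm J \<Longrightarrow> typed J"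
proof (induction rule: holmm.induct)
  case (wct R S)
  then show ?case by simp
qed (auto split: if_splits)

lemma hfree_hvars: "(x, \<gamma>) \<in> hfree A \<Longrightarrow> x \<in> hvars A"
  by (induction A) auto

lemma hfree_tvars: "(x, \<gamma>) \<in> hfree A \<Longrightarrow> ty_tvars \<gamma> \<subseteq> tvars A"
  by (induction A) auto

context set_model
begin

section \<open>The model of types\<close>

lemma den_toBool [simp]: "den E v (toBool \<phi>) = (if sat E v \<phi> then ext one else {})"
  by (simp add: toBool_def)

lemma sat_toWff [simp]: "sat E v (toWff A) \<longleftrightarrow> den E v A = ext one"
  by (simp add: toWff_def)

lemma den_cType [simp]: "den E v cType = {opr i b | i b. b \<in> ext V \<and> i \<in> ext b}"
  by (auto simp: cType_def Let_def)

definition tyok :: "(svar \<Rightarrow> 'm) \<Rightarrow> bool"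
  where "tyok v \<longleftrightarrow> (\<forall>a. v (HolTyp a) \<in> {opr i b | i b. b \<in> ext V \<and> i \<in> ext b})"

lemma den_S_ty_cong:
  "(\<And>a. a \<in> ty_tvars \<alpha> \<Longrightarrow> v (HolTyp a) = w (HolTyp a)) \<Longrightarrow> den E v (S_ty \<alpha>) = den E w (S_ty \<alpha>)"
proof (induction \<alpha> arbitrary: v w)
  case (TFun \<alpha> \<beta>)
  let ?x = "fr (cvars (S_ty \<alpha>) \<union> cvars (S_ty \<beta>)) 0"
  have 1: "den E v (S_ty \<alpha>) = den E w (S_ty \<alpha>)" "den E v (S_ty \<beta>) = den E w (S_ty \<beta>)"
    "den E (v(?x := a)) (S_ty \<alpha>) = den E w (S_ty \<alpha>)" "den E (v(?x := a)) (S_ty \<beta>) = den E w (S_ty \<beta>)"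
    "den E (w(?x := a)) (S_ty \<alpha>) = den E w (S_ty \<alpha>)" "den E (w(?x := a)) (S_ty \<beta>) = den E w (S_ty \<beta>)" for a
    by (rule TFun.IH; use TFun.prems in simp)+
  have "den E v (cmpt ?x (c2nd (S_ty \<alpha>)) (c1st (S_ty \<beta>))) = den E w (cmpt ?x (c2nd (S_ty \<alpha>)) (c1st (S_ty \<beta>)))"
    "den E v (cmap (c2nd (S_ty \<beta>)) (c2nd (S_ty \<alpha>))) = den E w (cmap (c2nd (S_ty \<beta>)) (c2nd (S_ty \<alpha>)))"
    by (simp_all add: den_cmpt c1st_def c2nd_def 1)
  then show ?case by (simp only: S_ty.simps Let_def den_cop)
qed simp_all

lemma den_base_cong:
  assumes "\<And>a. a \<in> ty_tvars \<alpha> \<Longrightarrow> v (HolTyp a) = w (HolTyp a)"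
  shows "den E v (base \<alpha>) = den E w (base \<alpha>)" "den E v (wit \<alpha>) = den E w (wit \<alpha>)"
proof -
  have "den E v (S_ty \<alpha>) = den E w (S_ty \<alpha>)" by (rule den_S_ty_cong) (rule assms)
  then show "den E v (base \<alpha>) = den E w (base \<alpha>)" "den E v (wit \<alpha>) = den E w (wit \<alpha>)"
    by (simp_all add: base_def wit_def c1st_def c2nd_def)
qed

lemma den_base_upd [simp]:
  "den E (v(HolVar x := a)) (base \<alpha>) = den E v (base \<alpha>)" "den E (v(HolVar x := a)) (wit \<alpha>) = den E v (wit \<alpha>)"
  "den E (v(fr X n := a)) (base \<alpha>) = den E v (base \<alpha>)" "den E (v(fr X n := a)) (wit \<alpha>) = den E v (wit \<alpha>)"
  "den E (v(Aux n := a)) (base \<alpha>) = den E v (base \<alpha>)" "den E (v(Aux n := a)) (wit \<alpha>) = den E v (wit \<alpha>)"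
  by (rule den_base_cong; simp)+

definition B :: "(svar \<Rightarrow> 'm) \<Rightarrow> ty \<Rightarrow> 'm"
  where "B v \<alpha> = cod (den E v (base \<alpha>))"

definition W :: "(svar \<Rightarrow> 'm) \<Rightarrow> ty \<Rightarrow> 'm"
  where "W v \<alpha> = cod (den E v (wit \<alpha>))"

definition two :: 'm where "two = cod {zero, one}"

lemma ext_two [simp]: "ext two = {zero, one}"
  by (simp add: two_def)

lemma two_in_V: "two \<in> ext V"
proof -
  have "suc zero = one" by (simp add: suc_def)
  then have "ext two \<subseteq> ext om" using zero_om suc_om[OF zero_om] by simp
  then show ?thesis using V_props(2) V_subset by blast
qed

definition maps :: "'m \<Rightarrow> 'm \<Rightarrow> 'm"
  where "maps a b = cod {f. Fn (ext f) (ext a) \<and> (\<forall>x y. opr x y \<in> ext f \<longrightarrow> y \<in> ext b)}"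

lemma ext_maps: "ext (maps a b) = {f. Fn (ext f) (ext a) \<and> (\<forall>x y. opr x y \<in> ext f \<longrightarrow> y \<in> ext b)}"
  unfolding maps_def by (rule ext_cod[OF map_isset])

lemma in_maps: "f \<in> ext (maps a b) \<longleftrightarrow> Fn (ext f) (ext a) \<and> (\<forall>x\<in>ext a. ap f x \<in> ext b)"
proof (cases "Fn (ext f) (ext a)")
  case True
  have "(\<forall>x y. opr x y \<in> ext f \<longrightarrow> y \<in> ext b) \<longleftrightarrow> (\<forall>x\<in>ext a. ap f x \<in> ext b)"
    using True Fn_iff_ap[OF True] by (subst Fn_eq_gr[OF True]) auto
  then show ?thesis using True by (simp add: ext_maps)
qed (simp add: ext_maps)

lemma ap_in [intro]: "f \<in> ext (maps a b) \<Longrightarrow> x \<in> ext a \<Longrightarrow> ap f x \<in> ext b"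
  by (simp add: in_maps)

lemma maps_ext: "f \<in> ext (maps a b) \<Longrightarrow> g \<in> ext (maps a b) \<Longrightarrow> f = g \<longleftrightarrow> (\<forall>x\<in>ext a. ap f x = ap g x)"
  using Fn_ext by (auto simp: in_maps)

lemma gr_in_maps:
  assumes "ext f = gr (ext a) g" "\<And>x. x \<in> ext a \<Longrightarrow> g x \<in> ext b"
  shows "f \<in> ext (maps a b)" and "\<And>x. x \<in> ext a \<Longrightarrow> ap f x = g x"
proof -
  have F: "Fn (ext f) (ext a)" by (simp add: assms(1))
  show "ap f x = g x" if "x \<in> ext a" for x using Fn_iff_ap[OF F that, of "g x"] that assms(1) by simp
  then show "f \<in> ext (maps a b)" using F assms(2) by (simp add: in_maps)
qed

text \<open>V bounds the base sets of function types by \<open>map_in_V\<close>. Their witnesses are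
  constant functions, which must be shown to be sets because a pair with a proper class denotes the
  empty set.\<close>

lemma den_S_ty:
  assumes "tyok v"
  shows "\<exists>i b. den E v (S_ty \<alpha>) = ext (opr i b) \<and> b \<in> ext V \<and> i \<in> ext b"
  and "\<alpha> = \<beta> \<rightarrow>\<^sub>h \<gamma> \<Longrightarrow> den E v (base \<alpha>) = ext (maps (B v \<beta>) (B v \<gamma>))"
proof -
  have *: "den E v (S_ty (\<alpha> \<rightarrow>\<^sub>h \<beta>)) = ext (opr (cod (gr (ext b) (\<lambda>_. j))) (maps b c))
      \<and> maps b c \<in> ext V \<and> cod (gr (ext b) (\<lambda>_. j)) \<in> ext (maps b c)"
    if a: "den E v (S_ty \<alpha>) = ext (opr i b)" "b \<in> ext V" "den E v (S_ty \<beta>) = ext (opr j c)"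
      "c \<in> ext V" "j \<in> ext c" for \<alpha> \<beta> i j b c
  proof -
    let ?x = "fr (cvars (S_ty \<alpha>) \<union> cvars (S_ty \<beta>)) 0"
    have x: "?x \<notin> cvars (S_ty \<alpha>) \<union> cvars (S_ty \<beta>)" by (rule fr_avoid) simp
    have s: "den E (v(?x := d)) (S_ty \<alpha>) = ext (opr i b)" "den E (v(?x := d)) (S_ty \<beta>) = ext (opr j c)" for d
      using a x by simp_all
    have g: "isset (gr (ext b) (\<lambda>_. j))"
      by (rule gr_isset[of b v ?x "c1st (S_ty \<beta>)"]) (rule den_c1st[OF s(2)])
    have 1: "den E v (cmpt ?x (c2nd (S_ty \<alpha>)) (c1st (S_ty \<beta>))) = gr (ext b) (\<lambda>_. j)"
      by (simp add: den_cmpt_gr den_c2nd[OF s(1)] den_c2nd[OF a(1)] den_c1st[OF s(2)])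
    have 2: "den E v (cmap (c2nd (S_ty \<beta>)) (c2nd (S_ty \<alpha>))) = ext (maps b c)"
      by (simp add: den_c2nd[OF a(1)] den_c2nd[OF a(3)] ext_maps)
    have "den E v (S_ty (\<alpha> \<rightarrow>\<^sub>h \<beta>)) = ext (opr (cod (gr (ext b) (\<lambda>_. j))) (maps b c))"
      by (simp only: S_ty.simps Let_def den_cop 1 2 g isset_ext cod_ext simp_thms if_True)
    moreover have "maps b c \<in> ext V" by (rule map_in_V[OF a(4,2) ext_maps])
    moreover have "cod (gr (ext b) (\<lambda>_. j)) \<in> ext (maps b c)"
      by (rule gr_in_maps(1)[of _ _ "\<lambda>_. j"]) (use g a in auto)
    ultimately show ?thesis by blast
  qed
  have all: "\<exists>i b. den E v (S_ty \<alpha>) = ext (opr i b) \<and> b \<in> ext V \<and> i \<in> ext b" for \<alpha>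
  proof (induction \<alpha>)
    case (TVar a)
    then show ?case using assms by (auto simp: tyok_def)
  next
    case TBool
    have "den E v (S_ty TBool) = ext (opr one two)" by (simp add: two_def)
    then show ?case using two_in_V by fastforce
  next
    case TInd
    have "den E v (S_ty TInd) = ext (opr zero om)" by simp
    then show ?case using V_props(2) zero_om by blast
  next
    case (TFun \<alpha> \<beta>)
    then obtain i b j c where "den E v (S_ty \<alpha>) = ext (opr i b)" "b \<in> ext V" "den E v (S_ty \<beta>) = ext (opr j c)"
      "c \<in> ext V" "j \<in> ext c" by blast
    from *[OF this] show ?case by blast
  qed
  then show "\<exists>i b. den E v (S_ty \<alpha>) = ext (opr i b) \<and> b \<in> ext V \<and> i \<in> ext b" .
  assume \<alpha>: "\<alpha> = \<beta> \<rightarrow>\<^sub>h \<gamma>"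
  obtain i b where b: "den E v (S_ty \<beta>) = ext (opr i b)" "b \<in> ext V" using all by blast
  obtain j c where c: "den E v (S_ty \<gamma>) = ext (opr j c)" "c \<in> ext V" "j \<in> ext c" using all by blast
  have "den E v (base \<alpha>) = ext (maps b c)"
    unfolding base_def \<alpha> by (rule den_c2nd) (use *[OF b c] in blast)
  moreover have "B v \<beta> = b" "B v \<gamma> = c"
    by (simp_all add: B_def base_def den_c2nd[OF b(1)] den_c2nd[OF c(1)])
  ultimately show "den E v (base \<alpha>) = ext (maps (B v \<beta>) (B v \<gamma>))" by simp
qed

lemma B_props:
  assumes "tyok v"
  shows "den E v (base \<alpha>) = ext (B v \<alpha>)" "den E v (wit \<alpha>) = ext (W v \<alpha>)"
    "W v \<alpha> \<in> ext (B v \<alpha>)" "B v \<alpha> \<in> ext V"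
    "B v (\<beta> \<rightarrow>\<^sub>h \<gamma>) = maps (B v \<beta>) (B v \<gamma>)" "B v TBool = two" "B v TInd = om"
proof -
  obtain i b where b: "den E v (S_ty \<alpha>) = ext (opr i b)" "b \<in> ext V" "i \<in> ext b" using den_S_ty(1)[OF assms] by blast
  show 1: "den E v (base \<alpha>) = ext (B v \<alpha>)" "den E v (wit \<alpha>) = ext (W v \<alpha>)"
    by (simp_all add: B_def W_def base_def wit_def den_c1st[OF b(1)] den_c2nd[OF b(1)])
  show "W v \<alpha> \<in> ext (B v \<alpha>)" "B v \<alpha> \<in> ext V"
    using b by (simp_all add: B_def W_def base_def wit_def den_c1st[OF b(1)] den_c2nd[OF b(1)])
  show "B v (\<beta> \<rightarrow>\<^sub>h \<gamma>) = maps (B v \<beta>) (B v \<gamma>)" using den_S_ty(2)[OF assms HOL.refl] by (simp add: B_def)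
  have "den E v (S_ty TBool) = ext (opr one two)" "den E v (S_ty TInd) = ext (opr zero om)" by (simp_all add: two_def)
  then show "B v TBool = two" "B v TInd = om" by (simp_all add: B_def base_def den_c2nd)
qed

end

section \<open>The model of terms\<close>

text \<open>The condition concerns the readings of free variable terms rather than the values of
  vars: two values outside a base set both read as the witness. Typing enters at constants, whose
  definiens must be closed.\<close>

lemma (in set_model) den_S_tm_cong:
  assumes "tyof A \<noteq> None" "\<And>a. a \<in> tvars A \<Longrightarrow> v (HolTyp a) = w (HolTyp a)"
    "eps_free A \<or> v (Aux n) = w (Aux n)"
    "\<And>x \<gamma>. (x, \<gamma>) \<in> hfree A \<Longrightarrow> den E v (S_tm (Aux n) (Var x \<gamma>)) = den E w (S_tm (Aux n) (Var x \<gamma>))"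
  shows "den E v (S_tm (Aux n) A) = den E w (S_tm (Aux n) A)"
  using assms
proof (induction A arbitrary: v w)
  case (Ctx R S)
  have "den E v (S_tm (Aux n) R) = den E w (S_tm (Aux n) R)"
    by (rule Ctx.IH(1)) (use Ctx.prems in \<open>auto split: if_splits\<close>)
  moreover have "den E v (S_tm (Aux n) S) = den E w (S_tm (Aux n) S)"
    by (rule Ctx.IH(2)) (use Ctx.prems in \<open>auto split: if_splits\<close>)
  ultimately show ?case by simp
next
  case (App F A)
  have t: "tyof F \<noteq> None" "tyof A \<noteq> None" using App.prems(1) by (auto split: option.splits ty.splits if_splits)
  have "den E v (S_tm (Aux n) F) = den E w (S_tm (Aux n) F)"
    by (rule App.IH(1)[OF t(1)]) (use App.prems(2-) in auto)
  moreover have "den E v (S_tm (Aux n) A) = den E w (S_tm (Aux n) A)"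
    by (rule App.IH(2)[OF t(2)]) (use App.prems(2-) in auto)
  ultimately show ?case by simp
next
  case (Var x \<alpha>)
  show ?case by (rule Var.prems(4)) simp
next
  case (Lam x \<alpha> T)
  let ?v = "\<lambda>a. v(HolVar x := a)" and ?w = "\<lambda>a. w(HolVar x := a)"
  have b: "den E v (base \<gamma>) = den E w (base \<gamma>)" "den E v (wit \<gamma>) = den E w (wit \<gamma>)"
    if "ty_tvars \<gamma> \<subseteq> tvars (Lam x \<alpha> T)" for \<gamma>
    by (rule den_base_cong; use Lam.prems(2) that in blast)+
  have "den E (?v a) (S_tm (Aux n) T) = den E (?w a) (S_tm (Aux n) T)" for a
  proof (rule Lam.IH)
    fix y \<gamma> assume y: "(y, \<gamma>) \<in> hfree T"
    have "ty_tvars \<gamma> \<subseteq> tvars (Lam x \<alpha> T)" using hfree_tvars[OF y] by auto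
    note b = b[OF this]
    show "den E (?v a) (S_tm (Aux n) (Var y \<gamma>)) = den E (?w a) (S_tm (Aux n) (Var y \<gamma>))"
    proof (cases "y = x")
      case True
      then show ?thesis using b by simp
    next
      case False
      then have "(y, \<gamma>) \<in> hfree (Lam x \<alpha> T)" using y by simp
      from Lam.prems(4)[OF this] False show ?thesis by (simp cong: if_cong)
    qed
  qed (use Lam.prems in auto)
  moreover have "den E v (base \<alpha>) = den E w (base \<alpha>)" by (rule b) simp
  ultimately show ?case by (simp add: den_cmpt)
next
  case (Equal \<alpha>)
  have "den E v (base \<alpha>) = den E w (base \<alpha>)" by (rule den_base_cong) (use Equal in simp)
  then show ?case by (simp add: den_cmpt Let_def)
next
  case (Eps \<alpha>)
  let ?X = "{Aux n} \<union> cvars (base \<alpha>) \<union> cvars (wit \<alpha>)"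
  have f: "fr ?X k \<notin> ?X" for k by (rule fr_avoid) simp
  have "den E v (base \<alpha>) = den E w (base \<alpha>)" "den E v (wit \<alpha>) = den E w (wit \<alpha>)"
    by (rule den_base_cong; use Eps in simp)+
  moreover have "v (Aux n) = w (Aux n)" using Eps by simp
  moreover have "Aux n \<noteq> fr ?X k" for k using f[of k] by auto
  ultimately show ?case by (simp add: den_cmpt Let_def)
next
  case (Const D)
  have "hfree D = {}" "tyof D \<noteq> None" using Const.prems(1) by (auto split: if_splits)
  then have "den E v (S_tm (Aux n) D) = den E w (S_tm (Aux n) D)"
    using Const.prems by (intro Const.IH) auto
  then show ?case by simp
qed simp

lemma (in set_model) cmpt_ex:
  assumes "den E v A = ext m" "\<And>a. den E (v(x := a)) A = ext m"
    "\<And>a. a \<in> ext m \<Longrightarrow> den E (v(x := a)) T = ext (g a)"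
  shows "\<exists>f. den E v (cmpt x A T) = ext f \<and> Fn (ext f) (ext m) \<and> (\<forall>a\<in>ext m. ap f a = g a)"
proof -
  have "isset (gr (ext m) g)" using assms(3) by (rule gr_isset)
  then obtain f where f: "gr (ext m) g = ext f" by (rule issetE)
  have "den E v (cmpt x A T) = ext f" using den_cmpt_gr[of v x A T g] assms f by simp
  moreover have F: "Fn (ext f) (ext m)" by (simp flip: f)
  moreover have "ap f a = g a" if "a \<in> ext m" for a using Fn_iff_ap[OF F that, of "g a"] that by (simp flip: f)
  ultimately show ?thesis by blast
qed

lemma (in set_model) ext_eq_bool [simp]: "ext a = {} \<longleftrightarrow> a = zero" "ext a = {zero} \<longleftrightarrow> a = one"
  by (metis ext_eq_iff ext_zero, metis ext_eq_iff ext_one)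

section \<open>Values of typed terms\<close>

locale hol_model = set_model E for E :: "'m \<Rightarrow> 'm \<Rightarrow> bool" +
  fixes n :: nat and v0 :: "svar \<Rightarrow> 'm"
  assumes tyok: "tyok v0" and choice: "is_choice (v0 (Aux n))"
begin

abbreviation e :: svar where "e \<equiv> Aux n"

text \<open>Types and descriptor are held fixed, whereas vars take arbitrary values, even outside
  the base sets.\<close>

definition ok :: "(svar \<Rightarrow> 'm) \<Rightarrow> bool"
  where "ok v \<longleftrightarrow> (\<forall>a. v (HolTyp a) = v0 (HolTyp a)) \<and> v e = v0 e"

lemma ok_upd [simp]: "ok (v(HolVar x := a)) \<longleftrightarrow> ok v"
  by (simp add: ok_def)

definition D :: "ty \<Rightarrow> 'm set"
  where "D \<alpha> = ext (B v0 \<alpha>)"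

lemma D_bool: "D TBool = {zero, one}"
  by (simp add: D_def B_props(6)[OF tyok])

lemma D_bool_mem [simp]: "zero \<in> D TBool" "one \<in> D TBool"
  by (simp_all add: D_bool)

lemma D_ind: "D TInd = ext om"
  by (simp add: D_def B_props(7)[OF tyok])

lemma D_fun: "f \<in> D (\<alpha> \<rightarrow>\<^sub>h \<beta>) \<longleftrightarrow> Fn (ext f) (D \<alpha>) \<and> (\<forall>a\<in>D \<alpha>. ap f a \<in> D \<beta>)"
  by (simp add: D_def B_props(5)[OF tyok] in_maps)

lemma D_ap: "f \<in> D (\<alpha> \<rightarrow>\<^sub>h \<beta>) \<Longrightarrow> a \<in> D \<alpha> \<Longrightarrow> ap f a \<in> D \<beta>"
  by (simp add: D_fun)

lemma D_ext: "f \<in> D (\<alpha> \<rightarrow>\<^sub>h \<beta>) \<Longrightarrow> g \<in> D (\<alpha> \<rightarrow>\<^sub>h \<beta>) \<Longrightarrow> f = g \<longleftrightarrow> (\<forall>a\<in>D \<alpha>. ap f a = ap g a)"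
  using maps_ext by (simp add: D_def B_props(5)[OF tyok])

lemma den_base:
  assumes "ok v"
  shows "den E v (base \<alpha>) = D \<alpha>" "den E v (wit \<alpha>) = ext (W v0 \<alpha>)"
proof -
  have "den E v (base \<alpha>) = den E v0 (base \<alpha>)" "den E v (wit \<alpha>) = den E v0 (wit \<alpha>)"
    by (rule den_base_cong; use assms in \<open>simp add: ok_def\<close>)+
  then show "den E v (base \<alpha>) = D \<alpha>" "den E v (wit \<alpha>) = ext (W v0 \<alpha>)"
    using B_props(1,2)[OF tyok] by (simp_all add: D_def)
qed

lemma wit_in_D [simp]: "W v0 \<alpha> \<in> D \<alpha>"
  using B_props(3)[OF tyok] by (simp add: D_def)

definition bl :: "bool \<Rightarrow> 'm"
  where "bl P = (if P then one else zero)"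

lemma bl_simps [simp]: "bl P = one \<longleftrightarrow> P" "bl P = zero \<longleftrightarrow> \<not> P" "bl P \<in> D TBool" "bl P = bl Q \<longleftrightarrow> (P \<longleftrightarrow> Q)"
  "one = bl P \<longleftrightarrow> P"
  by (auto simp: bl_def)

lemma den_toBool_bl: "den E v (toBool \<phi>) = ext (bl (sat E v \<phi>))"
  by (simp add: bl_def)

lemma den_Equal:
  assumes "ok v"
  shows "\<exists>f\<in>D (\<alpha> \<rightarrow>\<^sub>h \<alpha> \<rightarrow>\<^sub>h TBool). den E v (S_tm e (Equal \<alpha>)) = ext f \<and>
    (\<forall>a\<in>D \<alpha>. \<forall>c\<in>D \<alpha>. ap (ap f a) c = bl (a = c))"
proof -
  let ?x = "fr (cvars (base \<alpha>)) 0" and ?y = "fr (cvars (base \<alpha>)) 1"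
  let ?T = "cmpt ?y (base \<alpha>) (toBool (cv ?x \<^bold>= cv ?y))"
  have b: "den E v (base \<alpha>) = ext (B v0 \<alpha>)" using den_base[OF assms] by (simp add: D_def)
  have inner: "\<exists>f. den E (v(?x := a)) ?T = ext f \<and> Fn (ext f) (D \<alpha>) \<and> (\<forall>c\<in>D \<alpha>. ap f c = bl (a = c))" for a
    unfolding D_def by (rule cmpt_ex) (use b in \<open>auto simp: bl_def\<close>)
  define g where "g a = cod (den E (v(?x := a)) ?T)" for a
  have g: "den E (v(?x := a)) ?T = ext (g a)" "Fn (ext (g a)) (D \<alpha>)" "\<And>c. c \<in> D \<alpha> \<Longrightarrow> ap (g a) c = bl (a = c)" for a
    using inner[of a] by (auto simp: g_def)
  have "\<exists>f. den E v (cmpt ?x (base \<alpha>) ?T) = ext f \<and> Fn (ext f) (D \<alpha>) \<and> (\<forall>a\<in>D \<alpha>. ap f a = g a)"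
    unfolding D_def by (rule cmpt_ex) (use b g(1) in \<open>simp_all\<close>)
  then obtain f where f: "den E v (cmpt ?x (base \<alpha>) ?T) = ext f" "Fn (ext f) (D \<alpha>)" "\<And>a. a \<in> D \<alpha> \<Longrightarrow> ap f a = g a" by blast
  have "f \<in> D (\<alpha> \<rightarrow>\<^sub>h \<alpha> \<rightarrow>\<^sub>h TBool)" using f g by (simp add: D_fun)
  then show ?thesis using f g by (intro bexI[of _ f]) (auto simp: Let_def)
qed

text \<open>Here the confinement of types to V matters: the elements satisfying p form a subset of a
  base set, hence an element of V, where the choice function is defined.\<close>

lemma den_Eps:
  assumes "ok v"
  shows "\<exists>f\<in>D ((\<alpha> \<rightarrow>\<^sub>h TBool) \<rightarrow>\<^sub>h \<alpha>). den E v (S_tm e (Eps \<alpha>)) = ext f \<and>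
    (\<forall>p\<in>D (\<alpha> \<rightarrow>\<^sub>h TBool). \<forall>x\<in>D \<alpha>. ap p x = one \<longrightarrow> ap p (ap f p) = one)"
proof -
  let ?X = "{e} \<union> cvars (base \<alpha>) \<union> cvars (wit \<alpha>)"
  let ?f = "fr ?X 0" and ?x = "fr ?X 1"
  have fr: "fr ?X k \<notin> ?X" for k by (rule fr_avoid) simp
  have e: "e \<noteq> fr ?X k" for k using fr[of k] by auto
  let ?T = "cif (\<^bold>\<forall>?x\<^bold>\<in>base \<alpha>\<^bold>. (cfv (cv ?f) (cv ?x) \<^bold>= c0)) (wit \<alpha>)
          (cfv (cv e) (crab ?x (base \<alpha>) (cfv (cv ?f) (cv ?x) \<^bold>= c1)))"
  have b: "den E v (base \<alpha>) = D \<alpha>" "den E v (wit \<alpha>) = ext (W v0 \<alpha>)" using den_base[OF assms] by auto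
  have T: "\<exists>m\<in>D \<alpha>. den E (v(?f := p)) ?T = ext m \<and> ((\<exists>x\<in>D \<alpha>. ap p x = one) \<longrightarrow> ap p m = one)"
    if p: "p \<in> D (\<alpha> \<rightarrow>\<^sub>h TBool)" for p
  proof (cases "\<forall>x\<in>D \<alpha>. ap p x = zero")
    case True
    then have "den E (v(?f := p)) ?T = ext (W v0 \<alpha>)" using e by (simp add: b)
    moreover have "\<not> (\<exists>x\<in>D \<alpha>. ap p x = one)" using True by auto
    ultimately show ?thesis by (intro bexI[of _ "W v0 \<alpha>"]) auto
  next
    case False
    have "isset {x \<in> D \<alpha>. ap p x = one}"
    proof (rule definable_subset)
      show "{x \<in> D \<alpha>. ap p x = one} = den E (v(?f := p)) (crab ?x (base \<alpha>) (cfv (cv ?f) (cv ?x) \<^bold>= c1))"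
        using b by auto
      show "{x \<in> D \<alpha>. ap p x = one} \<subseteq> ext (B v0 \<alpha>)" by (auto simp: D_def)
    qed
    then obtain d where d: "{x \<in> D \<alpha>. ap p x = one} = ext d" by (rule issetE)
    have "d \<in> ext V" by (rule V_subset[OF B_props(4)[OF tyok, of \<alpha>]]) (auto simp: D_def simp flip: d)
    moreover have "d \<noteq> zero"
    proof -
      obtain x where x: "x \<in> D \<alpha>" "ap p x \<noteq> zero" using False by blast
      then have "ap p x = one" using D_ap[OF p x(1)] by (simp add: D_bool)
      then have "x \<in> ext d" using x by (simp flip: d)
      then show ?thesis by auto
    qed
    ultimately have "ap (v0 e) d \<in> ext d" using choice by (simp add: is_choice_def)
    then have m: "ap (v0 e) d \<in> D \<alpha>" "ap p (ap (v0 e) d) = one" by (simp_all flip: d)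
    have "v e = v0 e" using assms by (simp add: ok_def)
    then have "den E (v(?f := p)) ?T = fval (ext (v0 e)) {x \<in> D \<alpha>. ap p x = one}"
      using False e by (auto simp: b)
    then show ?thesis using m by (auto simp: d)
  qed
  define g where "g p = cod (den E (v(?f := p)) ?T)" for p
  have g: "den E (v(?f := p)) ?T = ext (g p)" "g p \<in> D \<alpha>" "(\<exists>x\<in>D \<alpha>. ap p x = one) \<longrightarrow> ap p (g p) = one"
    if p: "p \<in> D (\<alpha> \<rightarrow>\<^sub>h TBool)" for p
  proof -
    obtain m where "m \<in> D \<alpha>" "den E (v(?f := p)) ?T = ext m" "(\<exists>x\<in>D \<alpha>. ap p x = one) \<longrightarrow> ap p m = one"
      using T[OF p] by blast
    moreover from this(2) have "g p = m" unfolding g_def by (simp only: cod_ext)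
    ultimately show "den E (v(?f := p)) ?T = ext (g p)" "g p \<in> D \<alpha>" "(\<exists>x\<in>D \<alpha>. ap p x = one) \<longrightarrow> ap p (g p) = one"
      by (simp_all only:)
  qed
  have c: "den E v (cmap c2 (base \<alpha>)) = D (\<alpha> \<rightarrow>\<^sub>h TBool)" "den E (v(?f := p)) (cmap c2 (base \<alpha>)) = D (\<alpha> \<rightarrow>\<^sub>h TBool)" for p
    by (simp_all add: b) (simp_all add: D_def B_props(5,6)[OF tyok] ext_maps)
  have "\<exists>f. den E v (cmpt ?f (cmap c2 (base \<alpha>)) ?T) = ext f \<and> Fn (ext f) (D (\<alpha> \<rightarrow>\<^sub>h TBool)) \<and>
      (\<forall>p\<in>D (\<alpha> \<rightarrow>\<^sub>h TBool). ap f p = g p)"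
    unfolding D_def
    by (rule cmpt_ex) (use c g(1) in \<open>simp_all only: D_def\<close>)
  then obtain f where f: "den E v (cmpt ?f (cmap c2 (base \<alpha>)) ?T) = ext f" "Fn (ext f) (D (\<alpha> \<rightarrow>\<^sub>h TBool))"
    "\<And>p. p \<in> D (\<alpha> \<rightarrow>\<^sub>h TBool) \<Longrightarrow> ap f p = g p" by blast
  have "f \<in> D ((\<alpha> \<rightarrow>\<^sub>h TBool) \<rightarrow>\<^sub>h \<alpha>)" using f(2,3) g(2) D_fun[of f "\<alpha> \<rightarrow>\<^sub>h TBool" \<alpha>] by simp
  moreover have "den E v (S_tm e (Eps \<alpha>)) = ext f" using f(1) by (simp only: S_tm.simps Let_def)
  moreover have "\<forall>p\<in>D (\<alpha> \<rightarrow>\<^sub>h TBool). \<forall>x\<in>D \<alpha>. ap p x = one \<longrightarrow> ap p (ap f p) = one"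
    using f(3) g(3) by auto
  ultimately show ?thesis by blast
qed

text \<open>For typed terms this is faithful to the denotation, by \<open>den_val\<close>.\<close>

definition val :: "(svar \<Rightarrow> 'm) \<Rightarrow> tm \<Rightarrow> 'm"
  where "val v A = cod (den E v (S_tm e A))"

lemma den_Lam:
  assumes v: "ok v" and T: "\<And>a. a \<in> D \<alpha> \<Longrightarrow> den E (v(HolVar x := a)) (S_tm e T) = ext (g a) \<and> g a \<in> D \<beta>"
  shows "\<exists>f\<in>D (\<alpha> \<rightarrow>\<^sub>h \<beta>). den E v (S_tm e (Lam x \<alpha> T)) = ext f \<and> (\<forall>a\<in>D \<alpha>. ap f a = g a)"
proof -
  have "\<exists>f. den E v (cmpt (HolVar x) (base \<alpha>) (S_tm e T)) = ext f \<and> Fn (ext f) (D \<alpha>) \<and> (\<forall>a\<in>D \<alpha>. ap f a = g a)"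
    unfolding D_def by (rule cmpt_ex) (use den_base[OF v] T in \<open>simp_all add: D_def\<close>)
  then obtain f where "den E v (S_tm e (Lam x \<alpha> T)) = ext f" "Fn (ext f) (D \<alpha>)" "\<forall>a\<in>D \<alpha>. ap f a = g a" by auto
  then show ?thesis using T by (intro bexI[of _ f]) (simp_all add: D_fun)
qed

text \<open>Vars may have any values, since \<open>S_tm\<close> replaces those outside the base set
  by the witness. Abstractions are elements by \<open>den_Lam\<close>, that is, by
  replacement.\<close>

lemma den_tm:
  assumes "ok v" "tyof A = Some \<alpha>"
  shows "\<exists>m\<in>D \<alpha>. den E v (S_tm e A) = ext m"
  using assms
proof (induction A arbitrary: v \<alpha>)
  case Tru
  then show ?case by (intro bexI[of _ one]) auto
next
  case (Ctx R S)
  then have "\<alpha> = TBool" by (auto split: if_splits)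
  then show ?case by (simp only: S_tm.simps den_toBool_bl) auto
next
  case (App F A)
  then obtain \<beta> where "tyof F = Some (\<beta> \<rightarrow>\<^sub>h \<alpha>)" "tyof A = Some \<beta>" by (auto simp only: tyof_app)
  then obtain f a where "f \<in> D (\<beta> \<rightarrow>\<^sub>h \<alpha>)" "a \<in> D \<beta>" "den E v (S_tm e F) = ext f" "den E v (S_tm e A) = ext a"
    using App by meson
  then show ?case using D_ap by (intro bexI[of _ "ap f a"]) auto
next
  case (Var x \<gamma>)
  then show ?case using den_base[OF \<open>ok v\<close>, of \<gamma>] by auto
next
  case (Lam x \<gamma> T)
  then obtain \<beta> where \<beta>: "tyof T = Some \<beta>" "\<alpha> = \<gamma> \<rightarrow>\<^sub>h \<beta>" by auto
  have "den E (v(HolVar x := a)) (S_tm e T) = ext (val (v(HolVar x := a)) T) \<and> val (v(HolVar x := a)) T \<in> D \<beta>" for a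
  proof -
    obtain m where "m \<in> D \<beta>" "den E (v(HolVar x := a)) (S_tm e T) = ext m"
      using Lam.IH[OF _ \<beta>(1)] Lam.prems(1) ok_upd by blast
    then show ?thesis by (simp add: val_def)
  qed
  from den_Lam[OF \<open>ok v\<close> this] show ?case using \<beta> by blast
next
  case (Equal \<gamma>)
  then show ?case using den_Equal[of v \<gamma>] by auto
next
  case (Eps \<gamma>)
  then show ?case using den_Eps[of v \<gamma>] by auto
next
  case (Const A)
  then show ?case by (auto split: if_splits)
qed

lemma den_val:
  assumes "ok v" "tyof A = Some \<alpha>"
  shows "den E v (S_tm e A) = ext (val v A)"
proof -
  obtain m where "den E v (S_tm e A) = ext m" using den_tm[OF assms] by blast
  then show ?thesis by (simp add: val_def)
qed

lemma val_in [simp]: "ok v \<Longrightarrow> tyof A = Some \<alpha> \<Longrightarrow> val v A \<in> D \<alpha>"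
  using den_tm[of v A \<alpha>] by (auto simp: val_def)

lemma val_Tru [simp]: "val v Tru = one"
  by (simp add: val_def)

lemma val_Ctx [simp]:
  "ok v \<Longrightarrow> tyof R = Some TBool \<Longrightarrow> tyof S = Some TBool \<Longrightarrow> val v (Ctx R S) = bl (val v R = one \<and> val v S = one)"
  using den_val[of v R TBool] den_val[of v S TBool] by (simp add: val_def[of v "Ctx R S"] den_toBool_bl del: den_toBool)

lemma val_app: "ok v \<Longrightarrow> tyof (F \<cdot> A) \<noteq> None \<Longrightarrow> val v (F \<cdot> A) = ap (val v F) (val v A)"
proof -
  assume a: "ok v" "tyof (F \<cdot> A) \<noteq> None"
  then obtain \<alpha> \<beta> where "tyof F = Some (\<beta> \<rightarrow>\<^sub>h \<alpha>)" "tyof A = Some \<beta>" by (auto simp only: tyof_app)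
  then have "den E v (S_tm e F) = ext (val v F)" "den E v (S_tm e A) = ext (val v A)"
    using den_val[OF a(1)] by blast+
  then show ?thesis by (simp add: val_def[of v "F \<cdot> A"])
qed

lemma val_Var: "ok v \<Longrightarrow> val v (Var x \<alpha>) = (if v (HolVar x) \<in> D \<alpha> then v (HolVar x) else W v0 \<alpha>)"
  using den_base[of v \<alpha>] by (simp add: val_def)

lemma val_Lam [simp]: "ok v \<Longrightarrow> tyof T \<noteq> None \<Longrightarrow> a \<in> D \<alpha> \<Longrightarrow> ap (val v (Lam x \<alpha> T)) a = val (v(HolVar x := a)) T"
proof -
  assume a: "ok v" "tyof T \<noteq> None" "a \<in> D \<alpha>"
  then obtain \<beta> where "tyof T = Some \<beta>" by auto
  then have "den E (v(HolVar x := a)) (S_tm e T) = ext (val (v(HolVar x := a)) T) \<and> val (v(HolVar x := a)) T \<in> D \<beta>" for a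
    using den_val val_in a(1) ok_upd by blast
  from den_Lam[OF a(1) this] obtain f where
    "den E v (S_tm e (Lam x \<alpha> T)) = ext f" "\<forall>a\<in>D \<alpha>. ap f a = val (v(HolVar x := a)) T" by blast
  then show ?thesis using a(3) by (simp add: val_def[of v "Lam x \<alpha> T"])
qed

lemma val_Equal [simp]: "ok v \<Longrightarrow> a \<in> D \<alpha> \<Longrightarrow> c \<in> D \<alpha> \<Longrightarrow> ap (ap (val v (Equal \<alpha>)) a) c = bl (a = c)"
  using den_Equal[of v \<alpha>] by (auto simp: val_def simp del: S_tm.simps)

lemma val_Eps: "ok v \<Longrightarrow> p \<in> D (\<alpha> \<rightarrow>\<^sub>h TBool) \<Longrightarrow> x \<in> D \<alpha> \<Longrightarrow> ap p x = one \<Longrightarrow> ap p (ap (val v (Eps \<alpha>)) p) = one"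
  using den_Eps[of v \<alpha>] by (auto simp: val_def simp del: S_tm.simps)

lemma val_Const: "val v (Const A) = val v A"
  by (simp add: val_def)

lemma val_heq [simp]: "ok v \<Longrightarrow> tyof A = Some \<alpha> \<Longrightarrow> tyof C = Some \<alpha> \<Longrightarrow> val v (heq \<alpha> A C) = bl (val v A = val v C)"
  by (simp add: val_app)

lemma val_beta: "ok v \<Longrightarrow> tyof T \<noteq> None \<Longrightarrow> tyof A = Some \<alpha> \<Longrightarrow> val v (Lam x \<alpha> T \<cdot> A) = val (v(HolVar x := val v A)) T"
  by (auto simp: val_app)

lemma val_cong:
  assumes "ok v" "ok w" "tyof A \<noteq> None" "\<And>x \<gamma>. (x, \<gamma>) \<in> hfree A \<Longrightarrow> val v (Var x \<gamma>) = val w (Var x \<gamma>)"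
  shows "val v A = val w A"
proof -
  have "den E v (S_tm e A) = den E w (S_tm e A)"
  proof (rule den_S_tm_cong[OF assms(3)])
    show "v (HolTyp a) = w (HolTyp a)" for a using assms by (simp add: ok_def)
    show "eps_free A \<or> v e = w e" using assms by (simp add: ok_def)
    fix x \<gamma> assume "(x, \<gamma>) \<in> hfree A"
    from assms(4)[OF this] show "den E v (S_tm e (Var x \<gamma>)) = den E w (S_tm e (Var x \<gamma>))"
      using den_val[OF assms(1), of "Var x \<gamma>"] den_val[OF assms(2), of "Var x \<gamma>"] by simp
  qed
  then show ?thesis by (simp add: val_def)
qed

lemma val_upd:
  assumes "ok v" "tyof A \<noteq> None" "x \<notin> hvars A"
  shows "val (v(HolVar x := a)) A = val v A"
proof (rule val_cong)
  fix y \<gamma> assume "(y, \<gamma>) \<in> hfree A"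
  then have "y \<noteq> x" using hfree_hvars assms(3) by blast
  then show "val (v(HolVar x := a)) (Var y \<gamma>) = val v (Var y \<gamma>)" using assms(1) by (simp add: val_Var)
qed (use assms in simp_all)

section \<open>The logical constants\<close>

lemma val_hal [simp]: "ok v \<Longrightarrow> p \<in> D (\<alpha> \<rightarrow>\<^sub>h TBool) \<Longrightarrow> ap (val v (hal \<alpha>)) p = bl (\<forall>a\<in>D \<alpha>. ap p a = one)"
proof -
  assume a: "ok v" "p \<in> D (\<alpha> \<rightarrow>\<^sub>h TBool)"
  have "ap (val v (hal \<alpha>)) p = bl (p = val (v(HolVar 0 := p)) (Lam 1 \<alpha> Tru))"
    using a by (simp add: hal_def val_Const val_Var)
  also have "p = val (v(HolVar 0 := p)) (Lam 1 \<alpha> Tru) \<longleftrightarrow> (\<forall>a\<in>D \<alpha>. ap p a = one)"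
    using a by (subst D_ext[OF a(2) val_in]) simp_all
  finally show ?thesis .
qed

lemma val_hfal [simp]: "ok v \<Longrightarrow> val v hfal = zero"
  by (auto simp: hfal_def val_Const val_app val_Var D_bool)

lemma val_han [simp]:
  assumes v: "ok v" and pq: "p \<in> D TBool" "q \<in> D TBool"
  shows "ap (ap (val v han) p) q = bl (p = one \<and> q = one)"
proof -
  let ?\<beta> = "TBool \<rightarrow>\<^sub>h TBool \<rightarrow>\<^sub>h TBool"
  let ?v = "v(HolVar 0 := p, HolVar 1 := q)"
  let ?L = "Lam 2 ?\<beta> (Var 2 ?\<beta> \<cdot> Var 0 TBool \<cdot> Var 1 TBool)" and ?R = "Lam 2 ?\<beta> (Var 2 ?\<beta> \<cdot> Tru \<cdot> Tru)"
  have "ap (ap (val v han) p) q = bl (val ?v ?L = val ?v ?R)"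
    using v pq by (simp add: han_def Let_def val_Const)
  also have "val ?v ?L = val ?v ?R \<longleftrightarrow> (\<forall>f\<in>D ?\<beta>. ap (ap f p) q = ap (ap f one) one)"
    using v pq by (subst D_ext[of _ ?\<beta> TBool]) (simp_all add: val_app val_Var)
  also have "\<dots> \<longleftrightarrow> p = one \<and> q = one"
  proof
    assume a: "\<forall>f\<in>D ?\<beta>. ap (ap f p) q = ap (ap f one) one"
    \<comment> \<open>apply both sides to the two projections\<close>
    have "val v (Lam 0 TBool (Lam 1 TBool (Var 0 TBool))) \<in> D ?\<beta>" "val v (Lam 0 TBool (Lam 1 TBool (Var 1 TBool))) \<in> D ?\<beta>"
      using v by simp_all
    from a[rule_format, OF this(1)] a[rule_format, OF this(2)] show "p = one \<and> q = one"
      using v pq by (simp add: val_Var)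
  qed simp
  finally show ?thesis .
qed

lemma val_him [simp]:
  assumes v: "ok v" and pq: "p \<in> D TBool" "q \<in> D TBool"
  shows "ap (ap (val v him) p) q = bl (p = one \<longrightarrow> q = one)"
proof -
  have "ap (ap (val v him) p) q = bl (bl (p = one \<and> q = one) = p)"
    using v pq by (simp add: him_def val_Const val_app val_Var)
  also have "bl (p = one \<and> q = one) = p \<longleftrightarrow> (p = one \<longrightarrow> q = one)" using pq by (auto simp: D_bool bl_def)
  finally show ?thesis .
qed

lemma val_hnot [simp]: "ok v \<Longrightarrow> p \<in> D TBool \<Longrightarrow> ap (val v hnot) p = bl (p \<noteq> one)"
  by (simp add: hnot_def val_Const val_app val_Var)

lemma val_hex [simp]:
  assumes v: "ok v" and p: "p \<in> D (\<alpha> \<rightarrow>\<^sub>h TBool)"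
  shows "ap (val v (hex \<alpha>)) p = bl (\<exists>a\<in>D \<alpha>. ap p a = one)"
proof -
  have "ap (val v (hex \<alpha>)) p = bl (\<forall>q\<in>D TBool. (\<forall>a\<in>D \<alpha>. ap p a = one \<longrightarrow> q = one) \<longrightarrow> q = one)"
    using v p by (simp add: hex_def val_Const val_app val_Var D_ap)
  \<comment> \<open>The case q = zero says that not every a falsifies p.\<close>
  also have "(\<forall>q\<in>D TBool. (\<forall>a\<in>D \<alpha>. ap p a = one \<longrightarrow> q = one) \<longrightarrow> q = one) \<longleftrightarrow> (\<exists>a\<in>D \<alpha>. ap p a = one)"
    by (auto simp: D_bool)
  finally show ?thesis .
qed

lemma val_hinj [simp]:
  "ok v \<Longrightarrow> f \<in> D (\<alpha> \<rightarrow>\<^sub>h \<beta>) \<Longrightarrow>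
    ap (val v (hinj \<alpha> \<beta>)) f = bl (\<forall>a\<in>D \<alpha>. \<forall>c\<in>D \<alpha>. ap f a = ap f c \<longrightarrow> a = c)"
  by (simp add: hinj_def Let_def val_Const val_app val_Var D_ap)

lemma val_hsurj [simp]:
  "ok v \<Longrightarrow> f \<in> D (\<alpha> \<rightarrow>\<^sub>h \<beta>) \<Longrightarrow>
    ap (val v (hsurj \<alpha> \<beta>)) f = bl (\<forall>c\<in>D \<beta>. \<exists>a\<in>D \<alpha>. c = ap f a)"
  by (simp add: hsurj_def Let_def val_Const val_app val_Var D_ap)

end

section \<open>Soundness of hol.mm\<close>

lemma holmm_heqD:
  "holmm (R \<turnstile>\<^sub>h heq \<alpha> A C) \<Longrightarrow> tyof R = Some TBool \<and> tyof A = Some \<alpha> \<and> tyof C = Some \<alpha>"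
  "holmm (heq \<alpha> A C \<turnstile>\<^sub>h S) \<Longrightarrow> tyof S = Some TBool \<and> tyof A = Some \<alpha> \<and> tyof C = Some \<alpha>"
  by (auto dest!: holmm_typed simp del: tyof.simps(3))

context hol_model
begin

text \<open>Typing judgements are the concern of \<open>typed\<close>; semantic content is attached
  to entailments.\<close>

primrec valid :: "judgement \<Rightarrow> bool"
  where
    "valid (IsType \<alpha>) = True"
  | "valid (A :\<^sub>h \<alpha>) = True"
  | "valid (R \<turnstile>\<^sub>h S) = (\<forall>v. ok v \<longrightarrow> val v R = one \<longrightarrow> val v S = one)"
  | "valid (TypeDef \<alpha> \<beta> A R F C) = True"

lemma suc_inj: "suc a = suc c \<longleftrightarrow> a = c"
proof
  assume "suc a = suc c"
  then have "insert a (ext a) = insert c (ext c)" by (metis ext_suc)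
  then show "a = c" using no_cycle2 by (metis insert_iff)
qed simp

text \<open>The witness for the axiom of infinity; replacement makes it an element of the
  model.\<close>

lemma successor_map: "\<exists>f\<in>D (TInd \<rightarrow>\<^sub>h TInd). \<forall>a\<in>D TInd. ap f a = suc a"
proof -
  have "isset (gr (ext om) suc)"
    by (rule gr_isset[of om v0 "Aux 0" "csuc (cv (Aux 0))"]) simp
  then obtain f where f: "ext f = gr (ext om) suc" by (metis issetE)
  have "f \<in> ext (maps om om)" by (rule gr_in_maps(1)[OF f]) (rule suc_om)
  moreover have "ap f a = suc a" if "a \<in> ext om" for a
    by (rule gr_in_maps(2)[OF f suc_om that])
  ultimately show ?thesis by (auto simp: D_def B_props(5,7)[OF tyok])
qed

lemma infinity_valid:
  assumes "ok v"
  shows "val v (hex (TInd \<rightarrow>\<^sub>h TInd) \<cdot> Lam f (TInd \<rightarrow>\<^sub>h TInd)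
      (han \<cdot> (hinj TInd TInd \<cdot> Var f (TInd \<rightarrow>\<^sub>h TInd))
           \<cdot> (hnot \<cdot> (hsurj TInd TInd \<cdot> Var f (TInd \<rightarrow>\<^sub>h TInd))))) = one"
proof -
  obtain s where s: "s \<in> D (TInd \<rightarrow>\<^sub>h TInd)" "\<And>a. a \<in> D TInd \<Longrightarrow> ap s a = suc a"
    using successor_map by blast
  have z: "zero \<in> D TInd" by (simp add: D_ind zero_om)
  have "zero \<noteq> suc a" for a by (metis empty_not_insert ext_suc ext_zero)
  then have "\<not> (\<forall>c\<in>D TInd. \<exists>a\<in>D TInd. c = ap s a)" using z s(2) by auto
  moreover have "\<forall>a\<in>D TInd. \<forall>c\<in>D TInd. ap s a = ap s c \<longrightarrow> a = c" using s(2) suc_inj by auto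
  ultimately show ?thesis using assms s(1) by (simp add: val_app val_Var) blast
qed

text \<open>Validity ranges over all \<open>ok\<close> assignments, so a premise may be used after
  changing the value of a var, as \<open>leq\<close> and \<open>inst\<close> require.\<close>

lemma holmm_valid: "holmm J \<Longrightarrow> valid J"
proof (induction rule: holmm.induct)
  case (df_const C \<alpha>)
  then show ?case using holmm_typed[OF df_const(1)] by (simp add: val_Const)
next
  case (jca R S T)
  then show ?case using holmm_typed[OF jca(1)] holmm_typed[OF jca(2)] by simp
next
  case (simpl R S)
  then show ?case using holmm_typed[OF simpl(1)] holmm_typed[OF simpl(2)] by simp
next
  case (simpr R S)
  then show ?case using holmm_typed[OF simpr(1)] holmm_typed[OF simpr(2)] by simp
next
  case (refl A \<alpha>)
  then show ?case using holmm_typed[OF refl(1)] by simp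
next
  case (eqmp R A C)
  then show ?case using holmm_heqD(1)[OF eqmp(2)] by simp
next
  case (ded R S T)
  have t: "tyof R = Some TBool" "tyof S = Some TBool" "tyof T = Some TBool"
    using holmm_typed[OF ded(1)] holmm_typed[OF ded(2)] by (auto split: if_splits)
  \<comment> \<open>There are just two truth values, so equivalence is equality.\<close>
  have "val v S = val v T" if v: "ok v" "val v R = one" for v
  proof -
    have "val v S = one \<longleftrightarrow> val v T = one" using ded.IH v t by auto
    moreover have "val v S \<in> D TBool" "val v T \<in> D TBool" using v t by simp_all
    ultimately show ?thesis by (auto simp: D_bool)
  qed
  then show ?case using t by simp
next
  case (ceq F \<alpha> \<beta> A R G C)
  have t: "tyof F = Some (\<alpha> \<rightarrow>\<^sub>h \<beta>)" "tyof G = Some (\<alpha> \<rightarrow>\<^sub>h \<beta>)" "tyof A = Some \<alpha>" "tyof C = Some \<alpha>"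
    using holmm_heqD(1)[OF ceq(3)] holmm_heqD(1)[OF ceq(4)] by simp_all
  then have "val v (F \<cdot> A) = val v (G \<cdot> C)" if "ok v" "val v R = one" for v
    using ceq.IH that by (simp add: val_app)
  then show ?case using t by simp
next
  case (leq R \<beta> A C x \<alpha>)
  have t: "tyof R = Some TBool" "tyof A = Some \<beta>" "tyof C = Some \<beta>"
    using holmm_heqD(1)[OF leq(1)] by simp_all
  have "val v (Lam x \<alpha> A) = val v (Lam x \<alpha> C)" if v: "ok v" "val v R = one" for v
  proof (subst D_ext[of _ \<alpha> \<beta>])
    show "val v (Lam x \<alpha> A) \<in> D (\<alpha> \<rightarrow>\<^sub>h \<beta>)" "val v (Lam x \<alpha> C) \<in> D (\<alpha> \<rightarrow>\<^sub>h \<beta>)" using v t by simp_all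
    have "val (v(HolVar x := a)) R = one" for a using val_upd v t leq.hyps by simp
    then have "val (v(HolVar x := a)) A = val (v(HolVar x := a)) C" for a
      using leq.IH v t by simp
    then show "\<forall>a\<in>D \<alpha>. ap (val v (Lam x \<alpha> A)) a = ap (val v (Lam x \<alpha> C)) a" using v t by simp
  qed
  then show ?case using t by simp
next
  case (hbl1 A \<gamma> C \<alpha> \<beta> x)
  have t: "tyof A = Some \<gamma>" "tyof C = Some \<alpha>" using holmm_typed[OF hbl1(1)] holmm_typed[OF hbl1(2)] by simp_all
  have "val v (Lam x \<alpha> (Lam x \<beta> A) \<cdot> C) = val v (Lam x \<beta> A)" if v: "ok v" for v
  proof -
    have "val v (Lam x \<alpha> (Lam x \<beta> A) \<cdot> C) = val (v(HolVar x := val v C)) (Lam x \<beta> A)"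
      using v t by (simp add: val_beta)
    \<comment> \<open>The inner binding of x overwrites the value given by the outer one.\<close>
    also have "\<dots> = val v (Lam x \<beta> A)"
      using v t by (subst D_ext[of _ \<beta> \<gamma>]) simp_all
    finally show ?thesis .
  qed
  then show ?case using t by simp
next
  case (distrc C \<alpha> F \<beta> \<gamma> A x)
  have t: "tyof F = Some (\<beta> \<rightarrow>\<^sub>h \<gamma>)" "tyof C = Some \<alpha>" "tyof A = Some \<beta>"
    using holmm_typed[OF distrc(1)] holmm_typed[OF distrc(2)] holmm_typed[OF distrc(3)] by simp_all
  then have "val v (Lam x \<alpha> (F \<cdot> A) \<cdot> C) = val v ((Lam x \<alpha> F \<cdot> C) \<cdot> (Lam x \<alpha> A \<cdot> C))" if "ok v" for v
    using that by (simp add: val_app)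
  then show ?case using t by simp
next
  case (ax_17 A \<beta> C \<alpha> x)
  have t: "tyof A = Some \<beta>" "tyof C = Some \<alpha>" using holmm_typed[OF ax_17(1)] holmm_typed[OF ax_17(2)] by simp_all
  then show ?case using ax_17.hyps by (simp add: val_beta val_upd)
next
  case (distrl A \<gamma> C \<alpha> y x \<beta>)
  have t: "tyof A = Some \<gamma>" "tyof C = Some \<alpha>" using holmm_typed[OF distrl(1)] holmm_typed[OF distrl(2)] by simp_all
  have "val v (Lam x \<alpha> (Lam y \<beta> A) \<cdot> C) = val v (Lam y \<beta> (Lam x \<alpha> A \<cdot> C))" if v: "ok v" for v
  proof -
    have u: "val (v(HolVar y := b)) C = val v C" for b using v t distrl.hyps by (simp add: val_upd)
    have c: "v(HolVar x := a, HolVar y := b) = v(HolVar y := b, HolVar x := a)" for a b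
      using distrl.hyps by (simp add: fun_upd_twist)
    have "val v (Lam x \<alpha> (Lam y \<beta> A) \<cdot> C) = val (v(HolVar x := val v C)) (Lam y \<beta> A)"
      using v t by (simp add: val_beta)
    also have "\<dots> = val v (Lam y \<beta> (Lam x \<alpha> A \<cdot> C))"
      using v t by (subst D_ext[of _ \<beta> \<gamma>]) (simp_all add: val_beta u c)
    finally show ?thesis .
  qed
  then show ?case using t by simp
next
  case (beta A \<beta> x \<alpha>)
  have t: "tyof A = Some \<beta>" using holmm_typed[OF beta(1)] by simp
  have "val v (Lam x \<alpha> A \<cdot> Var x \<alpha>) = val v A" if v: "ok v" for v
  proof -
    have "val v (Lam x \<alpha> A \<cdot> Var x \<alpha>) = val (v(HolVar x := val v (Var x \<alpha>))) A"
      using v t by (simp add: val_beta)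
    \<comment> \<open>A value of \<open>x\<close> outside the base set of \<open>\<alpha>\<close> gets replaced by the witness of \<open>\<alpha>\<close>; by the proviso
      this is how \<open>A\<close> reads it anyway.\<close>
    also have "\<dots> = val v A"
    proof (rule val_cong)
      fix y \<gamma> assume y: "(y, \<gamma>) \<in> hfree A"
      have "val v (Var x \<alpha>) \<in> D \<alpha>" using v by simp
      then show "val (v(HolVar x := val v (Var x \<alpha>))) (Var y \<gamma>) = val v (Var y \<gamma>)"
        using beta.hyps y v by (cases "y = x") (auto simp: val_Var)
    qed (use v t in simp_all)
    finally show ?thesis .
  qed
  then show ?case using t by simp
next
  case (inst x \<alpha> C y S T A R)
  have t: "tyof C = Some TBool" "tyof S = Some TBool" "tyof T = Some \<alpha>" "tyof A = Some TBool" "tyof R = Some TBool"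
    using holmm_heqD(1)[OF inst(1)] holmm_heqD(1)[OF inst(2)] holmm_heqD(1)[OF inst(4)] holmm_heqD(1)[OF inst(3)]
      holmm_heqD(2)[OF inst(3)] by simp_all
  have "val v C = one" if v: "ok v" "val v S = one" for v
  proof -
    let ?w = "v(HolVar x := val v T)" and ?y = "val v (Var y \<alpha>)"
    have yx: "val ?w (Var y \<alpha>) = ?y" using inst.hyps v by (simp add: val_Var)
    \<comment> \<open>the first two premises say that \<open>C\<close> and \<open>S\<close> do not depend on \<open>x\<close>, as \<open>y\<close> has the same value on both sides\<close>
    have i: "val (v'(HolVar x := val v' (Var y \<alpha>))) Q = val v' Q" if "ok v'" "Q = C \<or> Q = S" for v' Q
      using that inst.IH(1,2) t by (auto simp: val_beta)
    have *: "val ?w Q = val v Q" if "Q = C \<or> Q = S" for Q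
      using i[of v Q] i[of ?w Q] that v yx by simp
    have "val ?w T = val v T" using v t inst.hyps by (simp add: val_upd)
    moreover have "val v T \<in> D \<alpha>" using v t by simp
    ultimately have eq: "val ?w (heq \<alpha> (Var x \<alpha>) T) = one" using v t by (simp add: val_Var)
    then have w: "val ?w A = val ?w C" "val ?w R = val ?w S"
      using inst.IH(3,4) v t ok_upd by auto
    have "val ?w R = one" using w(2) *[of S] v by simp
    then have "val ?w A = one" using inst.IH(5) v by simp
    then show ?thesis using w(1) *[of C] by simp
  qed
  then show ?case by simp
next
  case (eta f x \<alpha> \<beta>)
  have "val (v(HolVar f := g)) (Lam x \<alpha> (Var f (\<alpha> \<rightarrow>\<^sub>h \<beta>) \<cdot> Var x \<alpha>)) = g"
    if "ok v" "g \<in> D (\<alpha> \<rightarrow>\<^sub>h \<beta>)" for v g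
    using that eta by (subst D_ext[of _ \<alpha> \<beta>]) (simp_all add: val_app val_Var)
  then show ?case by (simp add: val_app val_Var)
next
  case (ac p x \<alpha>)
  have "ap q (ap (val v (Eps \<alpha>)) q) = one"
    if "ok v" "q \<in> D (\<alpha> \<rightarrow>\<^sub>h TBool)" "a \<in> D \<alpha>" "ap q a = one" for v q a
    using val_Eps that by blast
  moreover have "ap (val v (Eps \<alpha>)) q \<in> D \<alpha>" if "ok v" "q \<in> D (\<alpha> \<rightarrow>\<^sub>h TBool)" for v q
    by (rule D_ap[of _ "\<alpha> \<rightarrow>\<^sub>h TBool"]) (use that in simp_all)
  ultimately show ?case using ac by (simp add: val_app val_Var D_ap)
next
  case (infinity f)
  then show ?case using infinity_valid by simp
qed simp_all

end

section \<open>From soundness in the models to derivability in set.mm\<close>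

lemma (in set_model) entailment:
  assumes h: "holmm (A \<turnstile>\<^sub>h C)"
    and ty: "\<And>a. a \<in> tvars A \<union> tvars C \<Longrightarrow> v (HolTyp a) \<in> {opr i b | i b. b \<in> ext V \<and> i \<in> ext b}"
    and ch: "is_choice (v (Aux n))" and A: "den E v (S_tm (Aux n) A) = ext one"
  shows "den E v (S_tm (Aux n) C) = ext one"
proof -
  \<comment> \<open>the type variables outside the judgement may occur in its derivation; they are read as \<open>ind\<close>\<close>
  define v0 where "v0 s = (case s of HolTyp a \<Rightarrow> if a \<in> tvars A \<union> tvars C then v s else opr zero om | _ \<Rightarrow> v s)" for s
  have v0: "v0 (HolTyp a) = (if a \<in> tvars A \<union> tvars C then v (HolTyp a) else opr zero om)"
    "v0 (HolVar x) = v (HolVar x)" "v0 (Aux k) = v (Aux k)" for a x k by (simp_all add: v0_def)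
  have t: "tyof A = Some TBool" "tyof C = Some TBool" using holmm_typed[OF h] by simp_all
  interpret hol_model E n v0
  proof
    show "tyok v0" unfolding tyok_def
    proof
      fix a
      show "v0 (HolTyp a) \<in> {opr i b | i b. b \<in> ext V \<and> i \<in> ext b}"
      proof (cases "a \<in> tvars A \<union> tvars C")
        case True
        then show ?thesis using ty v0(1) by simp
      next
        case False
        then show ?thesis using V_props(2) zero_om v0(1) by auto
      qed
    qed
    show "is_choice (v0 (Aux n))" using ch v0 by simp
  qed
  have eq: "den E v (S_tm (Aux n) Q) = den E v0 (S_tm (Aux n) Q)" if Q: "Q = A \<or> Q = C" for Q
  proof (rule den_S_tm_cong)
    show "tyof Q \<noteq> None" using Q t by auto
    show T: "v (HolTyp a) = v0 (HolTyp a)" if "a \<in> tvars Q" for a using that Q v0 by auto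
    show "eps_free Q \<or> v (Aux n) = v0 (Aux n)" using v0 by simp
    fix x \<gamma> assume x: "(x, \<gamma>) \<in> hfree Q"
    have "den E v (base \<gamma>) = den E v0 (base \<gamma>)" "den E v (wit \<gamma>) = den E v0 (wit \<gamma>)"
      by (rule den_base_cong; use T hfree_tvars[OF x] in blast)+
    then show "den E v (S_tm (Aux n) (Var x \<gamma>)) = den E v0 (S_tm (Aux n) (Var x \<gamma>))"
      using v0 by (simp cong: if_cong)
  qed
  have ok: "ok v0" by (simp add: ok_def)
  then have "val v0 A = one" using A eq[of A] by (simp add: val_def)
  then have "val v0 C = one" using holmm_valid[OF h] ok by simp
  then show ?thesis using eq[of C] den_val[OF ok t(2)] by simp
qed

lemma sat_under_types:
  assumes "finite I"
  shows "sat E v (under_types I \<phi>) \<longleftrightarrow> ((\<forall>a\<in>I. sat E v (S_ty (TVar a) \<^bold>\<in> cType)) \<longrightarrow> sat E v \<phi>)"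
proof -
  have "sat E v (foldr (\<lambda>a \<psi>. S_ty (TVar a) \<^bold>\<in> cType \<^bold>\<rightarrow> \<psi>) xs \<phi>) \<longleftrightarrow>
      ((\<forall>a\<in>set xs. sat E v (S_ty (TVar a) \<^bold>\<in> cType)) \<longrightarrow> sat E v \<phi>)" for xs
    by (induction xs) auto
  then show ?thesis using assms by (simp add: under_types_def)
qed

lemma finite_ty_tvars [simp]: "finite (ty_tvars \<alpha>)"
  by (induction \<alpha>) auto

lemma finite_tvars [simp]: "finite (tvars A)"
  by (induction A) auto

text \<open>The class terms themselves coincide, since e enters the translation at the descriptor
  only.\<close>

lemma S_tm_eps_free: "eps_free A \<Longrightarrow> S_tm e A = S_tm e' A"
  by (induction A) (auto simp: Let_def)

theorem theorem3p2:
  fixes A B :: tm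
  assumes "holmm (A \<turnstile>\<^sub>h B)"
  shows "(\<forall>n. setmm (under_types (tvars A \<union> tvars B) (S_judgement (Aux n) (A \<turnstile>\<^sub>h B)))) \<and>
    (eps_free A \<and> eps_free B \<longrightarrow>
      (\<forall>e e'. S_tm e A = S_tm e' A \<and> S_tm e B = S_tm e' B) \<and>
      (\<forall>e. setmm (under_types (tvars A \<union> tvars B)
        (toWff (S_tm e A) \<^bold>\<rightarrow> toWff (S_tm e B)))))"
proof (intro conjI allI impI)
  fix n
  show "setmm (under_types (tvars A \<union> tvars B) (S_judgement (Aux n) (A \<turnstile>\<^sub>h B)))"
  proof (rule completeness)
    fix E :: "nat \<Rightarrow> nat \<Rightarrow> bool" and v
    assume "inj (\<lambda>m. {a. E a m})" and "\<And>\<psi> w. setmm \<psi> \<Longrightarrow> sat E w \<psi>"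
    then interpret set_model E by unfold_locales
    show "sat E v (under_types (tvars A \<union> tvars B) (S_judgement (Aux n) (A \<turnstile>\<^sub>h B)))"
      using entailment[OF assms, of v n] by (simp add: sat_under_types)
  qed
next
  fix e e'
  assume "eps_free A \<and> eps_free B"
  then show "S_tm e A = S_tm e' A" "S_tm e B = S_tm e' B" using S_tm_eps_free by blast+
next
  fix e
  assume ef: "eps_free A \<and> eps_free B"
  \<comment> \<open>An arbitrary e could coincide with a set variable that stands for a var;
    \<open>Aux 0\<close> cannot.\<close>
  have e: "S_tm e A = S_tm (Aux 0) A" "S_tm e B = S_tm (Aux 0) B" using ef S_tm_eps_free by blast+
  show "setmm (under_types (tvars A \<union> tvars B) (toWff (S_tm e A) \<^bold>\<rightarrow> toWff (S_tm e B)))"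
    unfolding e
  proof (rule completeness)
    fix E :: "nat \<Rightarrow> nat \<Rightarrow> bool" and v
    assume "inj (\<lambda>m. {a. E a m})" and "\<And>\<psi> w. setmm \<psi> \<Longrightarrow> sat E w \<psi>"
    then interpret set_model E by unfold_locales
    obtain c where c: "is_choice c" using choice_exists by blast
    \<comment> \<open>Without the antecedent \<open>Ch\<close>, the value of \<open>Aux 0\<close>
      under v need not be a choice function. It is exchanged for one, which leaves the denotations
      of the descriptor-free A and B unchanged.\<close>
    let ?v = "v(Aux 0 := c)"
    have "den E ?v (S_tm (Aux 0) Q) = den E v (S_tm (Aux 0) Q)" if "Q = A \<or> Q = B" for Q
    proof (rule den_S_tm_cong)
      show "tyof Q \<noteq> None" using holmm_typed[OF assms] that by auto
      show "eps_free Q \<or> ?v (Aux 0) = v (Aux 0)" using that ef by auto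
    qed simp_all
    then show "sat E v (under_types (tvars A \<union> tvars B) (toWff (S_tm (Aux 0) A) \<^bold>\<rightarrow> toWff (S_tm (Aux 0) B)))"
      using entailment[OF assms, of ?v 0] c by (simp add: sat_under_types)
  qed
qed

end
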